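(* Consider a graphon game $\mathcal G(\mathcal A_{ad}^\infty,U,\theta,W)$ in which the players have homogeneous action sets, i.e. $\mathcal A^x=\mathcal A^0$ for all $x\in[0,1]$. Suppose that: (A1) For all $\tilde z,\tilde\theta\in\mathcal A$, $\tilde a\mapsto U(\tilde a,\tilde z,\tilde\theta)$ is continuously Gâteaux differentiable and $U(\tilde a,\tilde z,\tilde\theta)+\frac{\alpha_U}{2}\|\tilde a\|_{\mathcal A}^2$ is concave in $\tilde a$, with $\alpha_U>0$; and $\nabla_{\tilde a}U(\cdot,\tilde z,\tilde\theta)$ is Lipschitz in $\tilde z,\tilde\theta$ with constants $\ell_U,\ell_\theta$, i.e. $\|\nabla_{\tilde a}U(\tilde a,\tilde z_1,\tilde\theta_1)-\nabla_{\tilde a}U(\tilde a,\tilde z_2,\tilde\theta_2)\|_{\mathcal A}\le \ell_U\|\tilde z_1-\tilde z_2\|_{\mathcal A}+\ell_\theta\|\tilde\theta_1-\tilde\theta_2\|_{\mathcal A}$. (A2) $\mathcal A^0$ is nonempty, convex and closed, and there exist $\tilde z_0,\tilde\theta_0\in\mathcal A$ such that $(\arg\max_{\tilde a\in\mathcal A^x}U(\tilde a,\tilde z_0,\tilde\theta_0))_{x\in[0,1]}\in\mathcal A^\infty$. (A3) There is a constant $M$ such that $\mathcal A^0\subset\mathcal A_M:=\{\tilde a\in\mathcal A:\|\tilde a\|_{\mathcal A}\le M\}$. (A4) $\ell_U\lambda_1(\boldsymbol W)<\alpha_U$. Denote by $\bar a$ the unique Nash equilibrium of this graphon game. Consider a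 sequence of graphs with symmetric adjacency matrices $G^N\in[0,1]^{N\times N}$, $N\in\mathbb N$, that converges to $W$ in cut norm, i.e. $\|W-W_{G^N}\|_\Box\to0$ as $N\to\infty$. For each $N$ let $\theta^N\in\mathcal A^N$ be a vector of heterogeneity processes with associated step function profile $\theta^N_{\mathrm{step}}$, and assume $\|\theta-\theta^N_{\mathrm{step}}\|_{\mathcal A^\infty}\to0$ as $N\to\infty$. Then there exists $N_0\in\mathbb N$ such that the network game $\mathcal G((\mathcal A^0)^N,U,\theta^N,G^N)$ admits a unique Nash equilibrium $\bar a^N$ for all $N\ge N_0$. Moreover, for all $N\ge N_0$, $$\|\bar a-\bar a^N_{\mathrm{step}}\|_{\mathcal A^\infty}\le C_W\|W-W_{G^N}\|_\Box^{1/2}+C_\theta\|\theta-\theta^N_{\mathrm{step}}\|_{\mathcal A^\infty}\xrightarrow{N\to\infty}0,$$ where $\bar a^N_{\mathrm{step}}$ is the step function action profile corresponding to $\bar a^N$ and $$C_W:=\frac{\sqrt8\,\ell_UM}{\alpha_U-\ell_U\lambda_1(\boldsymbol W)},\qquad C_\theta:=\frac{\ell_\theta}{\alpha_U-\ell_U\lambda_1(\boldsymbol W)}.$$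
   Context: Probabilistic setting. Fix $T>0$, a probability space $(\Omega,\mathcal F,\mathbb P)$, a probability space $([0,1],\mathcal I,\nu)$ extending the Lebesgue space on $[0,1]$, and a rich Fubini extension $([0,1]\times\Omega,\mathcal I\boxtimes\mathcal F,\nu\boxtimes\mathbb P)$ of the product space (an extension on which Fubini's theorem holds for all integrable functions and which supports essentially pairwise independent families of processes). Write $dx$ for $\nu(dx)$. $\mathbb F=(\mathcal F_t)_{0\le t\le T}$ is the augmentation of the filtration generated by $(\theta^x)_{x\in[0,1]}$; the augmented filtrations generated by the finite-player heterogeneity processes are assumed to be contained in $\mathbb F$. $\mathcal A$ is the Hilbert space of $\mathbb F$-progressively measurable $\tilde a:\Omega\times[0,T]\to\mathbb R$ with $\|\tilde a\|_{\mathcal A}^2=\int_0^T\mathbb E[\tilde a_t^2]dt<\infty$. An action profile is a family $a=(a^x)_{x\in[0,1]}$, $a^x\in\mathcal A$, with $(x,t,\omega)\mapsto a^x_t(\omega)$ being $\mathcal I\otimes\mathcal B([0,T])\otimes\mathcal F$-measurable; $\mathcal A^\infty$ is the Hilbert space of action profiles with $\|a\|_{\mathcal A^\infty}^2=\int_0^1\int_0^T\mathbb E[(a_t^x)^2]dtdx<\infty$. $U:\mathcal A^3\to\mathbb R$ is a given utility functional. Graphon game $\mathcal G(\mathcal A_{ad}^\infty,U,\theta,W)$: $\theta\in\mathcal A^\infty$; $W$ is a graphon (symmetric measurable $[0,1]^2\to[0,1]$); $(\boldsymbol Wf)(x)=\int_0^1W(x,y)f(y)dy$ on $L^2([0,1],\mathbb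 R)$ (also applied to $\mathcal A^\infty$); $\lambda_1(\boldsymbol W)$ is its largest eigenvalue; $\mathcal A_{ad}^\infty=\{a\in\mathcal A^\infty:a^x\in\mathcal A^x\ \forall x\}$. A Nash equilibrium is $\bar a\in\mathcal A_{ad}^\infty$ with $\bar a^x=\arg\max_{\tilde a\in\mathcal A^x}U(\tilde a,(\boldsymbol W\bar a)(x),\theta^x)$ for every $x\in[0,1]$. (Under (A1), (A2), (A4) it exists and is unique.) Network game $\mathcal G((\mathcal A^0)^N,U,\theta^N,G^N)$: a Nash equilibrium is $\bar a^N\in(\mathcal A^0)^N$ with $\bar a^{i,N}=\arg\max_{\tilde a\in\mathcal A^0}U(\tilde a,\frac1N\sum_jG^N_{ij}\bar a^{j,N},\theta^{i,N})$ for all $i$. Step objects. $\mathcal P_i^N=[\frac{i-1}N,\frac iN)$ for $i<N$, $\mathcal P_N^N=[\frac{N-1}N,1]$. For $a^N\in\mathcal A^N$, $a^N_{\mathrm{step}}\in\mathcal A^\infty$ is $a^{x,N}_{\mathrm{step}}=a^{i,N}$ for $x\in\mathcal P_i^N$. The step graphon is $W_{G^N}(x,y)=G^N_{ij}$ for $(x,y)\in\mathcal P_i^N\times\mathcal P_j^N$. Cut norm of a bounded symmetric measurable kernel: $\|W\|_\Box=\sup_{S_1,S_2\subset[0,1]\text{ Borel}}|\int_{S_1}\int_{S_2}W(x,y)dxdy|$. *)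

theory Defs
  imports "HOL-Probability.Probability"
begin

section \<open>The probabilistic setting\<close>

text \<open>A process is written \<open>a t \<omega>\<close>, an action profile \<open>a x t \<omega>\<close>. Values outside
  \<open>{0..T} \<times> space P\<close>, respectively at labels outside \<open>{0..1}\<close>, play no role.\<close>

type_synonym 'w process = "real \<Rightarrow> 'w \<Rightarrow> real"
type_synonym 'w profile = "real \<Rightarrow> 'w process"

definition extends_lebesgue_space :: "real measure \<Rightarrow> bool" where
  "extends_lebesgue_space \<nu> \<longleftrightarrow>
     prob_space \<nu> \<and> space \<nu> = {0..1} \<and>
     (\<forall>A\<in>sets (lebesgue_on {0..1}).
        A \<in> sets \<nu> \<and> emeasure \<nu> A = emeasure (lebesgue_on {0..1}) A)"

definition fubini_extension :: "real measure \<Rightarrow> 'w measure \<Rightarrow> (real \<times> 'w) measure \<Rightarrow> bool" where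
  "fubini_extension \<nu> P Q \<longleftrightarrow>
     prob_space Q \<and> space Q = space \<nu> \<times> space P \<and>
     (\<forall>A\<in>sets (\<nu> \<Otimes>\<^sub>M P). A \<in> sets Q \<and> emeasure Q A = emeasure (\<nu> \<Otimes>\<^sub>M P) A) \<and>
     (\<forall>f :: real \<times> 'w \<Rightarrow> real. integrable Q f \<longrightarrow>
        (AE x in \<nu>. integrable P (\<lambda>\<omega>. f (x, \<omega>))) \<and>
        (AE \<omega> in P. integrable \<nu> (\<lambda>x. f (x, \<omega>))) \<and>
        integrable \<nu> (\<lambda>x. \<integral>\<omega>. f (x, \<omega>) \<partial>P) \<and>
        integrable P (\<lambda>\<omega>. \<integral>x. f (x, \<omega>) \<partial>\<nu>) \<and>
        (\<integral>x. (\<integral>\<omega>. f (x, \<omega>) \<partial>P) \<partial>\<nu>) = (\<integral>z. f z \<partial>Q) \<and>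
        (\<integral>\<omega>. (\<integral>x. f (x, \<omega>) \<partial>\<nu>) \<partial>P) = (\<integral>z. f z \<partial>Q))"

text \<open>Richness in the sense of Sun: the extension carries an essentially pairwise independent
  family of uniformly distributed random variables.\<close>

definition rich_fubini_extension :: "real measure \<Rightarrow> 'w measure \<Rightarrow> (real \<times> 'w) measure \<Rightarrow> bool" where
  "rich_fubini_extension \<nu> P Q \<longleftrightarrow>
     fubini_extension \<nu> P Q \<and>
     (\<exists>f\<in>borel_measurable Q :: (real \<times> 'w \<Rightarrow> real) set.
        (AE x in \<nu>. AE y in \<nu>.
           prob_space.indep_var P borel (\<lambda>\<omega>. f (x, \<omega>)) borel (\<lambda>\<omega>. f (y, \<omega>))) \<and>
        (AE x in \<nu>. distr P borel (\<lambda>\<omega>. f (x, \<omega>)) = uniform_measure lborel {0..1}))"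

definition time_measure :: "real \<Rightarrow> real measure" where
  "time_measure T = restrict_space lborel {0..T}"

text \<open>The null sets adjoined are those belonging to the sigma-algebra of \<open>P\<close>; if \<open>P\<close> is
  complete, these are all subsets of null sets. The filtration is not made right-continuous.\<close>

definition augmented_filtration ::
    "'w measure \<Rightarrow> 'i set \<Rightarrow> ('i \<Rightarrow> 'w process) \<Rightarrow> real \<Rightarrow> 'w measure" where
  "augmented_filtration P I X t =
     sigma (space P)
       ((\<Union>i\<in>I. \<Union>s\<in>{0..t}. {X i s -` B \<inter> space P | B. B \<in> sets borel}) \<union> null_sets P)"

definition progressively_measurable :: "(real \<Rightarrow> 'w measure) \<Rightarrow> real \<Rightarrow> 'w process \<Rightarrow> bool" where
  "progressively_measurable F T a \<longleftrightarrow>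
     (\<forall>t\<in>{0..T}. (\<lambda>(s, \<omega>). a s \<omega>) \<in> borel_measurable (restrict_space borel {0..t} \<Otimes>\<^sub>M F t))"

section \<open>The Hilbert spaces of processes and of action profiles\<close>

text \<open>Elements of the Hilbert spaces are represented by functions. Two functions are the same
  element of the space of processes iff they satisfy \<open>process_eq\<close>.\<close>

definition process_eq :: "'w measure \<Rightarrow> real \<Rightarrow> 'w process \<Rightarrow> 'w process \<Rightarrow> bool" where
  "process_eq P T a b \<longleftrightarrow> (AE (t, \<omega>) in time_measure T \<Otimes>\<^sub>M P. a t \<omega> = b t \<omega>)"

definition sq_norm_A :: "'w measure \<Rightarrow> real \<Rightarrow> 'w process \<Rightarrow> ennreal" where
  "sq_norm_A P T a = (\<integral>\<^sup>+t. (\<integral>\<^sup>+\<omega>. ennreal ((a t \<omega>)\<^sup>2) \<partial>P) \<partial>time_measure T)"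

definition norm_A :: "'w measure \<Rightarrow> real \<Rightarrow> 'w process \<Rightarrow> real" where
  "norm_A P T a = sqrt (enn2real (sq_norm_A P T a))"

definition inner_A :: "'w measure \<Rightarrow> real \<Rightarrow> 'w process \<Rightarrow> 'w process \<Rightarrow> real" where
  "inner_A P T a b = (\<integral>t. (\<integral>\<omega>. a t \<omega> * b t \<omega> \<partial>P) \<partial>time_measure T)"

definition space_A :: "'w measure \<Rightarrow> (real \<Rightarrow> 'w measure) \<Rightarrow> real \<Rightarrow> 'w process set" where
  "space_A P F T = {a. progressively_measurable F T a \<and> sq_norm_A P T a < \<infinity>}"

definition sq_norm_Ainf :: "real measure \<Rightarrow> 'w measure \<Rightarrow> real \<Rightarrow> 'w profile \<Rightarrow> ennreal" where
  "sq_norm_Ainf \<nu> P T a = (\<integral>\<^sup>+x. sq_norm_A P T (a x) \<partial>\<nu>)"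

definition norm_Ainf :: "real measure \<Rightarrow> 'w measure \<Rightarrow> real \<Rightarrow> 'w profile \<Rightarrow> real" where
  "norm_Ainf \<nu> P T a = sqrt (enn2real (sq_norm_Ainf \<nu> P T a))"

definition space_Ainf ::
    "real measure \<Rightarrow> 'w measure \<Rightarrow> (real \<Rightarrow> 'w measure) \<Rightarrow> real \<Rightarrow> 'w profile set" where
  "space_Ainf \<nu> P F T =
     {a. (\<forall>x\<in>{0..1}. a x \<in> space_A P F T) \<and>
         (\<lambda>(x, t, \<omega>). a x t \<omega>)
           \<in> borel_measurable (\<nu> \<Otimes>\<^sub>M (restrict_space borel {0..T} \<Otimes>\<^sub>M P)) \<and>
         sq_norm_Ainf \<nu> P T a < \<infinity>}"

section \<open>Graphons\<close>

text \<open>Measurability with respect to the product of the Lebesgue sigma-algebras covers Borel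
  measurable graphons and still makes every section \<open>W x\<close> measurable, which the
  equilibrium condition at every label needs.\<close>

definition graphon :: "(real \<Rightarrow> real \<Rightarrow> real) \<Rightarrow> bool" where
  "graphon W \<longleftrightarrow>
     (\<lambda>(x, y). W x y) \<in> borel_measurable (lebesgue_on {0..1} \<Otimes>\<^sub>M lebesgue_on {0..1}) \<and>
     (\<forall>x\<in>{0..1}. \<forall>y\<in>{0..1}. W x y = W y x \<and> 0 \<le> W x y \<and> W x y \<le> 1)"

definition graphon_op :: "real measure \<Rightarrow> (real \<Rightarrow> real \<Rightarrow> real) \<Rightarrow> (real \<Rightarrow> real) \<Rightarrow> real \<Rightarrow> real" where
  "graphon_op \<nu> W f x = (\<integral>y. W x y * f y \<partial>\<nu>)"

definition graphon_op_profile ::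
    "real measure \<Rightarrow> (real \<Rightarrow> real \<Rightarrow> real) \<Rightarrow> 'w profile \<Rightarrow> 'w profile" where
  "graphon_op_profile \<nu> W a x = (\<lambda>t \<omega>. graphon_op \<nu> W (\<lambda>y. a y t \<omega>) x)"

definition graphon_eigenvalue :: "real measure \<Rightarrow> (real \<Rightarrow> real \<Rightarrow> real) \<Rightarrow> real \<Rightarrow> bool" where
  "graphon_eigenvalue \<nu> W l \<longleftrightarrow>
     (\<exists>f\<in>borel_measurable \<nu>. integrable \<nu> (\<lambda>x. (f x)\<^sup>2) \<and> \<not> (AE x in \<nu>. f x = 0) \<and>
        (AE x in \<nu>. graphon_op \<nu> W f x = l * f x))"

definition lambda1 :: "real measure \<Rightarrow> (real \<Rightarrow> real \<Rightarrow> real) \<Rightarrow> real" where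
  "lambda1 \<nu> W = (GREATEST l. graphon_eigenvalue \<nu> W l)"

definition cut_norm :: "real measure \<Rightarrow> (real \<Rightarrow> real \<Rightarrow> real) \<Rightarrow> real" where
  "cut_norm \<nu> W =
     (SUP (S1, S2) \<in> {S \<in> sets borel. S \<subseteq> {0..1}} \<times> {S \<in> sets borel. S \<subseteq> {0..1}}.
        \<bar>LINT x:S1|\<nu>. (LINT y:S2|\<nu>. W x y)\<bar>)"

section \<open>Step objects\<close>

definition cell :: "nat \<Rightarrow> nat \<Rightarrow> real set" where
  "cell N i = (if i < N then {(real i - 1) / real N ..< real i / real N}
               else {(real N - 1) / real N .. 1})"

definition cell_index :: "nat \<Rightarrow> real \<Rightarrow> nat" where
  "cell_index N x = (THE i. i \<in> {1..N} \<and> x \<in> cell N i)"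

definition step_profile :: "nat \<Rightarrow> (nat \<Rightarrow> 'w process) \<Rightarrow> 'w profile" where
  "step_profile N a x = a (cell_index N x)"

definition step_graphon :: "nat \<Rightarrow> (nat \<Rightarrow> nat \<Rightarrow> real) \<Rightarrow> real \<Rightarrow> real \<Rightarrow> real" where
  "step_graphon N G x y = G (cell_index N x) (cell_index N y)"

section \<open>Utility functionals and games\<close>

type_synonym 'w utility = "'w process \<Rightarrow> 'w process \<Rightarrow> 'w process \<Rightarrow> real"

text \<open>A functional on the Hilbert space is a functional on functions that does not distinguish
  almost everywhere equal arguments. As \<open>process_eq\<close> is required of arbitrary functions, the
  functional may also be evaluated at functions, such as \<open>graphon_op_profile \<nu> W a x\<close>, that
  agree only almost everywhere with a progressively measurable process.\<close>

definition well_defined_on_classes :: "'w measure \<Rightarrow> real \<Rightarrow> 'w utility \<Rightarrow> bool" where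
  "well_defined_on_classes P T U \<longleftrightarrow>
     (\<forall>a a' z z' \<theta> \<theta>'. process_eq P T a a' \<and> process_eq P T z z' \<and> process_eq P T \<theta> \<theta>'
        \<longrightarrow> U a z \<theta> = U a' z' \<theta>')"

definition is_gateaux_gradient ::
    "'w measure \<Rightarrow> (real \<Rightarrow> 'w measure) \<Rightarrow> real \<Rightarrow> ('w process \<Rightarrow> real) \<Rightarrow> 'w process \<Rightarrow> 'w process \<Rightarrow> bool"
  where
  "is_gateaux_gradient P F T f a g \<longleftrightarrow>
     g \<in> space_A P F T \<and>
     (\<forall>h\<in>space_A P F T.
        ((\<lambda>e. (f (\<lambda>t \<omega>. a t \<omega> + e * h t \<omega>) - f a) / e) \<longlongrightarrow> inner_A P T g h) (at 0))"

definition norm_continuous_A ::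
    "'w measure \<Rightarrow> (real \<Rightarrow> 'w measure) \<Rightarrow> real \<Rightarrow> ('w process \<Rightarrow> 'w process) \<Rightarrow> bool" where
  "norm_continuous_A P F T g \<longleftrightarrow>
     (\<forall>a\<in>space_A P F T. \<forall>e>0. \<exists>d>0. \<forall>b\<in>space_A P F T.
        norm_A P T (b - a) < d \<longrightarrow> norm_A P T (g b - g a) < e)"

definition concave_A ::
    "'w measure \<Rightarrow> (real \<Rightarrow> 'w measure) \<Rightarrow> real \<Rightarrow> ('w process \<Rightarrow> real) \<Rightarrow> bool" where
  "concave_A P F T f \<longleftrightarrow>
     (\<forall>a\<in>space_A P F T. \<forall>b\<in>space_A P F T. \<forall>u\<in>{0..1}.
        u * f a + (1 - u) * f b \<le> f (\<lambda>t \<omega>. u * a t \<omega> + (1 - u) * b t \<omega>))"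

definition utility_condition ::
    "'w measure \<Rightarrow> (real \<Rightarrow> 'w measure) \<Rightarrow> real \<Rightarrow> 'w utility \<Rightarrow> real \<Rightarrow> real \<Rightarrow> real \<Rightarrow> bool" where
  "utility_condition P F T U \<alpha>U lU l\<theta> \<longleftrightarrow>
     \<alpha>U > 0 \<and>
     (\<forall>z\<in>space_A P F T. \<forall>\<theta>\<in>space_A P F T.
        concave_A P F T (\<lambda>a. U a z \<theta> + \<alpha>U / 2 * (norm_A P T a)\<^sup>2)) \<and>
     (\<exists>gradU.
        (\<forall>z\<in>space_A P F T. \<forall>\<theta>\<in>space_A P F T.
           (\<forall>a\<in>space_A P F T. is_gateaux_gradient P F T (\<lambda>b. U b z \<theta>) a (gradU a z \<theta>)) \<and>
           norm_continuous_A P F T (\<lambda>a. gradU a z \<theta>)) \<and>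
        (\<forall>a\<in>space_A P F T. \<forall>z1\<in>space_A P F T. \<forall>z2\<in>space_A P F T.
           \<forall>\<theta>1\<in>space_A P F T. \<forall>\<theta>2\<in>space_A P F T.
             norm_A P T (gradU a z1 \<theta>1 - gradU a z2 \<theta>2)
               \<le> lU * norm_A P T (z1 - z2) + l\<theta> * norm_A P T (\<theta>1 - \<theta>2)))"

definition convex_A :: "'w process set \<Rightarrow> bool" where
  "convex_A S \<longleftrightarrow>
     (\<forall>a\<in>S. \<forall>b\<in>S. \<forall>u\<in>{0..1}. (\<lambda>t \<omega>. u * a t \<omega> + (1 - u) * b t \<omega>) \<in> S)"

text \<open>Closedness in the seminorm; in particular such a set contains, with a process, every
  element of \<open>space_A P F T\<close> equal to it almost everywhere.\<close>

definition closed_A :: "'w measure \<Rightarrow> (real \<Rightarrow> 'w measure) \<Rightarrow> real \<Rightarrow> 'w process set \<Rightarrow> bool" where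
  "closed_A P F T S \<longleftrightarrow>
     (\<forall>s a. (\<forall>n. s n \<in> S) \<and> a \<in> space_A P F T \<and> (\<lambda>n. norm_A P T (s n - a)) \<longlonglongrightarrow> 0 \<longrightarrow> a \<in> S)"

definition admissible_profiles ::
    "real measure \<Rightarrow> 'w measure \<Rightarrow> (real \<Rightarrow> 'w measure) \<Rightarrow> real \<Rightarrow> (real \<Rightarrow> 'w process set) \<Rightarrow> 'w profile set"
  where
  "admissible_profiles \<nu> P F T Ax = {a \<in> space_Ainf \<nu> P F T. \<forall>x\<in>{0..1}. a x \<in> Ax x}"

definition graphon_nash ::
    "real measure \<Rightarrow> 'w measure \<Rightarrow> (real \<Rightarrow> 'w measure) \<Rightarrow> real \<Rightarrow> (real \<Rightarrow> 'w process set) \<Rightarrow>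
     'w utility \<Rightarrow> 'w profile \<Rightarrow> (real \<Rightarrow> real \<Rightarrow> real) \<Rightarrow> 'w profile \<Rightarrow> bool" where
  "graphon_nash \<nu> P F T Ax U \<theta> W a \<longleftrightarrow>
     a \<in> admissible_profiles \<nu> P F T Ax \<and>
     (\<forall>x\<in>{0..1}.
        is_arg_max (\<lambda>b. U b (graphon_op_profile \<nu> W a x) (\<theta> x)) (\<lambda>b. b \<in> Ax x) (a x))"

definition network_nash ::
    "nat \<Rightarrow> 'w process set \<Rightarrow> 'w utility \<Rightarrow> (nat \<Rightarrow> 'w process) \<Rightarrow> (nat \<Rightarrow> nat \<Rightarrow> real) \<Rightarrow>
     (nat \<Rightarrow> 'w process) \<Rightarrow> bool" where
  "network_nash N A0 U \<theta> G a \<longleftrightarrow>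
     (\<forall>i\<in>{1..N}. a i \<in> A0) \<and>
     (\<forall>i\<in>{1..N}.
        is_arg_max (\<lambda>b. U b (\<lambda>t \<omega>. 1 / real N * (\<Sum>j=1..N. G i j * a j t \<omega>)) (\<theta> i))
          (\<lambda>b. b \<in> A0) (a i))"

end

theory Submission
  imports Defs "HOL-Library.Diagonal_Subsequence"
begin

text \<open>The best response to an aggregate and a heterogeneity process exists and is unique by strong
  concavity and is Lipschitz in both arguments, with constants \<open>lU / \<alpha>U\<close> and \<open>l\<theta> / \<alpha>U\<close>. A network equilibrium,
  read as a step profile, is therefore a fixed point of a contraction as soon as
  \<open>lU \<parallel>W\<^sub>N\<parallel> < \<alpha>U\<close>, where \<open>\<parallel>\<cdot>\<parallel>\<close> is the operator norm on square-integrable functions and \<open>W\<^sub>N\<close> the step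
  graphon, and comparing it with the graphon equilibrium gives
  \<open>\<alpha>U \<parallel>a - a\<^sub>N\<parallel> \<le> lU (\<parallel>W\<parallel> \<parallel>a - a\<^sub>N\<parallel> + \<parallel>W - W\<^sub>N\<parallel> M) + l\<theta> \<parallel>\<theta> - \<theta>\<^sub>N\<parallel>\<close>.
  The operator norm of a symmetric bounded kernel is attained at an eigenfunction \<open>f\<close>. For a graphon
  \<open>\<bar>f\<bar>\<close> is then an eigenfunction too, so the norm is the largest eigenvalue; for \<open>D = W - W\<^sub>N\<close> bounding \<open>f\<close> in
  the supremum and the mean norm gives \<open>\<parallel>D\<parallel>\<^sup>2 \<le> 4 \<parallel>D\<parallel>\<^sub>\<box>\<close>, slightly better than the required constant 8.\<close>

section \<open>Square-integrable functions\<close>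

text \<open>Elements of the Hilbert spaces are plain functions, so \<open>L2_norm\<close> is only a
  seminorm and every limit, fixed point or uniqueness claim is settled up to null sets;
  \<open>well_defined_on_classes\<close> lets the utility absorb them. The label measure \<nu>
  shapes the rest. It merely extends Lebesgue measure, so \<open>L2 \<nu>\<close> need not be
  separable, and weak compactness cannot rest on a countable basis. Functions measurable for \<nu>
  need not be Lebesgue measurable, while the cut norm tests only Borel sets; the bridge is that
  applying a kernel returns a Lebesgue measurable function for every argument measurable for \<nu>.
  The comparison of norms uses an eigenfunction because it supplies a supremum bound that an
  arbitrary unit vector lacks; the constant 4 counts the pairs of positive and negative parts on the
  two sides. The operators act on the label alone, so scalar bounds carry over to profiles by
  integrating over time and chance.\<close>

definition L2 :: "'a measure \<Rightarrow> ('a \<Rightarrow> real) set" where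
  "L2 M = {f \<in> borel_measurable M. integrable M (\<lambda>x. (f x)\<^sup>2)}"

definition L2_inner :: "'a measure \<Rightarrow> ('a \<Rightarrow> real) \<Rightarrow> ('a \<Rightarrow> real) \<Rightarrow> real" where
  "L2_inner M f g = (\<integral>x. f x * g x \<partial>M)"

definition L2_norm :: "'a measure \<Rightarrow> ('a \<Rightarrow> real) \<Rightarrow> real" where
  "L2_norm M f = sqrt (\<integral>x. (f x)\<^sup>2 \<partial>M)"

lemma L2_measurable [measurable_dest]: "f \<in> L2 M \<Longrightarrow> f \<in> borel_measurable M"
  by (simp add: L2_def)

lemma L2_square_integrable: "f \<in> L2 M \<Longrightarrow> integrable M (\<lambda>x. (f x)\<^sup>2)"
  by (simp add: L2_def)

lemma L2I_nn_integral:
  assumes "f \<in> borel_measurable M" and "(\<integral>\<^sup>+x. ennreal ((f x)\<^sup>2) \<partial>M) < \<infinity>"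
  shows "f \<in> L2 M"
  using assms unfolding L2_def by (auto simp: integrable_iff_bounded)

lemma nn_integral_L2:
  assumes "f \<in> L2 M"
  shows "(\<integral>\<^sup>+x. ennreal ((f x)\<^sup>2) \<partial>M) = ennreal ((L2_norm M f)\<^sup>2)"
  using assms by (simp add: L2_norm_def nn_integral_eq_integral L2_square_integrable)

lemma L2_norm_nonneg [simp]: "0 \<le> L2_norm M f"
  by (simp add: L2_norm_def)

lemma L2_norm_power2: "(L2_norm M f)\<^sup>2 = L2_inner M f f"
  by (simp add: L2_norm_def L2_inner_def power2_eq_square)

lemma L2_inner_commute: "L2_inner M f g = L2_inner M g f"
  by (simp add: L2_inner_def mult.commute)

lemma L2_integrable_mult:
  assumes "f \<in> L2 M" "g \<in> L2 M"
  shows "integrable M (\<lambda>x. f x * g x)"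
proof (rule Bochner_Integration.integrable_bound)
  show "integrable M (\<lambda>x. (f x)\<^sup>2 + (g x)\<^sup>2)"
    using assms by (simp add: L2_square_integrable)
  have "\<bar>f x * g x\<bar> \<le> (f x)\<^sup>2 + (g x)\<^sup>2" for x
    using sum_squares_bound[of "\<bar>f x\<bar>" "\<bar>g x\<bar>"] abs_ge_zero[of "f x * g x"]
    unfolding abs_mult power2_abs by linarith
  then show "AE x in M. norm (f x * g x) \<le> norm ((f x)\<^sup>2 + (g x)\<^sup>2)" by simp
qed (use assms in measurable)

lemma L2_add_scale:
  assumes "f \<in> L2 M" "g \<in> L2 M"
  shows "(\<lambda>x. f x + c * g x) \<in> L2 M"
proof -
  have "integrable M (\<lambda>x. (f x)\<^sup>2 + 2 * c * (f x * g x) + c\<^sup>2 * (g x)\<^sup>2)"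
    using assms by (simp add: L2_square_integrable L2_integrable_mult)
  moreover have "(\<lambda>x. (f x)\<^sup>2 + 2 * c * (f x * g x) + c\<^sup>2 * (g x)\<^sup>2) = (\<lambda>x. (f x + c * g x)\<^sup>2)"
    by (auto simp: power2_eq_square algebra_simps)
  ultimately show ?thesis
    using assms by (auto simp: L2_def)
qed

lemma L2_add: "f \<in> L2 M \<Longrightarrow> g \<in> L2 M \<Longrightarrow> (\<lambda>x. f x + g x) \<in> L2 M"
  using L2_add_scale[of f M g 1] by simp

lemma L2_diff: "f \<in> L2 M \<Longrightarrow> g \<in> L2 M \<Longrightarrow> (\<lambda>x. f x - g x) \<in> L2 M"
  using L2_add_scale[of f M g "-1"] by simp

lemma L2_zero: "(\<lambda>x. 0) \<in> L2 M"
  by (simp add: L2_def)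

lemma L2_scale: "f \<in> L2 M \<Longrightarrow> (\<lambda>x. c * f x) \<in> L2 M"
  using L2_add_scale[OF L2_zero, of f M c] by simp

lemma L2_abs: "f \<in> L2 M \<Longrightarrow> (\<lambda>x. \<bar>f x\<bar>) \<in> L2 M"
  by (auto simp: L2_def)

lemma L2_inner_add_scale_left:
  assumes "f \<in> L2 M" "g \<in> L2 M" "h \<in> L2 M"
  shows "L2_inner M (\<lambda>x. f x + c * g x) h = L2_inner M f h + c * L2_inner M g h"
  using assms by (simp add: L2_inner_def distrib_right L2_integrable_mult mult.assoc)

lemma L2_inner_add_scale_right:
  assumes "f \<in> L2 M" "g \<in> L2 M" "h \<in> L2 M"
  shows "L2_inner M h (\<lambda>x. f x + c * g x) = L2_inner M h f + c * L2_inner M h g"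
  using L2_inner_add_scale_left[OF assms] by (simp add: L2_inner_commute)

lemma L2_inner_diff_left:
  assumes "f \<in> L2 M" "g \<in> L2 M" "h \<in> L2 M"
  shows "L2_inner M (\<lambda>x. f x - g x) h = L2_inner M f h - L2_inner M g h"
  using L2_inner_add_scale_left[OF assms, of "-1"] by simp

lemma L2_inner_diff_right:
  assumes "f \<in> L2 M" "g \<in> L2 M" "h \<in> L2 M"
  shows "L2_inner M h (\<lambda>x. f x - g x) = L2_inner M h f - L2_inner M h g"
  using L2_inner_add_scale_right[OF assms, of "-1"] by simp

lemma L2_norm_add_scale:
  assumes "f \<in> L2 M" "g \<in> L2 M"
  shows "(L2_norm M (\<lambda>x. f x + c * g x))\<^sup>2
    = (L2_norm M f)\<^sup>2 + 2 * c * L2_inner M f g + c\<^sup>2 * (L2_norm M g)\<^sup>2"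
  unfolding L2_norm_power2 using assms L2_inner_commute[of M g f]
  by (simp add: L2_inner_add_scale_left L2_inner_add_scale_right L2_add_scale
      power2_eq_square[of c] algebra_simps)

lemma L2_norm_diff:
  assumes "f \<in> L2 M" "g \<in> L2 M"
  shows "(L2_norm M (\<lambda>x. f x - g x))\<^sup>2
    = (L2_norm M f)\<^sup>2 - 2 * L2_inner M f g + (L2_norm M g)\<^sup>2"
  using L2_norm_add_scale[OF assms, of "-1"] by simp

lemma L2_norm_scale: "L2_norm M (\<lambda>x. c * f x) = \<bar>c\<bar> * L2_norm M f"
  by (simp add: L2_norm_def power_mult_distrib real_sqrt_mult)

lemma L2_norm_zero [simp]: "L2_norm M (\<lambda>x. 0) = 0"
  by (simp add: L2_norm_def)

lemma L2_norm_minus_commute: "L2_norm M (\<lambda>x. f x - g x) = L2_norm M (\<lambda>x. g x - f x)"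
  by (simp add: L2_norm_def power2_commute)

lemma L2_norm_abs: "L2_norm M (\<lambda>x. \<bar>f x\<bar>) = L2_norm M f"
  by (simp add: L2_norm_def)

lemma L2_norm_cong_AE:
  assumes "f \<in> borel_measurable M" "g \<in> borel_measurable M" "AE x in M. f x = g x"
  shows "L2_norm M f = L2_norm M g"
  unfolding L2_norm_def
  by (intro arg_cong[of _ _ sqrt] integral_cong_AE) (use assms in auto)

lemma L2_norm_eq_0_iff:
  assumes "f \<in> L2 M"
  shows "L2_norm M f = 0 \<longleftrightarrow> (AE x in M. f x = 0)"
  using assms by (simp add: L2_norm_def integral_nonneg_eq_0_iff_AE L2_square_integrable)

lemma L2_Cauchy_Schwarz:
  assumes "f \<in> L2 M" "g \<in> L2 M"
  shows "\<bar>L2_inner M f g\<bar> \<le> L2_norm M f * L2_norm M g"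
proof (cases "L2_norm M g = 0")
  case True
  then have "AE x in M. f x * g x = 0"
    using assms by (auto simp: L2_norm_eq_0_iff)
  then have "L2_inner M f g = 0"
    unfolding L2_inner_def using integral_cong_AE[of "\<lambda>x. f x * g x" M "\<lambda>x. 0"] assms
    by (simp add: borel_measurable_integrable L2_integrable_mult)
  then show ?thesis by simp
next
  case False
  define c where "c = L2_inner M f g / (L2_norm M g)\<^sup>2"
  have "0 \<le> (L2_norm M (\<lambda>x. f x + (- c) * g x))\<^sup>2" by simp
  also have "\<dots> = (L2_norm M f)\<^sup>2 - (L2_inner M f g)\<^sup>2 / (L2_norm M g)\<^sup>2"
    using False unfolding L2_norm_add_scale[OF assms] c_def
    by (simp add: power2_eq_square field_simps)
  finally have "(L2_inner M f g)\<^sup>2 \<le> (L2_norm M f * L2_norm M g)\<^sup>2"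
    using False by (simp add: field_simps power_mult_distrib)
  then show ?thesis
    using power2_le_iff_abs_le[of "L2_norm M f * L2_norm M g" "L2_inner M f g"] by simp
qed

lemma L2_triangle:
  assumes "f \<in> L2 M" "g \<in> L2 M"
  shows "L2_norm M (\<lambda>x. f x + g x) \<le> L2_norm M f + L2_norm M g"
proof (rule power2_le_imp_le)
  show "(L2_norm M (\<lambda>x. f x + g x))\<^sup>2 \<le> (L2_norm M f + L2_norm M g)\<^sup>2"
    using L2_norm_add_scale[OF assms, of 1] L2_Cauchy_Schwarz[OF assms]
    by (simp add: power2_sum)
qed simp

lemma L2_triangle_diff:
  assumes "f \<in> L2 M" "g \<in> L2 M" "h \<in> L2 M"
  shows "L2_norm M (\<lambda>x. f x - h x) \<le> L2_norm M (\<lambda>x. f x - g x) + L2_norm M (\<lambda>x. g x - h x)"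
  using L2_triangle[OF L2_diff[OF assms(1,2)] L2_diff[OF assms(2,3)]] by simp

lemma L2_norm_le_add_diff:
  assumes "f \<in> L2 M" "g \<in> L2 M"
  shows "L2_norm M f \<le> L2_norm M g + L2_norm M (\<lambda>x. f x - g x)"
  using L2_triangle[OF assms(2) L2_diff[OF assms]] by simp

lemma L2_norm_mono:
  assumes "f \<in> borel_measurable M" "g \<in> L2 M" "AE x in M. \<bar>f x\<bar> \<le> \<bar>g x\<bar>"
  shows "f \<in> L2 M" "L2_norm M f \<le> L2_norm M g"
proof -
  have le: "AE x in M. (f x)\<^sup>2 \<le> (g x)\<^sup>2"
    using assms(3) by (simp add: abs_le_square_iff)
  show f: "f \<in> L2 M"
    using assms(1) le unfolding L2_def
    by (auto intro!: Bochner_Integration.integrable_bound[OF L2_square_integrable[OF assms(2)]])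
  show "L2_norm M f \<le> L2_norm M g"
    unfolding L2_norm_def
    by (intro real_sqrt_le_mono integral_mono_AE le L2_square_integrable f assms)
qed

text \<open>The last term is the strict convexity of the squared norm in quantitative form. It
  supplies the quadratic surplus in every midpoint and strong concavity argument;
  \<open>u = 1/2\<close> leaves the factor 1/4.\<close>

lemma L2_norm_convex_combination:
  assumes "a \<in> L2 M" "b \<in> L2 M"
  shows "(L2_norm M (\<lambda>x. u * a x + (1 - u) * b x))\<^sup>2
    = u * (L2_norm M a)\<^sup>2 + (1 - u) * (L2_norm M b)\<^sup>2 - u * (1 - u) * (L2_norm M (\<lambda>x. a x - b x))\<^sup>2"
proof -
  have eq: "(\<lambda>x. u * a x + (1 - u) * b x) = (\<lambda>x. b x + u * (a x - b x))"
    by (auto simp: algebra_simps)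
  show ?thesis
    unfolding eq L2_norm_add_scale[OF assms(2) L2_diff[OF assms]] L2_norm_diff[OF assms]
      L2_inner_diff_right[OF assms assms(2)] L2_norm_power2[symmetric] L2_inner_commute[of M b a]
    by (simp add: power2_eq_square algebra_simps)
qed

section \<open>Completeness and maximisers\<close>

definition L2_Cauchy :: "'a measure \<Rightarrow> (nat \<Rightarrow> 'a \<Rightarrow> real) \<Rightarrow> bool" where
  "L2_Cauchy M s \<longleftrightarrow> (\<forall>e>0. \<exists>n0. \<forall>m\<ge>n0. \<forall>n\<ge>n0. L2_norm M (\<lambda>x. s m x - s n x) < e)"

text \<open>Completeness is a property of a subset, so that one notion serves all of
  \<open>L2 M\<close>, the progressively measurable processes, the action set and the set of test
  functions in the weak compactness proof.\<close>

definition L2_complete :: "'a measure \<Rightarrow> ('a \<Rightarrow> real) set \<Rightarrow> bool" where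
  "L2_complete M C \<longleftrightarrow> (\<forall>s. (\<forall>n. s n \<in> C) \<and> L2_Cauchy M s \<longrightarrow>
     (\<exists>g\<in>C. (\<lambda>n. L2_norm M (\<lambda>x. s n x - g x)) \<longlonglongrightarrow> 0))"

lemma (in finite_measure) L2_integrable:
  assumes "f \<in> L2 M" shows "integrable M f"
  using L2_integrable_mult[OF assms, of "\<lambda>x. 1"] by (simp add: L2_def)

text \<open>Cauchy-Schwarz against the constant one; it turns increments with summable
  \<open>L2_norm\<close> into increments that are summable at almost every point.\<close>

lemma (in finite_measure) L1_norm_le_L2_norm:
  assumes "f \<in> L2 M"
  shows "(\<integral>x. \<bar>f x\<bar> \<partial>M) \<le> sqrt (measure M (space M)) * L2_norm M f"
  using L2_Cauchy_Schwarz[OF L2_abs[OF assms], of "\<lambda>x. 1"]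
  by (simp add: L2_def L2_inner_def L2_norm_abs) (simp add: L2_norm_def mult.commute)

text \<open>Riesz-Fischer, with the limit given by an explicit formula, the pointwise
  \<open>lim\<close> along a subsequence. The formula matters later: it is measurable for every
  sigma-algebra that makes all the terms measurable.\<close>

lemma (in finite_measure) L2_Cauchy_subseq:
  assumes s: "\<And>n. s n \<in> L2 M" and C: "L2_Cauchy M s"
  obtains r where "strict_mono (r :: nat \<Rightarrow> nat)" "AE x in M. convergent (\<lambda>n. s (r n) x)"
    "(\<lambda>x. lim (\<lambda>n. s (r n) x)) \<in> L2 M"
    "(\<lambda>n. L2_norm M (\<lambda>x. s n x - lim (\<lambda>n. s (r n) x))) \<longlonglongrightarrow> 0"
proof -
  have [measurable]: "s n \<in> borel_measurable M" for n using s by (rule L2_measurable)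
  have "\<forall>k. \<exists>n0. \<forall>m\<ge>n0. \<forall>n\<ge>n0. L2_norm M (\<lambda>x. s m x - s n x) < (1/2)^k"
    using C unfolding L2_Cauchy_def by simp
  then obtain n0 where n0: "\<And>k m n. m \<ge> n0 k \<Longrightarrow> n \<ge> n0 k \<Longrightarrow> L2_norm M (\<lambda>x. s m x - s n x) < (1/2)^k"
    by metis
  \<comment> \<open>Each index exceeds its predecessor and the threshold for accuracy
    \<open>(1/2)^k\<close>, so consecutive differences have summable norms.\<close>
  define r where "r = rec_nat (n0 0) (\<lambda>k r. max (Suc r) (n0 (Suc k)))"
  have r_Suc: "r (Suc k) = max (Suc (r k)) (n0 (Suc k))" for k by (simp add: r_def)
  have r: "strict_mono r"
    by (rule strict_monoI_Suc) (simp add: r_Suc)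
  have rn0: "r k \<ge> n0 k" for k
    by (cases k) (simp_all add: r_Suc, simp add: r_def)
  define d where "d k x = s (r (Suc k)) x - s (r k) x" for k x
  have d: "d k \<in> L2 M" for k unfolding d_def by (intro L2_diff s)
  have [measurable]: "d k \<in> borel_measurable M" for k using d by (rule L2_measurable)
  define c where "c = sqrt (measure M (space M))"
  have c0: "c \<ge> 0" by (simp add: c_def)
  have dn: "(\<integral>\<^sup>+x. ennreal \<bar>d k x\<bar> \<partial>M) \<le> ennreal (c * (1/2)^k)" for k
  proof -
    have "L2_norm M (d k) \<le> (1/2)^k"
      unfolding d_def using n0[of k "r (Suc k)" "r k"] rn0[of k] strict_monoD[OF r, of k "Suc k"]
      by simp
    then have "(\<integral>x. \<bar>d k x\<bar> \<partial>M) \<le> c * (1/2)^k"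
      using L1_norm_le_L2_norm[OF d, of k] c0 mult_left_mono[of "L2_norm M (d k)" "(1/2)^k" c]
      unfolding c_def by linarith
    then show ?thesis
      by (subst nn_integral_eq_integral) (auto intro!: L2_integrable L2_abs d ennreal_leI)
  qed
  have "(\<integral>\<^sup>+x. (\<Sum>k. ennreal \<bar>d k x\<bar>) \<partial>M) = (\<Sum>k. \<integral>\<^sup>+x. ennreal \<bar>d k x\<bar> \<partial>M)"
    by (rule nn_integral_suminf) simp
  also have "\<dots> \<le> (\<Sum>k. ennreal (c * (1/2)^k))"
    by (intro suminf_le dn) auto
  also have "\<dots> = ennreal (\<Sum>k. c * (1/2)^k)"
    using c0 by (intro suminf_ennreal2 summable_mult summable_geometric) auto
  finally have "(\<integral>\<^sup>+x. (\<Sum>k. ennreal \<bar>d k x\<bar>) \<partial>M) \<noteq> \<infinity>"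
    by (auto simp: top_unique)
  then have "AE x in M. (\<Sum>k. ennreal \<bar>d k x\<bar>) \<noteq> \<infinity>"
    by (intro nn_integral_PInf_AE) auto
  moreover have "convergent (\<lambda>n. s (r n) x)" if "(\<Sum>k. ennreal \<bar>d k x\<bar>) \<noteq> \<infinity>" for x
  proof -
    have "summable (\<lambda>k. \<bar>d k x\<bar>)"
      using that by (intro summable_suminf_not_top) auto
    then have "summable (\<lambda>k. d k x)" by (rule summable_rabs_cancel)
    then have "convergent (\<lambda>n. \<Sum>k<n. d k x)" by (simp add: summable_iff_convergent)
    moreover have "(\<Sum>k<n. d k x) = s (r n) x - s (r 0) x" for n
      unfolding d_def by (rule sum_lessThan_telescope)
    ultimately have "convergent (\<lambda>n. s (r n) x - s (r 0) x)" by simp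
    from convergent_add[OF this convergent_const[of "s (r 0) x"]] show ?thesis by simp
  qed
  ultimately have conv: "AE x in M. convergent (\<lambda>n. s (r n) x)" by (rule eventually_mono)
  define g where "g x = lim (\<lambda>n. s (r n) x)" for x
  have [measurable]: "g \<in> borel_measurable M" unfolding g_def by measurable
  have lim: "AE x in M. (\<lambda>n. s (r n) x) \<longlonglongrightarrow> g x"
    using conv by eventually_elim (simp add: g_def convergent_LIMSEQ_iff)
  \<comment> \<open>Fatou's lemma along the subsequence: a bound on all later differences passes to
    the difference with the limit.\<close>
  have bound: "(\<integral>\<^sup>+x. ennreal ((s n x - g x)\<^sup>2) \<partial>M) \<le> ennreal (e\<^sup>2)"
    if e: "\<And>m. m \<ge> n \<Longrightarrow> L2_norm M (\<lambda>x. s n x - s m x) \<le> e" for n e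
  proof -
    have "(\<integral>\<^sup>+x. ennreal ((s n x - g x)\<^sup>2) \<partial>M) = (\<integral>\<^sup>+x. liminf (\<lambda>k. ennreal ((s n x - s (r k) x)\<^sup>2)) \<partial>M)"
    proof (rule nn_integral_cong_AE)
      show "AE x in M. ennreal ((s n x - g x)\<^sup>2) = liminf (\<lambda>k. ennreal ((s n x - s (r k) x)\<^sup>2))"
        using lim
      proof eventually_elim
        case (elim x)
        have "(\<lambda>k. ennreal ((s n x - s (r k) x)\<^sup>2)) \<longlonglongrightarrow> ennreal ((s n x - g x)\<^sup>2)"
          by (intro tendsto_ennrealI tendsto_intros elim)
        from lim_imp_Liminf[OF _ this] show ?case by simp
      qed
    qed
    also have "\<dots> \<le> liminf (\<lambda>k. \<integral>\<^sup>+x. ennreal ((s n x - s (r k) x)\<^sup>2) \<partial>M)"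
      by (rule nn_integral_liminf) measurable
    also have "\<dots> \<le> liminf (\<lambda>k. ennreal (e\<^sup>2))"
    proof (rule Liminf_mono, rule eventually_sequentiallyI[of n])
      fix k assume "n \<le> k"
      then have "r k \<ge> n" using strict_mono_imp_increasing[OF r, of k] by linarith
      then show "(\<integral>\<^sup>+x. ennreal ((s n x - s (r k) x)\<^sup>2) \<partial>M) \<le> ennreal (e\<^sup>2)"
        by (subst nn_integral_L2) (auto intro!: L2_diff s ennreal_leI power_mono e)
    qed
    finally show ?thesis by (simp add: Liminf_const)
  qed
  have diff: "(\<lambda>x. s n x - g x) \<in> L2 M" if "\<And>m. m \<ge> n \<Longrightarrow> L2_norm M (\<lambda>x. s n x - s m x) \<le> e" for n e
    by (rule L2I_nn_integral) (use bound[OF that] in \<open>auto simp: le_less_trans\<close>)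
  \<comment> \<open>\<open>g\<close> is the member \<open>s (r 0)\<close> minus the
    square-integrable remainder of \<open>s (r 0)\<close> against \<open>g\<close>.\<close>
  have "\<And>m. m \<ge> r 0 \<Longrightarrow> L2_norm M (\<lambda>x. s (r 0) x - s m x) \<le> 1"
    using n0[of 0 "r 0"] rn0[of 0] by (fastforce intro: less_imp_le)
  from L2_diff[OF s[of "r 0"] diff[OF this]] have g: "g \<in> L2 M" by simp
  have "(\<lambda>n. L2_norm M (\<lambda>x. s n x - g x)) \<longlonglongrightarrow> 0"
  proof (rule LIMSEQ_I)
    fix e :: real assume e: "0 < e"
    from C e obtain k where k: "\<And>m n. m \<ge> k \<Longrightarrow> n \<ge> k \<Longrightarrow> L2_norm M (\<lambda>x. s m x - s n x) < e / 2"
      unfolding L2_Cauchy_def by (meson half_gt_zero)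
    show "\<exists>k. \<forall>n\<ge>k. norm (L2_norm M (\<lambda>x. s n x - g x) - 0) < e"
    proof (intro exI[of _ k] allI impI)
      fix n assume n: "k \<le> n"
      then have *: "\<And>m. m \<ge> n \<Longrightarrow> L2_norm M (\<lambda>x. s n x - s m x) \<le> e / 2"
        by (intro less_imp_le[OF k]) auto
      have "(L2_norm M (\<lambda>x. s n x - g x))\<^sup>2 \<le> (e / 2)\<^sup>2"
        using bound[OF *] diff[OF *] by (simp add: nn_integral_L2)
      then have "L2_norm M (\<lambda>x. s n x - g x) \<le> e / 2"
        by (rule power2_le_imp_le) (use e in simp)
      then show "norm (L2_norm M (\<lambda>x. s n x - g x) - 0) < e" using e by simp
    qed
  qed
  with r conv g that[of r] show thesis unfolding g_def by blast
qed

lemma (in finite_measure) L2_complete_L2: "L2_complete M (L2 M)"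
  unfolding L2_complete_def
proof (intro allI impI, elim conjE)
  fix s assume s: "\<forall>n. s n \<in> L2 M" "L2_Cauchy M s"
  obtain r where r: "(\<lambda>x. lim (\<lambda>n. s (r n) x)) \<in> L2 M"
    "(\<lambda>n. L2_norm M (\<lambda>x. s n x - lim (\<lambda>n. s (r n) x))) \<longlonglongrightarrow> 0"
    using L2_Cauchy_subseq[of s] s by blast
  show "\<exists>g\<in>L2 M. (\<lambda>n. L2_norm M (\<lambda>x. s n x - g x)) \<longlonglongrightarrow> 0"
    by (rule bexI[where x = "\<lambda>x. lim (\<lambda>n. s (r n) x)"]) (use r in auto)
qed

text \<open>The convergence half of Banach's fixed point argument: increments are dominated by a
  geometric series. It is applied to iterated best responses.\<close>

lemma L2_Cauchy_geometric:
  assumes f: "\<And>n. f n \<in> L2 M"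
    and step: "\<And>n. L2_norm M (\<lambda>x. f (Suc n) x - f n x) \<le> B * q ^ n"
    and q: "0 \<le> q" "q < 1"
  shows "L2_Cauchy M f"
proof -
  have B: "0 \<le> B" using order_trans[OF L2_norm_nonneg step[of 0]] by simp
  have tail: "L2_norm M (\<lambda>x. f (n + k) x - f n x) \<le> B * q ^ n * (\<Sum>i<k. q ^ i)" for n k
  proof (induction k)
    case (Suc k)
    have "L2_norm M (\<lambda>x. f (n + Suc k) x - f n x)
        \<le> L2_norm M (\<lambda>x. f (Suc (n + k)) x - f (n + k) x) + L2_norm M (\<lambda>x. f (n + k) x - f n x)"
      using L2_triangle_diff[OF f[of "n + Suc k"] f[of "n + k"] f[of n]] by simp
    also have "\<dots> \<le> B * q ^ (n + k) + B * q ^ n * (\<Sum>i<k. q ^ i)"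
      by (intro add_mono step Suc.IH)
    also have "\<dots> = B * q ^ n * (\<Sum>i<Suc k. q ^ i)"
      by (simp add: power_add algebra_simps)
    finally show ?case .
  qed simp
  define C where "C = B / (1 - q)"
  have tail': "L2_norm M (\<lambda>x. f m x - f n x) \<le> C * q ^ n" if "n \<le> m" for m n
  proof -
    have "(\<Sum>i<m - n. q ^ i) \<le> 1 / (1 - q)"
      using q by (simp add: sum_gp_strict divide_right_mono)
    then have "B * q ^ n * (\<Sum>i<m - n. q ^ i) \<le> B * q ^ n * (1 / (1 - q))"
      using B q by (intro mult_left_mono) auto
    with tail[of n "m - n"] that show ?thesis by (simp add: C_def mult.commute)
  qed
  have "(\<lambda>n. C * q ^ n) \<longlonglongrightarrow> C * 0"
    using q by (intro tendsto_intros LIMSEQ_power_zero) auto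
  then have lim: "(\<lambda>n. C * q ^ n) \<longlonglongrightarrow> 0" by simp
  show ?thesis
    unfolding L2_Cauchy_def
  proof (intro allI impI)
    fix e :: real assume "0 < e"
    with order_tendstoD(2)[OF lim, of "e / 2"] obtain k where k: "\<And>n. n \<ge> k \<Longrightarrow> C * q ^ n < e / 2"
      by (auto simp: eventually_sequentially)
    show "\<exists>n0. \<forall>m\<ge>n0. \<forall>n\<ge>n0. L2_norm M (\<lambda>x. f m x - f n x) < e"
    proof (intro exI[of _ k] allI impI)
      fix m n assume mn: "k \<le> m" "k \<le> n"
      have "L2_norm M (\<lambda>x. f m x - f n x)
          \<le> L2_norm M (\<lambda>x. f m x - f k x) + L2_norm M (\<lambda>x. f n x - f k x)"
        using L2_triangle_diff[OF f[of m] f[of k] f[of n]] by (simp add: L2_norm_minus_commute[of M "f k"])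
      also have "\<dots> \<le> C * q ^ k + C * q ^ k" by (intro add_mono tail' mn)
      also have "\<dots> < e" using k[of k] by simp
      finally show "L2_norm M (\<lambda>x. f m x - f n x) < e" .
    qed
  qed
qed

text \<open>A maximising sequence is Cauchy by strong concavity at midpoints.\<close>

lemma L2_maximiser_exists:
  assumes C: "C \<noteq> {}" "C \<subseteq> L2 M" "L2_complete M C"
    and mid: "\<And>a b. a \<in> C \<Longrightarrow> b \<in> C \<Longrightarrow> (\<lambda>x. 1/2 * a x + (1 - 1/2) * b x) \<in> C"
    and conc: "\<And>a b. a \<in> C \<Longrightarrow> b \<in> C \<Longrightarrow>
      (J a + J b) / 2 + c * (L2_norm M (\<lambda>x. a x - b x))\<^sup>2 \<le> J (\<lambda>x. 1/2 * a x + (1 - 1/2) * b x)"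
    and c: "c > 0"
    and bdd: "bdd_above (J ` C)"
    and usc: "\<And>s a l. (\<And>n. s n \<in> C) \<Longrightarrow> a \<in> C \<Longrightarrow> (\<lambda>n. L2_norm M (\<lambda>x. s n x - a x)) \<longlonglongrightarrow> 0 \<Longrightarrow>
      (\<lambda>n. J (s n)) \<longlonglongrightarrow> l \<Longrightarrow> l \<le> J a"
  shows "\<exists>a\<in>C. \<forall>b\<in>C. J b \<le> J a"
proof -
  define S where "S = Sup (J ` C)"
  have JS: "J a \<le> S" if "a \<in> C" for a
    unfolding S_def by (intro cSup_upper bdd imageI that)
  have "\<exists>a\<in>C. S - 1 / real (Suc n) < J a" for n
  proof -
    have "S - 1 / real (Suc n) < Sup (J ` C)" by (simp add: S_def)
    then obtain y where "y \<in> J ` C" "S - 1 / real (Suc n) < y"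
      using less_cSupD[of "J ` C"] C(1) by blast
    then show ?thesis by auto
  qed
  then obtain s where s: "\<And>n. s n \<in> C" "\<And>n. S - 1 / real (Suc n) < J (s n)" by metis
  \<comment> \<open>Both endpoints lie within \<open>t\<close> of the supremum \<open>S\<close> and
    the midpoint value \<open>w\<close> does not exceed it, so the concavity surplus
    \<open>X\<close> is at most \<open>t\<close>.\<close>
  have arith: "(p + q) / 2 + X \<le> w \<Longrightarrow> w \<le> S \<Longrightarrow> S - u < p \<Longrightarrow> S - v < q \<Longrightarrow> u \<le> t \<Longrightarrow> v \<le> t \<Longrightarrow> X \<le> t"
    for p q X w u v t :: real
    by (simp add: field_simps)
  have close: "c * (L2_norm M (\<lambda>x. s m x - s n x))\<^sup>2 \<le> 1 / real (Suc k)" if "m \<ge> k" "n \<ge> k" for m n k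
  proof -
    have "1 / real (Suc m) \<le> 1 / real (Suc k)" "1 / real (Suc n) \<le> 1 / real (Suc k)"
      using that by (auto simp: frac_le)
    then show ?thesis
      by (rule arith[OF conc[OF s(1) s(1)] JS[OF mid[OF s(1) s(1)]] s(2) s(2)])
  qed
  have "L2_Cauchy M s"
    unfolding L2_Cauchy_def
  proof (intro allI impI)
    fix e :: real assume e: "e > 0"
    then have "c * e\<^sup>2 > 0" using c by simp
    then obtain k where k: "1 / real (Suc k) < c * e\<^sup>2" using nat_approx_posE by blast
    show "\<exists>k. \<forall>m\<ge>k. \<forall>n\<ge>k. L2_norm M (\<lambda>x. s m x - s n x) < e"
    proof (intro exI[of _ k] allI impI)
      fix m n assume "m \<ge> k" "n \<ge> k"
      from le_less_trans[OF close[OF this] k] have "(L2_norm M (\<lambda>x. s m x - s n x))\<^sup>2 < e\<^sup>2"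
        using c by simp
      then show "L2_norm M (\<lambda>x. s m x - s n x) < e"
        using e by (intro power2_less_imp_less[of _ e]) auto
    qed
  qed
  then obtain a where a: "a \<in> C" "(\<lambda>n. L2_norm M (\<lambda>x. s n x - a x)) \<longlonglongrightarrow> 0"
    using C(3) s(1) unfolding L2_complete_def by blast
  have "(\<lambda>n. J (s n)) \<longlonglongrightarrow> S"
  proof (rule tendsto_sandwich)
    show "(\<lambda>n. S - 1 / real (Suc n)) \<longlonglongrightarrow> S"
      using tendsto_diff[OF tendsto_const[of S] LIMSEQ_inverse_real_of_nat] by (simp add: inverse_eq_divide)
    show "\<forall>\<^sub>F n in sequentially. S - 1 / real (Suc n) \<le> J (s n)"
      using s(2) by (intro always_eventually allI less_imp_le) auto
    show "\<forall>\<^sub>F n in sequentially. J (s n) \<le> S"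
      using JS s(1) by (intro always_eventually allI) auto
  qed simp
  from usc[OF s(1) a this] JS a(1) show ?thesis by (meson order_trans)
qed

section \<open>Orthogonal projection and weak compactness\<close>

definition L2_subspace :: "'a measure \<Rightarrow> ('a \<Rightarrow> real) set \<Rightarrow> bool" where
  "L2_subspace M V \<longleftrightarrow> V \<subseteq> L2 M \<and> (\<lambda>x. 0) \<in> V \<and>
     (\<forall>f\<in>V. \<forall>g\<in>V. \<forall>c. (\<lambda>x. f x + c * g x) \<in> V)"

lemma L2_norm_diff_tendsto:
  assumes "\<And>n. s n \<in> L2 M" "a \<in> L2 M" "(\<lambda>n. L2_norm M (\<lambda>x. s n x - a x)) \<longlonglongrightarrow> 0"
  shows "(\<lambda>n. L2_norm M (s n)) \<longlonglongrightarrow> L2_norm M a"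
proof (rule LIM_zero_cancel, rule Lim_null_comparison[OF _ assms(3)], rule always_eventually, rule allI)
  fix n
  show "norm (L2_norm M (s n) - L2_norm M a) \<le> L2_norm M (\<lambda>x. s n x - a x)"
    using L2_norm_le_add_diff[OF assms(1)[of n] assms(2)] L2_norm_le_add_diff[OF assms(2) assms(1)[of n]]
    by (simp add: L2_norm_minus_commute[of M a])
qed

text \<open>The nearest point of \<open>V\<close> maximises \<open>J\<close>, minus the squared
  distance to \<open>v\<close>. By the convex combination identity the midpoint surplus of
  \<open>J\<close> is exactly a quarter of the squared distance of the endpoints; perturbing the
  maximiser along \<open>g\<close> then gives orthogonality.\<close>

lemma L2_projection:
  assumes V: "L2_subspace M V" "L2_complete M V" and v: "v \<in> L2 M"
  obtains p where "p \<in> V" "\<And>g. g \<in> V \<Longrightarrow> L2_inner M (\<lambda>x. v x - p x) g = 0"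
proof -
  have VL: "g \<in> L2 M" if "g \<in> V" for g using V(1) that by (auto simp: L2_subspace_def)
  define J where "J a = - (L2_norm M (\<lambda>x. v x - a x))\<^sup>2" for a
  have "\<exists>a\<in>V. \<forall>b\<in>V. J b \<le> J a"
  proof (rule L2_maximiser_exists[where c = "1/4"])
    show "V \<noteq> {}" "V \<subseteq> L2 M" using V(1) by (auto simp: L2_subspace_def)
    show "L2_complete M V" by fact
    show "(\<lambda>x. 1/2 * a x + (1 - 1/2) * b x) \<in> V" if "a \<in> V" "b \<in> V" for a b
    proof -
      have z: "(\<lambda>x. 0) \<in> V" and add: "\<And>f g c. f \<in> V \<Longrightarrow> g \<in> V \<Longrightarrow> (\<lambda>x. f x + c * g x) \<in> V"
        using V(1) unfolding L2_subspace_def by auto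
      from add[OF add[OF z that(1), of "1/2"] that(2), of "1/2"] show ?thesis by simp
    qed
    show "(J a + J b) / 2 + 1/4 * (L2_norm M (\<lambda>x. a x - b x))\<^sup>2 \<le> J (\<lambda>x. 1/2 * a x + (1 - 1/2) * b x)"
      if "a \<in> V" "b \<in> V" for a b
    proof -
      have eq1: "(\<lambda>x. v x - (1/2 * a x + (1 - 1/2) * b x)) = (\<lambda>x. 1/2 * (v x - a x) + (1 - 1/2) * (v x - b x))"
        by (auto simp: field_simps)
      have eq2: "L2_norm M (\<lambda>x. (v x - a x) - (v x - b x)) = L2_norm M (\<lambda>x. a x - b x)"
        by (subst L2_norm_minus_commute) (simp add: algebra_simps)
      show ?thesis
        unfolding J_def eq1 L2_norm_convex_combination[OF L2_diff[OF v VL[OF that(1)]] L2_diff[OF v VL[OF that(2)]]] eq2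
        by simp
    qed
    show "bdd_above (J ` V)" by (auto simp: J_def intro!: bdd_aboveI[of _ 0])
    show "l \<le> J a" if s: "\<And>n. s n \<in> V" and a: "a \<in> V"
      and lim: "(\<lambda>n. L2_norm M (\<lambda>x. s n x - a x)) \<longlonglongrightarrow> 0" and l: "(\<lambda>n. J (s n)) \<longlonglongrightarrow> l" for s a l
    proof -
      have "(\<lambda>n. L2_norm M (\<lambda>x. v x - s n x)) \<longlonglongrightarrow> L2_norm M (\<lambda>x. v x - a x)"
        by (rule L2_norm_diff_tendsto)
          (use lim s a v VL in \<open>auto intro!: L2_diff simp: L2_norm_minus_commute[of M a]\<close>)
      then have "(\<lambda>n. J (s n)) \<longlonglongrightarrow> J a"
        unfolding J_def by (intro tendsto_intros)
      from LIMSEQ_unique[OF l this] show ?thesis by simp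
    qed
  qed simp
  then obtain p where p: "p \<in> V" "\<And>b. b \<in> V \<Longrightarrow> J b \<le> J p" by blast
  have "L2_inner M (\<lambda>x. v x - p x) g = 0" if g: "g \<in> V" for g
  proof -
    define w where "w x = v x - p x" for x
    have w: "w \<in> L2 M" unfolding w_def by (intro L2_diff v VL p)
    define i where "i = L2_inner M w g"
    have le: "0 \<le> 2 * c * i + c\<^sup>2 * (L2_norm M g)\<^sup>2" for c
    proof -
      have "(\<lambda>x. p x + (- c) * g x) \<in> V"
        using V(1) p(1) g unfolding L2_subspace_def by blast
      then have "(L2_norm M w)\<^sup>2 \<le> (L2_norm M (\<lambda>x. v x - (p x + (- c) * g x)))\<^sup>2"
        using p(2)[of "\<lambda>x. p x + (- c) * g x"] by (simp add: J_def w_def[abs_def])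
      also have "(\<lambda>x. v x - (p x + (- c) * g x)) = (\<lambda>x. w x + c * g x)"
        by (auto simp: w_def)
      finally show ?thesis
        unfolding L2_norm_add_scale[OF w VL[OF g]] i_def by simp
    qed
    \<comment> \<open>The summand 1 keeps the divisor positive even if \<open>g\<close> has norm 0;
      the choice \<open>c = - i / n\<close> leaves a negative multiple of \<open>i\<^sup>2\<close>,
      which must not be below 0.\<close>
    define n where "n = (L2_norm M g)\<^sup>2 + 1"
    have n: "n > 0" by (simp add: n_def add_nonneg_pos)
    have "0 \<le> 2 * (- i / n) * i + (- i / n)\<^sup>2 * (n - 1)"
      using le[of "- i / n"] by (simp add: n_def)
    also have "\<dots> = - (i\<^sup>2 * (n + 1)) / n\<^sup>2"
      using n by (simp add: field_simps power2_eq_square)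
    finally have "i\<^sup>2 * (n + 1) \<le> 0"
      using n by (simp add: field_simps)
    then have "i = 0" using n by (simp add: mult_le_0_iff)
    then show ?thesis unfolding i_def w_def .
  qed
  with p(1) that show thesis by blast
qed

text \<open>Sequential weak compactness of balls: a diagonal subsequence converges against each
  of its own members; the set of vectors against which it converges is a closed subspace, so it
  contains, with the members, everything orthogonal to it.\<close>

lemma (in finite_measure) L2_weak_subseq:
  assumes f: "\<And>n. f n \<in> L2 M" and B: "\<And>n. L2_norm M (f n) \<le> B"
  obtains r where "strict_mono (r :: nat \<Rightarrow> nat)"
    "\<And>v. v \<in> L2 M \<Longrightarrow> convergent (\<lambda>n. L2_inner M (f (r n)) v)"
proof -
  have B0: "B \<ge> 0" using B[of 0] L2_norm_nonneg order_trans by blast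
  have ib: "\<bar>L2_inner M (f n) v\<bar> \<le> B * L2_norm M v" if "v \<in> L2 M" for n v
    using L2_Cauchy_Schwarz[OF f[of n] that] mult_right_mono[OF B[of n] L2_norm_nonneg[of M v]] by linarith
  \<comment> \<open>At stage \<open>m\<close> the subsequence is refined until the inner products
    with the member \<open>f m\<close> converge, which is possible because they form a bounded real
    sequence.\<close>
  interpret s: subseqs "\<lambda>m r. convergent (\<lambda>n. L2_inner M (f (r n)) (f m))"
  proof
    fix m and s :: "nat \<Rightarrow> nat" assume "strict_mono s"
    have "bounded (range (\<lambda>n. L2_inner M (f (s n)) (f m)))"
      by (rule boundedI[of _ "B * L2_norm M (f m)"]) (use ib f in auto)
    from bounded_imp_convergent_subsequence[OF this]
    show "\<exists>r'. strict_mono r' \<and> convergent (\<lambda>n. L2_inner M (f ((s \<circ> r') n)) (f m))"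
      by (auto simp: convergent_def o_def)
  qed
  define r where "r = s.diagseq"
  have r: "strict_mono r" unfolding r_def by (rule s.subseq_diagseq)
  have conv_f: "convergent (\<lambda>n. L2_inner M (f (r n)) (f m))" for m
  proof -
    \<comment> \<open>From index \<open>Suc m\<close> on, the diagonal is a subsequence of the stage
      that settles \<open>f m\<close>; the omitted initial terms are restored afterwards.\<close>
    have "convergent (\<lambda>n. L2_inner M (f ((s.diagseq \<circ> (+) (Suc m)) n)) (f m))"
    proof (rule s.diagseq_holds)
      fix s r' :: "nat \<Rightarrow> nat" and n
      assume "strict_mono r'" "convergent (\<lambda>i. L2_inner M (f (s i)) (f n))"
      from convergent_subseq_convergent[OF this(2,1)]
      show "convergent (\<lambda>i. L2_inner M (f ((s \<circ> r') i)) (f n))" by (simp add: o_def)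
    qed
    then have "convergent (\<lambda>n. (\<lambda>n. L2_inner M (f (r n)) (f m)) (n + Suc m))"
      by (simp add: r_def o_def add.commute)
    then show ?thesis by (subst (asm) convergent_ignore_initial_segment)
  qed
  define S where "S = {v \<in> L2 M. convergent (\<lambda>n. L2_inner M (f (r n)) v)}"
  have sub: "L2_subspace M S"
    unfolding L2_subspace_def S_def
    by (auto simp: L2_zero L2_add_scale L2_inner_add_scale_right f L2_inner_def[of _ _ "\<lambda>x. 0"]
        intro!: convergent_add convergent_mult convergent_const)
  have compl: "L2_complete M S"
    unfolding L2_complete_def
  proof (intro allI impI, elim conjE)
    fix s assume s: "\<forall>n. s n \<in> S" and C: "L2_Cauchy M s"
    then have sL: "\<And>n. s n \<in> L2 M" by (auto simp: S_def)
    obtain g where g: "g \<in> L2 M" and lim: "(\<lambda>n. L2_norm M (\<lambda>x. s n x - g x)) \<longlonglongrightarrow> 0"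
      using L2_complete_L2 C sL unfolding L2_complete_def by blast
    have "Cauchy (\<lambda>n. L2_inner M (f (r n)) g)"
    proof (rule metric_CauchyI)
      fix e :: real assume e: "e > 0"
      have "(\<lambda>n. B * L2_norm M (\<lambda>x. s n x - g x)) \<longlonglongrightarrow> B * 0"
        by (intro tendsto_intros lim)
      then have "\<forall>\<^sub>F n in sequentially. B * L2_norm M (\<lambda>x. s n x - g x) < e / 3"
        using e by (intro order_tendstoD(2)[of _ "B * 0"]) auto
      then obtain k where k: "B * L2_norm M (\<lambda>x. s k x - g x) < e / 3"
        by (auto simp: eventually_sequentially)
      have near: "\<bar>L2_inner M (f (r n)) (s k) - L2_inner M (f (r n)) g\<bar> < e / 3" for n
        using ib[OF L2_diff[OF sL[of k] g], of "r n"] k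
        by (simp add: L2_inner_diff_right f sL g)
      have "Cauchy (\<lambda>n. L2_inner M (f (r n)) (s k))"
        using s by (simp add: S_def Cauchy_convergent_iff)
      then obtain n0 where n0: "\<And>m n. m \<ge> n0 \<Longrightarrow> n \<ge> n0 \<Longrightarrow>
          dist (L2_inner M (f (r m)) (s k)) (L2_inner M (f (r n)) (s k)) < e / 3"
        using e by (meson metric_CauchyD divide_pos_pos zero_less_numeral)
      show "\<exists>n0. \<forall>m\<ge>n0. \<forall>n\<ge>n0. dist (L2_inner M (f (r m)) g) (L2_inner M (f (r n)) g) < e"
      proof (intro exI[of _ n0] allI impI)
        fix m n assume "m \<ge> n0" "n \<ge> n0"
        from n0[OF this] near[of m] near[of n]
        show "dist (L2_inner M (f (r m)) g) (L2_inner M (f (r n)) g) < e"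
          unfolding dist_real_def by linarith
      qed
    qed
    then have "g \<in> S" using g by (simp add: S_def Cauchy_convergent_iff)
    with lim show "\<exists>g\<in>S. (\<lambda>n. L2_norm M (\<lambda>x. s n x - g x)) \<longlonglongrightarrow> 0" by blast
  qed
  have "convergent (\<lambda>n. L2_inner M (f (r n)) v)" if v: "v \<in> L2 M" for v
  proof -
    obtain p where p: "p \<in> S" "\<And>g. g \<in> S \<Longrightarrow> L2_inner M (\<lambda>x. v x - p x) g = 0"
      using L2_projection[OF sub compl v] by blast
    have pL: "p \<in> L2 M" using p(1) by (simp add: S_def)
    have "L2_inner M (f (r n)) v = L2_inner M (f (r n)) p" for n
    proof -
      have "f (r n) \<in> S" using conv_f f by (simp add: S_def)
      from p(2)[OF this] show ?thesis
        by (subst (asm) L2_inner_commute) (simp add: L2_inner_diff_right f v pL)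
    qed
    then show ?thesis using p(1) by (simp add: S_def)
  qed
  with r that show thesis by blast
qed

section \<open>Symmetric bounded kernels\<close>

definition kernel_norm :: "real measure \<Rightarrow> (real \<Rightarrow> real \<Rightarrow> real) \<Rightarrow> real" where
  "kernel_norm M K = (SUP f \<in> {f \<in> L2 M. L2_norm M f \<le> 1}. L2_norm M (graphon_op M K f))"

text \<open>The bound one without a sign condition is what graphons and differences of two graphons
  share. Symmetry and bound hold at all points and not just almost everywhere, so
  \<open>op f x\<close> is controlled at each single label.\<close>

locale sym_kernel = prob_space M for M :: "real measure" +
  fixes K :: "real \<Rightarrow> real \<Rightarrow> real"
  assumes kernel_measurable: "(\<lambda>(x, y). K x y) \<in> borel_measurable (M \<Otimes>\<^sub>M M)"
    and kernel_sym: "x \<in> space M \<Longrightarrow> y \<in> space M \<Longrightarrow> K x y = K y x"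
    and kernel_bound: "x \<in> space M \<Longrightarrow> y \<in> space M \<Longrightarrow> \<bar>K x y\<bar> \<le> 1"
begin

abbreviation "op \<equiv> graphon_op M K"
abbreviation "\<sigma> \<equiv> kernel_norm M K"

lemma kernel_measurable' [measurable (raw)]:
  assumes [measurable]: "f \<in> measurable N M" "g \<in> measurable N M"
  shows "(\<lambda>z. K (f z) (g z)) \<in> borel_measurable N"
  using measurable_compose[OF measurable_Pair[OF assms] kernel_measurable] by simp

lemma kernel_section: "x \<in> space M \<Longrightarrow> K x \<in> L2 M" "x \<in> space M \<Longrightarrow> L2_norm M (K x) \<le> 1"
proof -
  assume x: "x \<in> space M"
  then have [measurable]: "K x \<in> borel_measurable M" by measurable
  have "L2_norm M (\<lambda>x. 1) = 1" by (simp add: L2_norm_def prob_space)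
  then show "K x \<in> L2 M" "L2_norm M (K x) \<le> 1"
    using L2_norm_mono[of "K x" M "\<lambda>x. 1"] kernel_bound[OF x] by (auto simp: L2_def)
qed

lemma op_eq_inner: "op f x = L2_inner M (K x) f"
  by (simp add: graphon_op_def L2_inner_def)

lemma op_bound: "f \<in> L2 M \<Longrightarrow> x \<in> space M \<Longrightarrow> \<bar>op f x\<bar> \<le> L2_norm M f"
  unfolding op_eq_inner
  using L2_Cauchy_Schwarz[OF kernel_section(1), of x f] mult_right_mono[OF kernel_section(2) L2_norm_nonneg, of x M f]
  by simp

text \<open>In contrast to \<open>op_bound\<close>, the pointwise bound on the kernel is used here.
  Applied to an eigenfunction it bounds the supremum by the mean norm.\<close>

lemma op_L1_bound:
  assumes "f \<in> L2 M" "x \<in> space M"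
  shows "\<bar>op f x\<bar> \<le> (\<integral>y. \<bar>f y\<bar> \<partial>M)"
proof -
  have "\<bar>op f x\<bar> \<le> (\<integral>y. \<bar>K x y * f y\<bar> \<partial>M)"
    unfolding graphon_op_def by (rule integral_abs_bound)
  also have "\<dots> \<le> (\<integral>y. \<bar>f y\<bar> \<partial>M)"
    using assms kernel_bound
    by (intro integral_mono integrable_abs L2_integrable L2_integrable_mult[OF kernel_section(1)])
      (auto simp: abs_mult mult_left_le_one_le)
  finally show ?thesis .
qed

lemma op_measurable [measurable (raw)]:
  assumes [measurable]: "f \<in> borel_measurable M"
  shows "op f \<in> borel_measurable M"
  unfolding graphon_op_def by measurable

lemma L2_bounded:
  assumes "f \<in> borel_measurable M" "\<And>x. x \<in> space M \<Longrightarrow> \<bar>f x\<bar> \<le> B"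
  shows "f \<in> L2 M" "L2_norm M f \<le> \<bar>B\<bar>"
proof -
  have "L2_norm M (\<lambda>x. B) = \<bar>B\<bar>" by (simp add: L2_norm_def prob_space)
  then show "f \<in> L2 M" "L2_norm M f \<le> \<bar>B\<bar>"
    using L2_norm_mono[of f M "\<lambda>x. B"] assms by (force simp: L2_def)+
qed

lemma op_L2: "f \<in> L2 M \<Longrightarrow> op f \<in> L2 M"
  and op_norm_le: "f \<in> L2 M \<Longrightarrow> L2_norm M (op f) \<le> L2_norm M f"
  using L2_bounded[of "op f" "L2_norm M f"] op_bound by (auto simp: L2_measurable)

lemma op_add_scale:
  "f \<in> L2 M \<Longrightarrow> g \<in> L2 M \<Longrightarrow> x \<in> space M \<Longrightarrow> op (\<lambda>y. f y + c * g y) x = op f x + c * op g x"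
  by (simp add: op_eq_inner L2_inner_add_scale_right kernel_section)

lemma op_diff:
  "f \<in> L2 M \<Longrightarrow> g \<in> L2 M \<Longrightarrow> x \<in> space M \<Longrightarrow> op (\<lambda>y. f y - g y) x = op f x - op g x"
  by (simp add: op_eq_inner L2_inner_diff_right kernel_section)

lemma L2_norm_cong_space: "(\<And>x. x \<in> space M \<Longrightarrow> f x = g x) \<Longrightarrow> L2_norm M f = L2_norm M g"
  unfolding L2_norm_def by (intro arg_cong[of _ _ sqrt] Bochner_Integration.integral_cong) auto

lemma kernel_norm_bdd: "bdd_above ((\<lambda>f. L2_norm M (op f)) ` {f \<in> L2 M. L2_norm M f \<le> 1})"
  by (rule bdd_aboveI[of _ 1]) (auto intro: order_trans[OF op_norm_le])

lemma kernel_norm_nonneg: "0 \<le> \<sigma>"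
proof -
  have "L2_norm M (op (\<lambda>x. 0)) \<le> \<sigma>"
    unfolding kernel_norm_def by (rule cSUP_upper[OF _ kernel_norm_bdd]) (simp add: L2_zero)
  then show ?thesis using L2_norm_nonneg order_trans by blast
qed

lemma op_norm_le_kernel_norm:
  assumes f: "f \<in> L2 M"
  shows "L2_norm M (op f) \<le> \<sigma> * L2_norm M f"
proof (cases "L2_norm M f = 0")
  case True
  then show ?thesis using op_norm_le[OF f] by simp
next
  case False
  define n where "n = L2_norm M f"
  have n: "n > 0" using False L2_norm_nonneg[of M f] unfolding n_def by linarith
  have "L2_norm M (\<lambda>x. 1 / n * f x) = 1" unfolding L2_norm_scale using n by (simp add: n_def)
  then have "L2_norm M (op (\<lambda>x. 1 / n * f x)) \<le> \<sigma>"
    unfolding kernel_norm_def by (intro cSUP_upper[OF _ kernel_norm_bdd]) (simp add: L2_scale[OF f, of "1/n", simplified])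
  moreover have "L2_norm M (op (\<lambda>x. 1 / n * f x)) = L2_norm M (\<lambda>x. 1 / n * op f x)"
    by (rule L2_norm_cong_space) (use op_add_scale[OF L2_zero f, of _ "1/n"] in \<open>simp add: graphon_op_def\<close>)
  ultimately have "1 / n * L2_norm M (op f) \<le> \<sigma>"
    using n by (simp add: L2_norm_scale del: times_divide_eq_left)
  then show ?thesis using n by (simp add: field_simps n_def)
qed

lemma kernel_norm_le:
  assumes "\<And>f. f \<in> L2 M \<Longrightarrow> L2_norm M f \<le> 1 \<Longrightarrow> L2_norm M (op f) \<le> B"
  shows "\<sigma> \<le> B"
  unfolding kernel_norm_def by (rule cSUP_least) (use assms L2_zero[of M] in \<open>auto intro!: exI[of _ "\<lambda>x. 0"]\<close>)

text \<open>Fubini, with the product of \<open>\<bar>f y\<bar>\<close> and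
  \<open>\<bar>g x\<bar>\<close> as dominating function, and symmetry of the kernel when the
  variables are exchanged.\<close>

lemma op_self_adjoint:
  assumes f: "f \<in> L2 M" and g: "g \<in> L2 M"
  shows "L2_inner M (op f) g = L2_inner M f (op g)"
proof -
  interpret pair_sigma_finite M M ..
  have [measurable]: "f \<in> borel_measurable M" "g \<in> borel_measurable M" using f g by measurable
  have "integrable (M \<Otimes>\<^sub>M M) (\<lambda>(x, y). K x y * f y * g x)"
  proof (rule Fubini_integrable)
    show "(\<lambda>(x, y). K x y * f y * g x) \<in> borel_measurable (M \<Otimes>\<^sub>M M)" by measurable
    show "AE x in M. integrable M (\<lambda>y. case (x, y) of (x, y) \<Rightarrow> K x y * f y * g x)"
      using L2_integrable_mult[OF kernel_section(1) f] by (auto intro!: AE_I2)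
    show "integrable M (\<lambda>x. \<integral>y. norm (case (x, y) of (x, y) \<Rightarrow> K x y * f y * g x) \<partial>M)"
    proof (rule Bochner_Integration.integrable_bound)
      show "integrable M (\<lambda>x. (\<integral>y. \<bar>f y\<bar> \<partial>M) * \<bar>g x\<bar>)"
        by (intro integrable_mult_right integrable_abs L2_integrable g)
      have "(\<integral>y. \<bar>K x y * f y * g x\<bar> \<partial>M) \<le> (\<integral>y. \<bar>f y\<bar> * \<bar>g x\<bar> \<partial>M)" if x: "x \<in> space M" for x
        using x kernel_bound
        by (intro integral_mono integrable_abs integrable_mult_left L2_integrable f L2_integrable_mult[OF kernel_section(1)])
          (auto simp: abs_mult mult.assoc mult_left_le_one_le)
      then show "AE x in M. norm (\<integral>y. norm (case (x, y) of (x, y) \<Rightarrow> K x y * f y * g x) \<partial>M)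
          \<le> norm ((\<integral>y. \<bar>f y\<bar> \<partial>M) * \<bar>g x\<bar>)"
        by (auto intro!: AE_I2 simp: abs_mult)
    qed measurable
  qed
  from Fubini_integral[OF this]
  have "(\<integral>y. (\<integral>x. K x y * f y * g x \<partial>M) \<partial>M) = (\<integral>x. (\<integral>y. K x y * f y * g x \<partial>M) \<partial>M)" .
  also have "(\<integral>x. (\<integral>y. K x y * f y * g x \<partial>M) \<partial>M) = L2_inner M (op f) g"
    by (simp add: L2_inner_def graphon_op_def)
  also have "(\<integral>y. (\<integral>x. K x y * f y * g x \<partial>M) \<partial>M) = (\<integral>y. (\<integral>x. f y * (K y x * g x) \<partial>M) \<partial>M)"
    by (intro Bochner_Integration.integral_cong refl) (use kernel_sym in \<open>simp add: mult_ac\<close>)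
  also have "\<dots> = L2_inner M f (op g)"
    by (simp add: L2_inner_def graphon_op_def)
  finally show ?thesis by simp
qed

text \<open>Compactness of the operator is immediate from the bounded kernel: along a weakly convergent
  sequence the images converge pointwise, hence in the mean square by dominated convergence.\<close>

lemma op_compact:
  assumes f: "\<And>n. f n \<in> L2 M" "\<And>n. L2_norm M (f n) \<le> 1"
  obtains r g where "strict_mono (r :: nat \<Rightarrow> nat)" "g \<in> L2 M"
    "(\<lambda>n. L2_norm M (\<lambda>x. op (f (r n)) x - g x)) \<longlonglongrightarrow> 0"
proof -
  obtain r where r: "strict_mono (r :: nat \<Rightarrow> nat)"
    "\<And>v. v \<in> L2 M \<Longrightarrow> convergent (\<lambda>n. L2_inner M (f (r n)) v)"
    by (rule L2_weak_subseq[where f = f and B = 1, OF f(1) f(2)]) (rule that)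
  define g where "g x = lim (\<lambda>n. op (f (r n)) x)" for x
  have fm [measurable]: "f n \<in> borel_measurable M" for n using f(1) by (rule L2_measurable)
  have gm [measurable]: "g \<in> borel_measurable M" unfolding g_def by measurable
  have lim: "(\<lambda>n. op (f (r n)) x) \<longlonglongrightarrow> g x" if "x \<in> space M" for x
    using r(2)[OF kernel_section(1)[OF that]]
    unfolding g_def op_eq_inner by (simp add: L2_inner_commute convergent_LIMSEQ_iff)
  have b: "\<bar>op (f n) x\<bar> \<le> 1" if "x \<in> space M" for n x
    using op_bound[OF f(1) that] f(2) order_trans by blast
  have gb: "\<bar>g x\<bar> \<le> 1" if "x \<in> space M" for x
    by (rule LIMSEQ_le_const2[OF tendsto_rabs[OF lim[OF that]]]) (use b that in blast)
  have "(\<lambda>n. \<integral>x. (op (f (r n)) x - g x)\<^sup>2 \<partial>M) \<longlonglongrightarrow> (\<integral>x. 0 \<partial>M)"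
  proof (rule integral_dominated_convergence[where w = "\<lambda>x. 4"])
    show "AE x in M. (\<lambda>n. (op (f (r n)) x - g x)\<^sup>2) \<longlonglongrightarrow> 0"
    proof (rule AE_I2)
      fix x assume "x \<in> space M"
      from tendsto_power[OF LIM_zero[OF lim[OF this]], of 2]
      show "(\<lambda>n. (op (f (r n)) x - g x)\<^sup>2) \<longlonglongrightarrow> 0" by simp
    qed
    show "AE x in M. norm ((op (f (r n)) x - g x)\<^sup>2) \<le> 4" for n
    proof (rule AE_I2)
      fix x assume "x \<in> space M"
      then have "\<bar>op (f (r n)) x - g x\<bar> \<le> 2" using b[of x "r n"] gb[of x] by linarith
      from power_mono[OF this, of 2] show "norm ((op (f (r n)) x - g x)\<^sup>2) \<le> 4" by simp
    qed
  qed simp_all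
  then have "(\<lambda>n. L2_norm M (\<lambda>x. op (f (r n)) x - g x)) \<longlonglongrightarrow> 0"
    unfolding L2_norm_def using tendsto_real_sqrt by fastforce
  with r(1) L2_bounded(1)[OF gm gb] that show thesis by blast
qed

section \<open>The operator norm as an eigenvalue\<close>

text \<open>A maximising sequence on the unit ball is not known to converge, but by compactness its
  images have a limit \<open>g\<close>, of norm \<open>\<sigma>\<close>, along a subsequence. Norms
  are maximised and not quadratic forms, so the sign of the eigenvalue is open: \<open>g\<close> is
  first shown to be an eigenfunction of the squared operator, which is then factored.\<close>

lemma op_eigenfunction:
  assumes pos: "\<sigma> > 0"
  obtains f l where "f \<in> L2 M" "\<not> (AE x in M. f x = 0)" "\<bar>l\<bar> = \<sigma>" "AE x in M. op f x = l * f x"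
proof -
  have "\<exists>f. f \<in> L2 M \<and> L2_norm M f \<le> 1 \<and> \<sigma> - 1 / real (Suc n) < L2_norm M (op f)" for n
  proof -
    have "\<sigma> - 1 / real (Suc n) < \<sigma>" by simp
    moreover have "{f \<in> L2 M. L2_norm M f \<le> 1} \<noteq> {}"
      using L2_zero[of M] by (auto intro!: exI[of _ "\<lambda>x. 0"])
    ultimately show ?thesis
      using less_cSUP_iff[OF _ kernel_norm_bdd, of "\<sigma> - 1 / real (Suc n)"]
      unfolding kernel_norm_def[symmetric] by blast
  qed
  then obtain f0 where f0: "\<And>n. f0 n \<in> L2 M" "\<And>n. L2_norm M (f0 n) \<le> 1"
    "\<And>n. \<sigma> - 1 / real (Suc n) < L2_norm M (op (f0 n))" by metis
  obtain r g where r: "strict_mono (r :: nat \<Rightarrow> nat)" and g: "g \<in> L2 M"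
    and lim: "(\<lambda>n. L2_norm M (\<lambda>x. op (f0 (r n)) x - g x)) \<longlonglongrightarrow> 0"
    by (rule op_compact[where f = f0, OF f0(1) f0(2)])
  define f where "f n = f0 (r n)" for n
  have f: "f n \<in> L2 M" "L2_norm M (f n) \<le> 1" for n using f0 by (auto simp: f_def)
  have lim: "(\<lambda>n. L2_norm M (\<lambda>x. op (f n) x - g x)) \<longlonglongrightarrow> 0" using lim by (simp add: f_def)
  have up: "L2_norm M (op (f n)) \<le> \<sigma>" for n
    unfolding kernel_norm_def by (rule cSUP_upper[OF _ kernel_norm_bdd]) (use f in simp)
  have "(\<lambda>n. L2_norm M (op (f0 n))) \<longlonglongrightarrow> \<sigma>"
  proof (rule tendsto_sandwich)
    show "(\<lambda>n. \<sigma> - 1 / real (Suc n)) \<longlonglongrightarrow> \<sigma>"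
      using tendsto_diff[OF tendsto_const[of \<sigma>] LIMSEQ_inverse_real_of_nat] by (simp add: inverse_eq_divide)
    show "\<forall>\<^sub>F n in sequentially. \<sigma> - 1 / real (Suc n) \<le> L2_norm M (op (f0 n))"
      using f0(3) by (intro always_eventually allI less_imp_le) auto
    show "\<forall>\<^sub>F n in sequentially. L2_norm M (op (f0 n)) \<le> \<sigma>"
      unfolding kernel_norm_def by (intro always_eventually allI cSUP_upper[OF _ kernel_norm_bdd]) (use f0 in simp)
  qed simp
  from LIMSEQ_subseq_LIMSEQ[OF this r] have nlim: "(\<lambda>n. L2_norm M (op (f n))) \<longlonglongrightarrow> \<sigma>"
    by (simp add: f_def o_def)
  have opf: "op (f n) \<in> L2 M" for n by (intro op_L2 f)
  have gn: "L2_norm M g = \<sigma>"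
    using LIMSEQ_unique[OF L2_norm_diff_tendsto[OF opf g lim] nlim] by simp
  \<comment> \<open>The distance of \<open>f n\<close> from being an eigenfunction of the squared
    operator for \<open>\<sigma>\<^sup>2\<close>. By self-adjointness the cross term is the squared
    norm of \<open>op (f n)\<close>, which tends to \<open>\<sigma>\<^sup>2\<close>, so the terms
    cancel in the limit.\<close>
  define e where "e n = L2_norm M (\<lambda>x. op (op (f n)) x - \<sigma>\<^sup>2 * f n x)" for n
  have e_sq: "(e n)\<^sup>2 \<le> \<sigma>\<^sup>2 * \<sigma>\<^sup>2 - \<sigma>\<^sup>2 * (L2_norm M (op (f n)))\<^sup>2" for n
  proof -
    have "(e n)\<^sup>2 = (L2_norm M (op (op (f n))))\<^sup>2 - 2 * \<sigma>\<^sup>2 * L2_inner M (op (op (f n))) (f n)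
        + (\<sigma>\<^sup>2)\<^sup>2 * (L2_norm M (f n))\<^sup>2"
      unfolding e_def using L2_norm_add_scale[OF op_L2[OF opf] f(1), of n "- \<sigma>\<^sup>2" n] by simp
    moreover have "L2_inner M (op (op (f n))) (f n) = (L2_norm M (op (f n)))\<^sup>2"
      by (simp add: op_self_adjoint[OF opf f(1)] L2_norm_power2)
    moreover have "(L2_norm M (op (op (f n))))\<^sup>2 \<le> \<sigma>\<^sup>2 * (L2_norm M (op (f n)))\<^sup>2"
      using power_mono[OF op_norm_le_kernel_norm[OF opf[of n]] L2_norm_nonneg, of 2]
      by (simp add: power_mult_distrib)
    moreover have "(\<sigma>\<^sup>2)\<^sup>2 * (L2_norm M (f n))\<^sup>2 \<le> (\<sigma>\<^sup>2)\<^sup>2 * 1"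
      using f(2)[of n] by (intro mult_left_mono) (auto simp: power_le_one)
    ultimately show ?thesis by (simp add: power2_eq_square[of "\<sigma>\<^sup>2"])
  qed
  have "(\<lambda>n. \<sigma>\<^sup>2 * \<sigma>\<^sup>2 - \<sigma>\<^sup>2 * (L2_norm M (op (f n)))\<^sup>2) \<longlonglongrightarrow> \<sigma>\<^sup>2 * \<sigma>\<^sup>2 - \<sigma>\<^sup>2 * \<sigma>\<^sup>2"
    by (intro tendsto_intros nlim)
  then have "(\<lambda>n. \<sigma>\<^sup>2 * \<sigma>\<^sup>2 - \<sigma>\<^sup>2 * (L2_norm M (op (f n)))\<^sup>2) \<longlonglongrightarrow> 0" by simp
  from Lim_null_comparison[OF _ this, of "\<lambda>n. (e n)\<^sup>2"] e_sq
  have "(\<lambda>n. (e n)\<^sup>2) \<longlonglongrightarrow> 0" by simp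
  from tendsto_real_sqrt[OF this] have elim: "e \<longlonglongrightarrow> 0" by (simp add: e_def[abs_def])
  define d where "d n = L2_norm M (\<lambda>x. op (f n) x - g x)" for n
  have opg: "op g \<in> L2 M" "op (op g) \<in> L2 M" by (intro op_L2 g)+
  \<comment> \<open>Only the images converge, so the operator is applied once more: from
    \<open>op (op g)\<close> through \<open>op (op (op (f n)))\<close> and
    \<open>\<sigma>\<^sup>2 * op (f n) x\<close> to \<open>\<sigma>\<^sup>2 * g x\<close>.\<close>
  have key: "L2_norm M (\<lambda>x. op (op g) x - \<sigma>\<^sup>2 * g x) \<le> \<sigma> * \<sigma> * d n + (\<sigma> * e n + \<sigma>\<^sup>2 * d n)" for n
  proof -
    let ?a = "op (op g)" and ?b = "op (op (op (f n)))" and ?c = "\<lambda>x. \<sigma>\<^sup>2 * op (f n) x" and ?d = "\<lambda>x. \<sigma>\<^sup>2 * g x"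
    have L: "?a \<in> L2 M" "?b \<in> L2 M" "?c \<in> L2 M" "?d \<in> L2 M"
      by (intro op_L2 L2_scale g f)+
    have "L2_norm M (\<lambda>x. ?a x - ?d x) \<le> L2_norm M (\<lambda>x. ?a x - ?b x) + L2_norm M (\<lambda>x. ?b x - ?d x)"
      by (rule L2_triangle_diff[OF L(1,2,4)])
    moreover have "L2_norm M (\<lambda>x. ?b x - ?d x) \<le> L2_norm M (\<lambda>x. ?b x - ?c x) + L2_norm M (\<lambda>x. ?c x - ?d x)"
      by (rule L2_triangle_diff[OF L(2,3,4)])
    moreover have "L2_norm M (\<lambda>x. ?a x - ?b x) \<le> \<sigma> * \<sigma> * d n"
    proof -
      have 1: "L2_norm M (\<lambda>x. ?a x - ?b x) = L2_norm M (op (\<lambda>x. op g x - op (op (f n)) x))"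
        by (rule L2_norm_cong_space) (simp add: op_diff opg op_L2 opf)
      have 2: "L2_norm M (\<lambda>x. op g x - op (op (f n)) x) = L2_norm M (op (\<lambda>x. g x - op (f n) x))"
        by (rule L2_norm_cong_space) (simp add: op_diff g opf)
      have "L2_norm M (\<lambda>x. ?a x - ?b x) \<le> \<sigma> * L2_norm M (op (\<lambda>x. g x - op (f n) x))"
        unfolding 1 by (rule order_trans[OF op_norm_le_kernel_norm]) (auto intro!: L2_diff opg op_L2 f simp: 2)
      also have "\<dots> \<le> \<sigma> * (\<sigma> * L2_norm M (\<lambda>x. g x - op (f n) x))"
        by (intro mult_left_mono op_norm_le_kernel_norm L2_diff g opf kernel_norm_nonneg)
      finally show ?thesis by (simp add: d_def L2_norm_minus_commute[of M g])
    qed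
    moreover have "L2_norm M (\<lambda>x. ?b x - ?c x) \<le> \<sigma> * e n"
    proof -
      have "L2_norm M (\<lambda>x. ?b x - ?c x) = L2_norm M (op (\<lambda>x. op (op (f n)) x + (- \<sigma>\<^sup>2) * f n x))"
        by (rule L2_norm_cong_space) (use op_add_scale[OF op_L2[OF opf[of n]] f(1)[of n], where c = "- \<sigma>\<^sup>2"] in simp)
      also have "\<dots> \<le> \<sigma> * L2_norm M (\<lambda>x. op (op (f n)) x + (- \<sigma>\<^sup>2) * f n x)"
        by (intro op_norm_le_kernel_norm L2_add_scale op_L2 f)
      finally show ?thesis by (simp add: e_def)
    qed
    moreover have "L2_norm M (\<lambda>x. ?c x - ?d x) = \<sigma>\<^sup>2 * d n"
      using L2_norm_scale[of M "\<sigma>\<^sup>2" "\<lambda>x. op (f n) x - g x"] by (simp add: d_def right_diff_distrib)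
    ultimately show ?thesis by linarith
  qed
  have "(\<lambda>n. \<sigma> * \<sigma> * d n + (\<sigma> * e n + \<sigma>\<^sup>2 * d n)) \<longlonglongrightarrow> \<sigma> * \<sigma> * 0 + (\<sigma> * 0 + \<sigma>\<^sup>2 * 0)"
    by (intro tendsto_intros elim lim[folded d_def])
  then have "L2_norm M (\<lambda>x. op (op g) x - \<sigma>\<^sup>2 * g x) \<le> 0"
    using key by (intro LIMSEQ_le_const) auto
  then have "L2_norm M (\<lambda>x. op (op g) x - \<sigma>\<^sup>2 * g x) = 0"
    using L2_norm_nonneg order_antisym by blast
  then have sq: "AE x in M. op (op g) x = \<sigma>\<^sup>2 * g x"
    by (subst (asm) L2_norm_eq_0_iff) (auto intro!: L2_diff opg L2_scale g)
  \<comment> \<open>The squared operator minus \<open>\<sigma>\<^sup>2\<close> factors. Either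
    \<open>op\<close> plus \<open>\<sigma>\<close> kills \<open>g\<close>, giving the eigenvalue
    \<open>- \<sigma>\<close>, or \<open>h\<close> is nonzero and \<open>op\<close> minus
    \<open>\<sigma>\<close> kills it.\<close>
  define h where "h x = op g x + \<sigma> * g x" for x
  have h: "h \<in> L2 M" unfolding h_def by (intro L2_add_scale opg g)
  show thesis
  proof (cases "AE x in M. h x = 0")
    case True
    then have "AE x in M. op g x = - \<sigma> * g x" by eventually_elim (simp add: h_def)
    moreover have "\<not> (AE x in M. g x = 0)"
      using gn pos by (simp flip: L2_norm_eq_0_iff[OF g])
    ultimately show thesis using that[OF g, of "- \<sigma>"] pos by simp
  next
    case False
    have "AE x in M. op h x = \<sigma> * h x"
      using sq AE_space
    proof eventually_elim
      case (elim x)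
      then show ?case
        unfolding h_def by (subst op_add_scale) (auto simp: opg g algebra_simps power2_eq_square)
    qed
    with that[OF h False, of \<sigma>] pos show thesis by simp
  qed
qed

text \<open>Taking absolute values in the eigenvalue equation gives
  \<open>\<sigma> * g x \<le> op g x\<close> for \<open>g = \<bar>f\<bar>\<close>, whichever sign
  the eigenvalue has. Together with the norm bound this forces equality and so removes the sign
  ambiguity.\<close>

lemma kernel_norm_eigenvalue:
  assumes nonneg: "\<And>x y. x \<in> space M \<Longrightarrow> y \<in> space M \<Longrightarrow> 0 \<le> K x y"
  shows "graphon_eigenvalue M K \<sigma>"
proof (cases "\<sigma> = 0")
  case True
  \<comment> \<open>\<open>op_eigenfunction\<close> starts from a positive norm. For norm 0 the
    constant one is an eigenfunction, nonzero because the measure is a probability.\<close>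
  have one: "(\<lambda>x. 1) \<in> L2 M" by (simp add: L2_def)
  have "L2_norm M (op (\<lambda>x. 1)) = 0"
    using op_norm_le_kernel_norm[OF one] True L2_norm_nonneg[of M "op (\<lambda>x. 1)"] by simp
  then have "AE x in M. op (\<lambda>x. 1) x = 0"
    by (simp add: L2_norm_eq_0_iff op_L2 one)
  moreover have "\<not> (AE x in M. (1::real) = 0)" by (simp add: AE_const)
  ultimately show ?thesis
    unfolding graphon_eigenvalue_def True by (intro bexI[of _ "\<lambda>x. 1"]) auto
next
  case False
  then have pos: "\<sigma> > 0" using kernel_norm_nonneg by simp
  obtain f l where f: "f \<in> L2 M" "\<not> (AE x in M. f x = 0)" and l: "\<bar>l\<bar> = \<sigma>"
    and eig: "AE x in M. op f x = l * f x"
    using op_eigenfunction[OF pos] .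
  define g where "g x = \<bar>f x\<bar>" for x
  have g: "g \<in> L2 M" unfolding g_def by (intro L2_abs f)
  have le: "AE x in M. \<sigma> * g x \<le> op g x"
    using eig AE_space
  proof eventually_elim
    case (elim x)
    then have "\<sigma> * g x = \<bar>op f x\<bar>" by (simp add: g_def abs_mult l)
    also have "\<dots> \<le> (\<integral>y. \<bar>K x y * f y\<bar> \<partial>M)"
      unfolding graphon_op_def by (rule integral_abs_bound)
    also have "\<dots> = op g x"
      unfolding graphon_op_def g_def using nonneg elim(2)
      by (intro Bochner_Integration.integral_cong) (auto simp: abs_mult)
    finally show ?case .
  qed
  have "\<sigma> * (L2_norm M g)\<^sup>2 = L2_inner M (\<lambda>x. \<sigma> * g x) g"
    by (simp add: L2_norm_power2 L2_inner_def mult.assoc)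
  also have "\<dots> \<le> L2_inner M (op g) g"
    unfolding L2_inner_def
  proof (rule integral_mono_AE)
    show "AE x in M. \<sigma> * g x * g x \<le> op g x * g x"
      using le by eventually_elim (rule mult_right_mono, auto simp: g_def)
  qed (intro L2_integrable_mult L2_scale op_L2 g)+
  finally have i: "\<sigma> * (L2_norm M g)\<^sup>2 \<le> L2_inner M (op g) g" .
  \<comment> \<open>After expanding the square, the operator bound on the first term and the lower
    bound \<open>i\<close> on the cross term make everything cancel.\<close>
  have "(L2_norm M (\<lambda>x. op g x + (- \<sigma>) * g x))\<^sup>2
      = (L2_norm M (op g))\<^sup>2 - 2 * \<sigma> * L2_inner M (op g) g + \<sigma>\<^sup>2 * (L2_norm M g)\<^sup>2"
    using L2_norm_add_scale[OF op_L2[OF g] g, of "- \<sigma>"] by simp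
  also have "\<dots> \<le> \<sigma>\<^sup>2 * (L2_norm M g)\<^sup>2 - 2 * \<sigma> * (\<sigma> * (L2_norm M g)\<^sup>2) + \<sigma>\<^sup>2 * (L2_norm M g)\<^sup>2"
  proof -
    have "(L2_norm M (op g))\<^sup>2 \<le> \<sigma>\<^sup>2 * (L2_norm M g)\<^sup>2"
      using power_mono[OF op_norm_le_kernel_norm[OF g] L2_norm_nonneg, of 2] by (simp add: power_mult_distrib)
    moreover have "2 * \<sigma> * (\<sigma> * (L2_norm M g)\<^sup>2) \<le> 2 * \<sigma> * L2_inner M (op g) g"
      by (rule mult_left_mono[OF i]) (use pos in simp)
    ultimately show ?thesis by linarith
  qed
  also have "\<dots> = 0" by (simp add: power2_eq_square)
  finally have "L2_norm M (\<lambda>x. op g x + (- \<sigma>) * g x) = 0" by simp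
  then have "AE x in M. op g x + (- \<sigma>) * g x = 0"
    by (subst (asm) L2_norm_eq_0_iff) (intro L2_add_scale op_L2 g)
  then have "AE x in M. op g x = \<sigma> * g x" by eventually_elim simp
  moreover have "\<not> (AE x in M. g x = 0)" using f(2) by (simp add: g_def)
  ultimately show ?thesis
    unfolding graphon_eigenvalue_def using g by (auto simp: L2_def)
qed

text \<open>The norm bound on an eigenfunction limits every eigenvalue by \<open>\<sigma>\<close>,
  which is itself one, so \<open>GREATEST\<close> is attained. This turns the eigenvalue condition
  of the game into a contraction condition.\<close>

lemma lambda1_eq_kernel_norm:
  assumes "\<And>x y. x \<in> space M \<Longrightarrow> y \<in> space M \<Longrightarrow> 0 \<le> K x y"
  shows "lambda1 M K = \<sigma>"
  unfolding lambda1_def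
proof (rule Greatest_equality)
  show "graphon_eigenvalue M K \<sigma>" by (rule kernel_norm_eigenvalue[OF assms])
  fix l assume "graphon_eigenvalue M K l"
  then obtain f where f: "f \<in> L2 M" "\<not> (AE x in M. f x = 0)" and eig: "AE x in M. op f x = l * f x"
    by (auto simp: graphon_eigenvalue_def L2_def)
  have "L2_norm M (op f) = L2_norm M (\<lambda>x. l * f x)"
    by (rule L2_norm_cong_AE) (use eig f(1) in \<open>auto simp: L2_measurable\<close>)
  then have "\<bar>l\<bar> * L2_norm M f \<le> \<sigma> * L2_norm M f"
    using op_norm_le_kernel_norm[OF f(1)] by (simp add: L2_norm_scale)
  moreover have "L2_norm M f > 0"
    using f(2) L2_norm_nonneg[of M f] by (simp add: less_le flip: L2_norm_eq_0_iff[OF f(1)])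
  ultimately show "l \<le> \<sigma>" by simp
qed

end

text \<open>Transfers smallness of the operator norm from the graphon \<open>K\<close> to a nearby
  step graphon \<open>K'\<close>. That the difference is a kernel is a separate assumption because
  the bounds on \<open>K\<close> and \<open>K'\<close> alone only give two.\<close>

lemma kernel_norm_le_add_diff:
  assumes "sym_kernel M K" "sym_kernel M K'" "sym_kernel M (K - K')"
  shows "kernel_norm M K' \<le> kernel_norm M K + kernel_norm M (K - K')"
proof -
  interpret K: sym_kernel M K by fact
  interpret K': sym_kernel M K' by fact
  interpret D: sym_kernel M "K - K'" by fact
  show ?thesis
  proof (rule K'.kernel_norm_le)
    fix f assume f: "f \<in> L2 M" "L2_norm M f \<le> 1"
    have "K'.op f x = K.op f x - D.op f x" if "x \<in> space M" for x
      using f(1) that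
      by (simp add: graphon_op_def left_diff_distrib L2_integrable_mult K.kernel_section K'.kernel_section)
    then have "L2_norm M (K'.op f) = L2_norm M (\<lambda>x. K.op f x + (-1) * D.op f x)"
      by (intro K.L2_norm_cong_space) simp
    also have "\<dots> \<le> L2_norm M (K.op f) + L2_norm M (\<lambda>x. (-1) * D.op f x)"
      by (intro L2_triangle L2_scale K.op_L2 D.op_L2 f)
    also have "\<dots> \<le> kernel_norm M K * L2_norm M f + kernel_norm M (K - K') * L2_norm M f"
      unfolding L2_norm_scale using K.op_norm_le_kernel_norm[OF f(1)] D.op_norm_le_kernel_norm[OF f(1)] by simp
    also have "\<dots> \<le> kernel_norm M K + kernel_norm M (K - K')"
      using f(2) K.kernel_norm_nonneg D.kernel_norm_nonneg by (intro add_mono mult_left_le) auto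
    finally show "L2_norm M (K'.op f) \<le> kernel_norm M K + kernel_norm M (K - K')" .
  qed
qed

section \<open>The cut norm\<close>

context
  fixes \<nu> :: "real measure"
  assumes ext: "extends_lebesgue_space \<nu>"
begin

lemma extends_lebesgue_prob: "prob_space \<nu>"
  and extends_lebesgue_space_eq: "space \<nu> = {0..1}"
  and extends_lebesgue_sets: "A \<in> sets (lebesgue_on {0..1}) \<Longrightarrow> A \<in> sets \<nu>"
  and extends_lebesgue_emeasure:
    "A \<in> sets (lebesgue_on {0..1}) \<Longrightarrow> emeasure \<nu> A = emeasure (lebesgue_on {0..1}) A"
  using ext by (auto simp: extends_lebesgue_space_def)

text \<open>Lebesgue measurable kernels become measurable for \<nu> by composition with this
  identity map, whose domain carries the larger sigma-algebra.\<close>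

lemma extends_lebesgue_ident [measurable]: "(\<lambda>x. x) \<in> measurable \<nu> (lebesgue_on {0..1})"
proof (rule measurableI)
  fix A assume A: "A \<in> sets (lebesgue_on {0..1::real})"
  then have "A \<subseteq> {0..1}" using sets.sets_into_space[OF A] by simp
  then have "(\<lambda>x. x) -` A \<inter> space \<nu> = A" by (auto simp: extends_lebesgue_space_eq)
  with A show "(\<lambda>x. x) -` A \<inter> space \<nu> \<in> sets \<nu>" by (simp add: extends_lebesgue_sets)
qed (simp add: extends_lebesgue_space_eq)

lemma borel_sets_lebesgue_on: "S \<in> sets borel \<Longrightarrow> S \<subseteq> {0..1} \<Longrightarrow> S \<in> sets (lebesgue_on {0..1::real})"
  by (auto simp: sets_restrict_space_iff)

text \<open>The cut norm ranges over Borel sets, whereas the sign sets tested later are only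
  Lebesgue measurable. The Borel main part in the completion differs from \<open>S\<close> by a
  Lebesgue null set, which is null for \<nu> since the measures agree on it.\<close>

lemma lebesgue_set_borel_part:
  assumes "S \<in> sets (lebesgue_on {0..1})"
  obtains B where "B \<in> sets borel" "B \<subseteq> {0..1}" "AE x in \<nu>. x \<in> B \<longleftrightarrow> x \<in> S"
proof -
  have S: "S \<in> sets lebesgue" "S \<subseteq> {0..1}" using assms by (auto simp: sets_restrict_space_iff)
  interpret prob_space \<nu> by (rule extends_lebesgue_prob)
  define B where "B = main_part lborel S"
  have B: "B \<in> sets borel" using S(1) main_part_sets[of S lborel] by (simp add: B_def)
  have BS: "B \<subseteq> S" using main_part_null_part_Un[OF S(1)] unfolding B_def by blast
  have B': "B \<in> sets (lebesgue_on {0..1})" using B BS S(2) by (intro borel_sets_lebesgue_on) auto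
  have "emeasure lebesgue S = emeasure lebesgue B"
    using S(1) B by (simp add: B_def)
  then have "emeasure \<nu> S = emeasure \<nu> B"
    using assms B' BS S by (simp add: extends_lebesgue_emeasure emeasure_restrict_space)
  then have "emeasure \<nu> (S - B) = 0"
    using assms B' BS by (subst emeasure_Diff) (auto simp: extends_lebesgue_sets)
  then have "AE x in \<nu>. x \<notin> S - B"
    using assms B' by (intro AE_not_in null_setsI sets.Diff extends_lebesgue_sets) auto
  then have "AE x in \<nu>. x \<in> B \<longleftrightarrow> x \<in> S" by (rule eventually_mono) (use BS in auto)
  with B BS S(2) that show thesis by blast
qed

context
  fixes D :: "real \<Rightarrow> real \<Rightarrow> real"
  assumes D_meas: "(\<lambda>(x, y). D x y) \<in> borel_measurable (lebesgue_on {0..1} \<Otimes>\<^sub>M lebesgue_on {0..1})"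
    and D_sym: "\<And>x y. x \<in> {0..1} \<Longrightarrow> y \<in> {0..1} \<Longrightarrow> D x y = D y x"
    and D_bound: "\<And>x y. x \<in> {0..1} \<Longrightarrow> y \<in> {0..1} \<Longrightarrow> \<bar>D x y\<bar> \<le> 1"
begin

lemma lebesgue_kernel_compose [measurable (raw)]:
  assumes [measurable]: "f \<in> measurable N (lebesgue_on {0..1})" "g \<in> measurable N (lebesgue_on {0..1})"
  shows "(\<lambda>z. D (f z) (g z)) \<in> borel_measurable N"
  using measurable_compose[OF measurable_Pair[OF assms] D_meas] by simp

lemma lebesgue_sym_kernel: "sym_kernel \<nu> D"
proof -
  interpret prob_space \<nu> by (rule extends_lebesgue_prob)
  show ?thesis
  proof
    have [measurable]: "fst \<in> measurable (\<nu> \<Otimes>\<^sub>M \<nu>) (lebesgue_on {0..1})" "snd \<in> measurable (\<nu> \<Otimes>\<^sub>M \<nu>) (lebesgue_on {0..1})"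
      by (rule measurable_compose[OF _ extends_lebesgue_ident], simp)+
    show "(\<lambda>(x, y). D x y) \<in> borel_measurable (\<nu> \<Otimes>\<^sub>M \<nu>)"
      unfolding split_beta by measurable
  qed (simp_all add: extends_lebesgue_space_eq D_sym D_bound)
qed

interpretation sym_kernel \<nu> D by (rule lebesgue_sym_kernel)

text \<open>The free variable enters through the kernel alone, which is Lebesgue measurable in it.
  So even if \<open>f\<close> is measurable only for the larger sigma-algebra, the sets where
  \<open>op f\<close> is positive or negative come within reach of the cut norm.\<close>

lemma op_lebesgue_measurable:
  assumes [measurable]: "f \<in> borel_measurable \<nu>"
  shows "op f \<in> borel_measurable (lebesgue_on {0..1})"
proof -
  have [measurable]: "snd \<in> measurable (lebesgue_on {0..1} \<Otimes>\<^sub>M \<nu>) (lebesgue_on {0..1})"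
    by (rule measurable_compose[OF _ extends_lebesgue_ident], simp)
  show ?thesis unfolding graphon_op_def by measurable
qed

text \<open>A supremum of reals is informative only for bounded sets; each use of
  \<open>cut_norm\<close> as an upper bound rests on this.\<close>

lemma cut_norm_bdd:
  "bdd_above ((\<lambda>(S1, S2). \<bar>LINT x:S1|\<nu>. (LINT y:S2|\<nu>. D x y)\<bar>) `
     ({S \<in> sets borel. S \<subseteq> {0..1}} \<times> {S \<in> sets borel. S \<subseteq> {0..1}}))"
proof (rule bdd_aboveI[of _ 1], clarsimp)
  fix S1 S2 :: "real set"
  assume S: "S1 \<in> sets borel" "S1 \<subseteq> {0..1}" "S2 \<in> sets borel" "S2 \<subseteq> {0..1}"
  then have [measurable]: "S1 \<in> sets \<nu>" "S2 \<in> sets \<nu>"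
    by (auto intro!: extends_lebesgue_sets borel_sets_lebesgue_on)
  have i: "indicator S1 \<in> L2 \<nu>" "indicator S2 \<in> L2 \<nu>"
    "L2_norm \<nu> (indicator S1) \<le> 1" "L2_norm \<nu> (indicator S2) \<le> 1"
    using L2_bounded[of "indicator S1" 1] L2_bounded[of "indicator S2" 1]
    by (auto simp: indicator_def)
  have "(LINT x:S1|\<nu>. (LINT y:S2|\<nu>. D x y)) = L2_inner \<nu> (indicator S1) (op (indicator S2))"
    by (simp add: set_lebesgue_integral_def L2_inner_def graphon_op_def mult.commute)
  moreover have "\<bar>L2_inner \<nu> (indicator S1) (op (indicator S2))\<bar> \<le> 1"
    using L2_Cauchy_Schwarz[OF i(1) op_L2[OF i(2)]] op_norm_le[OF i(2)] i(3,4)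
    by (smt (verit) L2_norm_nonneg mult_le_one)
  ultimately show "\<bar>LINT x:S1|\<nu>. (LINT y:S2|\<nu>. D x y)\<bar> \<le> 1" by simp
qed

lemma cut_norm_nonneg: "0 \<le> cut_norm \<nu> D"
  unfolding cut_norm_def
  by (rule cSUP_upper2[OF cut_norm_bdd, of "({}, {})"]) auto

text \<open>Set integrals are inner products with indicators, hence unchanged when both sets are
  replaced by their Borel parts.\<close>

lemma cut_norm_lebesgue_sets:
  assumes S: "S \<in> sets (lebesgue_on {0..1})" "S' \<in> sets (lebesgue_on {0..1})"
  shows "\<bar>L2_inner \<nu> (indicator S) (op (indicator S'))\<bar> \<le> cut_norm \<nu> D"
proof -
  obtain B where B: "B \<in> sets borel" "B \<subseteq> {0..1}" "AE x in \<nu>. x \<in> B \<longleftrightarrow> x \<in> S"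
    using lebesgue_set_borel_part[OF S(1)] .
  obtain B' where B': "B' \<in> sets borel" "B' \<subseteq> {0..1}" "AE x in \<nu>. x \<in> B' \<longleftrightarrow> x \<in> S'"
    using lebesgue_set_borel_part[OF S(2)] .
  have [measurable]: "S \<in> sets \<nu>" "S' \<in> sets \<nu>" "B \<in> sets \<nu>" "B' \<in> sets \<nu>"
    using S B B' by (auto intro!: extends_lebesgue_sets borel_sets_lebesgue_on)
  have "op (indicator S') x = op (indicator B') x" if [measurable]: "x \<in> space \<nu>" for x
    unfolding graphon_op_def
    by (rule integral_cong_AE) (use B'(3) in \<open>auto simp: indicator_def elim!: eventually_mono\<close>)
  then have "L2_inner \<nu> (indicator S) (op (indicator S')) = L2_inner \<nu> (indicator S) (op (indicator B'))"
    unfolding L2_inner_def by (intro Bochner_Integration.integral_cong) auto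
  also have "\<dots> = L2_inner \<nu> (indicator B) (op (indicator B'))"
    unfolding L2_inner_def
    by (rule integral_cong_AE) (use B(3) in \<open>auto simp: indicator_def elim!: eventually_mono\<close>)
  also have "\<dots> = (LINT x:B|\<nu>. (LINT y:B'|\<nu>. D x y))"
    by (simp add: set_lebesgue_integral_def L2_inner_def graphon_op_def mult.commute)
  finally show ?thesis
    unfolding cut_norm_def
    using B B' by (intro cSUP_upper2[OF cut_norm_bdd, of "(B, B')"]) auto
qed

text \<open>If \<open>D f = l f\<close> with \<open>\<bar>l\<bar> = \<sigma>\<close>, then \<open>\<sigma> \<parallel>f\<parallel>\<^sub>\<infinity> \<le> \<parallel>f\<parallel>\<^sub>1\<close> because the kernel is bounded by one, and
  \<open>\<sigma> \<parallel>f\<parallel>\<^sub>1 \<le> 4 \<parallel>D\<parallel>\<^sub>\<box> \<parallel>f\<parallel>\<^sub>\<infinity>\<close> by testing against signs; this replaces the interpolation argument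
  usually given for this comparison.\<close>

lemma kernel_norm_le_cut_norm: "\<sigma>\<^sup>2 \<le> 4 * cut_norm \<nu> D"
proof (cases "\<sigma> = 0")
  case True
  then show ?thesis using cut_norm_nonneg by simp
next
  case False
  then have pos: "\<sigma> > 0" using kernel_norm_nonneg by simp
  obtain f l where f: "f \<in> L2 \<nu>" "\<not> (AE x in \<nu>. f x = 0)" and l: "\<bar>l\<bar> = \<sigma>"
    and eig: "AE x in \<nu>. op f x = l * f x"
    using op_eigenfunction[OF pos] .
  have [measurable]: "f \<in> borel_measurable \<nu>" using f(1) by (rule L2_measurable)
  \<comment> \<open>The sign of \<open>op h\<close>, written as a difference of two indicators so
    that the cut norm applies to it.\<close>
  define s where "s h x = (indicator {x \<in> {0..1}. 0 < op h x} x - indicator {x \<in> {0..1}. op h x < 0} x :: real)"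
    for h x
  have sets_s: "{x \<in> {0..1}. 0 < op h x} \<in> sets (lebesgue_on {0..1})" "{x \<in> {0..1}. op h x < 0} \<in> sets (lebesgue_on {0..1})"
    if "h \<in> borel_measurable \<nu>" for h
  proof -
    have [measurable]: "op h \<in> borel_measurable (lebesgue_on {0..1})" by (rule op_lebesgue_measurable[OF that])
    have "{x \<in> space (lebesgue_on {0..1}). 0 < op h x} \<in> sets (lebesgue_on {0..1})"
      "{x \<in> space (lebesgue_on {0..1}). op h x < 0} \<in> sets (lebesgue_on {0..1})" by measurable
    then show "{x \<in> {0..1}. 0 < op h x} \<in> sets (lebesgue_on {0..1})" "{x \<in> {0..1}. op h x < 0} \<in> sets (lebesgue_on {0..1})"
      by simp_all
  qed
  have ind: "indicator S \<in> L2 \<nu>" if "S \<in> sets (lebesgue_on {0..1})" for S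
    using extends_lebesgue_sets[OF that] L2_bounded(1)[of "indicator S" 1] by (auto simp: indicator_def)
  have s_L2: "s h \<in> L2 \<nu>" if "h \<in> borel_measurable \<nu>" for h
    unfolding s_def by (intro L2_diff ind sets_s that)
  have s_abs: "s h x * op h x = \<bar>op h x\<bar>" if "x \<in> space \<nu>" for h x
    using that by (auto simp: s_def extends_lebesgue_space_eq indicator_def)
  have L1: "L2_inner \<nu> (s h) (op h) = (\<integral>x. \<bar>op h x\<bar> \<partial>\<nu>)" for h
    unfolding L2_inner_def by (intro Bochner_Integration.integral_cong s_abs refl)
  define A where "A = (\<integral>x. \<bar>f x\<bar> \<partial>\<nu>)"
  have "A \<noteq> 0"
    unfolding A_def using f by (subst integral_nonneg_eq_0_iff_AE) (auto intro!: L2_integrable L2_abs)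
  moreover have "A \<ge> 0" unfolding A_def by simp
  ultimately have A: "A > 0" by simp
  have sup: "AE x in \<nu>. \<bar>f x\<bar> \<le> A / \<sigma>"
    using eig AE_space
  proof eventually_elim
    case (elim x)
    then have "\<sigma> * \<bar>f x\<bar> = \<bar>op f x\<bar>" by (simp add: abs_mult l)
    also have "\<dots> \<le> A" unfolding A_def by (rule op_L1_bound[OF f(1) elim(2)])
    finally show ?case using pos by (simp add: field_simps)
  qed
  define k where "k = s f"
  have k: "k \<in> L2 \<nu>" unfolding k_def by (intro s_L2) simp
  have "\<sigma> * A = (\<integral>x. \<bar>op f x\<bar> \<partial>\<nu>)"
  proof -
    have "(\<integral>x. \<bar>op f x\<bar> \<partial>\<nu>) = (\<integral>x. \<sigma> * \<bar>f x\<bar> \<partial>\<nu>)"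
      by (rule integral_cong_AE) (use eig in \<open>auto simp: abs_mult l elim!: eventually_mono\<close>)
    then show ?thesis by (simp add: A_def)
  qed
  \<comment> \<open>Self-adjointness moves the operator onto the sign function \<open>k\<close>, so
    that \<open>f\<close> can be replaced by its supremum bound.\<close>
  also have "\<dots> = L2_inner \<nu> (op k) f"
    unfolding k_def L1[symmetric] by (rule op_self_adjoint[symmetric]) (auto intro!: s_L2 f)
  also have "\<dots> \<le> (\<integral>x. A / \<sigma> * \<bar>op k x\<bar> \<partial>\<nu>)"
    unfolding L2_inner_def
  proof (rule integral_mono_AE)
    show "AE x in \<nu>. op k x * f x \<le> A / \<sigma> * \<bar>op k x\<bar>"
      using sup
    proof eventually_elim
      case (elim x)
      have "op k x * f x \<le> \<bar>op k x\<bar> * \<bar>f x\<bar>" by (simp flip: abs_mult)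
      also have "\<dots> \<le> A / \<sigma> * \<bar>op k x\<bar>" using mult_left_mono[OF elim, of "\<bar>op k x\<bar>"] by (simp add: mult.commute)
      finally show ?case .
    qed
  qed (intro L2_integrable_mult op_L2 k f integrable_mult_right integrable_abs L2_integrable)+
  also have "\<dots> = A / \<sigma> * (\<integral>x. \<bar>op k x\<bar> \<partial>\<nu>)" by simp
  \<comment> \<open>The mean norm of \<open>op k\<close> is the bilinear form of the kernel at the
    signs of \<open>op k\<close> and \<open>op f\<close>. Two indicators on each side make four
    terms, each at most the cut norm in absolute value.\<close>
  also have "\<dots> \<le> A / \<sigma> * (4 * cut_norm \<nu> D)"
  proof (rule mult_left_mono)
    let ?P = "\<lambda>h. {x \<in> {0..1}. 0 < op h x}" and ?N = "\<lambda>h. {x \<in> {0..1}. op h x < 0}"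
    have km: "k \<in> borel_measurable \<nu>" using k by (rule L2_measurable)
    have fm: "f \<in> borel_measurable \<nu>" by simp
    note S = sets_s[OF km] sets_s[OF fm]
    note I = ind[OF S(1)] ind[OF S(2)] ind[OF S(3)] ind[OF S(4)]
    have "op k x = op (indicator (?P f)) x - op (indicator (?N f)) x" if "x \<in> space \<nu>" for x
      unfolding k_def s_def using op_diff[OF I(3,4) that] by simp
    then have "L2_inner \<nu> (s k) (op k) = L2_inner \<nu> (s k) (\<lambda>x. op (indicator (?P f)) x - op (indicator (?N f)) x)"
      unfolding L2_inner_def by (intro Bochner_Integration.integral_cong) auto
    also have "\<dots> = L2_inner \<nu> (\<lambda>x. indicator (?P k) x - indicator (?N k) x) (op (indicator (?P f)))
        - L2_inner \<nu> (\<lambda>x. indicator (?P k) x - indicator (?N k) x) (op (indicator (?N f)))"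
      using L2_inner_diff_right[OF op_L2[OF I(3)] op_L2[OF I(4)] s_L2[OF km]] by (simp add: s_def[abs_def])
    also have "\<dots> = (L2_inner \<nu> (indicator (?P k)) (op (indicator (?P f))) - L2_inner \<nu> (indicator (?N k)) (op (indicator (?P f))))
        - (L2_inner \<nu> (indicator (?P k)) (op (indicator (?N f))) - L2_inner \<nu> (indicator (?N k)) (op (indicator (?N f))))"
      using L2_inner_diff_left[OF I(1,2) op_L2[OF I(3)]] L2_inner_diff_left[OF I(1,2) op_L2[OF I(4)]] by simp
    also have "\<dots> \<le> 4 * cut_norm \<nu> D"
      using cut_norm_lebesgue_sets[OF S(1,3)] cut_norm_lebesgue_sets[OF S(2,3)]
        cut_norm_lebesgue_sets[OF S(1,4)] cut_norm_lebesgue_sets[OF S(2,4)]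
      unfolding abs_le_iff by linarith
    finally show "(\<integral>x. \<bar>op k x\<bar> \<partial>\<nu>) \<le> 4 * cut_norm \<nu> D" by (simp add: L1)
    show "0 \<le> A / \<sigma>" using A pos by simp
  qed
  finally show ?thesis
    using A pos by (simp add: field_simps power2_eq_square)
qed

end

end

section \<open>Families of square-integrable functions\<close>

text \<open>\<open>\<mu>\<close> will be the product of time and chance. It stays abstract because
  these arguments see a profile as a function of a label and one further point.\<close>

locale labelled = nu: prob_space \<nu> + mu: finite_measure \<mu>
  for \<nu> :: "real measure" and \<mu> :: "'m measure"
begin

sublocale pair_sigma_finite \<nu> \<mu> ..

lemma family_measurable_section:
  assumes "case_prod b \<in> borel_measurable (\<nu> \<Otimes>\<^sub>M \<mu>)"
  shows "x \<in> space \<nu> \<Longrightarrow> b x \<in> borel_measurable \<mu>"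
    and "m \<in> space \<mu> \<Longrightarrow> (\<lambda>y. b y m) \<in> borel_measurable \<nu>"
  using measurable_Pair2[OF assms, of x] measurable_Pair1[OF assms, of m] by simp_all

lemma family_norm_measurable:
  assumes [measurable]: "case_prod b \<in> borel_measurable (\<nu> \<Otimes>\<^sub>M \<mu>)"
  shows "(\<lambda>x. L2_norm \<mu> (b x)) \<in> borel_measurable \<nu>"
  unfolding L2_norm_def by measurable

lemma nn_integral_family:
  assumes [measurable]: "case_prod b \<in> borel_measurable (\<nu> \<Otimes>\<^sub>M \<mu>)"
    and b: "\<And>x. x \<in> space \<nu> \<Longrightarrow> b x \<in> L2 \<mu>"
  shows "(\<integral>\<^sup>+z. ennreal ((case_prod b z)\<^sup>2) \<partial>(\<nu> \<Otimes>\<^sub>M \<mu>)) = (\<integral>\<^sup>+x. ennreal ((L2_norm \<mu> (b x))\<^sup>2) \<partial>\<nu>)"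
proof -
  have "(\<integral>\<^sup>+z. ennreal ((case_prod b z)\<^sup>2) \<partial>(\<nu> \<Otimes>\<^sub>M \<mu>)) = (\<integral>\<^sup>+x. \<integral>\<^sup>+m. ennreal ((b x m)\<^sup>2) \<partial>\<mu> \<partial>\<nu>)"
    by (subst mu.nn_integral_fst[symmetric]) auto
  also have "\<dots> = (\<integral>\<^sup>+x. ennreal ((L2_norm \<mu> (b x))\<^sup>2) \<partial>\<nu>)"
    by (intro nn_integral_cong nn_integral_L2 b)
  finally show ?thesis .
qed

text \<open>By Tonelli, norms of profiles may be computed either labelwise or on the product space;
  the first suits best responses, the second suits operators.\<close>

lemma family_L2_iff:
  assumes "case_prod b \<in> borel_measurable (\<nu> \<Otimes>\<^sub>M \<mu>)" "\<And>x. x \<in> space \<nu> \<Longrightarrow> b x \<in> L2 \<mu>"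
  shows "case_prod b \<in> L2 (\<nu> \<Otimes>\<^sub>M \<mu>) \<longleftrightarrow> (\<lambda>x. L2_norm \<mu> (b x)) \<in> L2 \<nu>"
  using assms nn_integral_family[OF assms] family_norm_measurable[OF assms(1)]
  by (simp add: L2_def integrable_iff_bounded)

lemma family_norm:
  assumes [measurable]: "case_prod b \<in> borel_measurable (\<nu> \<Otimes>\<^sub>M \<mu>)" and b: "\<And>x. x \<in> space \<nu> \<Longrightarrow> b x \<in> L2 \<mu>"
  shows "L2_norm (\<nu> \<Otimes>\<^sub>M \<mu>) (case_prod b) = L2_norm \<nu> (\<lambda>x. L2_norm \<mu> (b x))"
proof -
  have [measurable]: "(\<lambda>x. L2_norm \<mu> (b x)) \<in> borel_measurable \<nu>" by (rule family_norm_measurable) simp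
  show ?thesis
    unfolding L2_norm_def[of "\<nu> \<Otimes>\<^sub>M \<mu>"] L2_norm_def[of \<nu>]
    by (simp add: integral_eq_nn_integral nn_integral_family[OF assms])
qed

lemma family_AE_section:
  assumes b: "case_prod b \<in> L2 (\<nu> \<Otimes>\<^sub>M \<mu>)"
  shows "AE m in \<mu>. (\<lambda>y. b y m) \<in> L2 \<nu>"
proof -
  have "integrable (\<nu> \<Otimes>\<^sub>M \<mu>) (\<lambda>(y, m). (b y m)\<^sup>2)"
    using L2_square_integrable[OF b] by (simp add: split_beta')
  from AE_integrable_snd[OF this] AE_space show ?thesis
    by eventually_elim (use family_measurable_section(2)[OF L2_measurable[OF b]] in \<open>auto simp: L2_def\<close>)
qed

text \<open>This is the dominating function for weighted averages over labels.\<close>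

lemma family_norm_section_L2:
  assumes b: "case_prod b \<in> L2 (\<nu> \<Otimes>\<^sub>M \<mu>)"
  shows "(\<lambda>m. L2_norm \<nu> (\<lambda>y. b y m)) \<in> L2 \<mu>"
proof -
  have *: "integrable (\<nu> \<Otimes>\<^sub>M \<mu>) (\<lambda>(y, m). (b y m)\<^sup>2)"
    using L2_square_integrable[OF b] by (simp add: split_beta')
  from integrable_snd[OF this] show ?thesis
    unfolding L2_def L2_norm_def by (auto intro!: borel_measurable_sqrt borel_measurable_integrable)
qed

text \<open>The average of a square-integrable family lies, up to a null set, in every complete subspace
  containing the family: it is orthogonal to everything orthogonal to the subspace.\<close>

lemma family_average:
  assumes b: "case_prod b \<in> L2 (\<nu> \<Otimes>\<^sub>M \<mu>)"
    and V: "L2_subspace \<mu> V" "L2_complete \<mu> V" "\<And>y. y \<in> space \<nu> \<Longrightarrow> b y \<in> V"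
    and w [measurable]: "w \<in> borel_measurable \<nu>" and w1: "\<And>y. y \<in> space \<nu> \<Longrightarrow> \<bar>w y\<bar> \<le> 1"
  shows "(\<lambda>m. \<integral>y. w y * b y m \<partial>\<nu>) \<in> L2 \<mu>"
    and "\<exists>p\<in>V. AE m in \<mu>. (\<integral>y. w y * b y m \<partial>\<nu>) = p m"
proof -
  define z where "z m = (\<integral>y. w y * b y m \<partial>\<nu>)" for m
  have [measurable]: "case_prod b \<in> borel_measurable (\<nu> \<Otimes>\<^sub>M \<mu>)" using b by (rule L2_measurable)
  have [measurable]: "z \<in> borel_measurable \<mu>" unfolding z_def by measurable
  have wL: "w \<in> L2 \<nu>" and wn: "L2_norm \<nu> w \<le> 1"
  proof -
    have "L2_norm \<nu> (\<lambda>x. 1) = 1" by (simp add: L2_norm_def nu.prob_space)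
    then show "w \<in> L2 \<nu>" "L2_norm \<nu> w \<le> 1"
      using L2_norm_mono[of w \<nu> "\<lambda>x. 1"] w1 by (auto simp: L2_def)
  qed
  have "AE m in \<mu>. \<bar>z m\<bar> \<le> \<bar>L2_norm \<nu> (\<lambda>y. b y m)\<bar>"
    using family_AE_section[OF b]
  proof eventually_elim
    case (elim m)
    then have "\<bar>z m\<bar> \<le> L2_norm \<nu> w * L2_norm \<nu> (\<lambda>y. b y m)"
      using L2_Cauchy_Schwarz[OF wL elim] by (simp add: z_def L2_inner_def)
    also have "\<dots> \<le> 1 * L2_norm \<nu> (\<lambda>y. b y m)" by (intro mult_right_mono wn) simp
    finally show ?case by simp
  qed
  then have zL: "z \<in> L2 \<mu>" by (intro L2_norm_mono(1)[OF _ family_norm_section_L2[OF b]]) auto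
  then show "(\<lambda>m. \<integral>y. w y * b y m \<partial>\<nu>) \<in> L2 \<mu>" by (simp add: z_def[abs_def])
  obtain p where p: "p \<in> V" "\<And>g. g \<in> V \<Longrightarrow> L2_inner \<mu> (\<lambda>m. z m - p m) g = 0"
    using L2_projection[OF V(1,2) zL] by blast
  have pL: "p \<in> L2 \<mu>" using V(1) p(1) by (auto simp: L2_subspace_def)
  \<comment> \<open>The part of the average orthogonal to \<open>V\<close>. Fubini takes the inner
    product with \<open>h\<close> inside the average, where each \<open>b y\<close> contributes
    zero.\<close>
  define h where "h m = z m - p m" for m
  have hL: "h \<in> L2 \<mu>" unfolding h_def by (intro L2_diff zL pL)
  then have [measurable]: "h \<in> borel_measurable \<mu>" by (rule L2_measurable)
  have orth: "L2_inner \<mu> h g = 0" if "g \<in> V" for g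
    using p(2)[OF that] by (simp add: h_def[abs_def])
  have "case_prod (\<lambda>y. h) \<in> L2 (\<nu> \<Otimes>\<^sub>M \<mu>)"
    by (subst family_L2_iff) (use hL in \<open>auto simp: L2_def\<close>)
  then have wh: "(\<lambda>(y, m). w y * h m) \<in> L2 (\<nu> \<Otimes>\<^sub>M \<mu>)"
    by (rule L2_norm_mono(1)[rotated])
      (auto intro!: AE_I2 mult_left_le_one_le w1 simp: abs_mult space_pair_measure)
  have "integrable (\<nu> \<Otimes>\<^sub>M \<mu>) (\<lambda>(y, m). w y * h m * b y m)"
    using L2_integrable_mult[OF wh b] by (simp add: split_beta')
  from Fubini_integral[OF this]
  have "(\<integral>m. (\<integral>y. w y * h m * b y m \<partial>\<nu>) \<partial>\<mu>) = (\<integral>y. (\<integral>m. w y * h m * b y m \<partial>\<mu>) \<partial>\<nu>)" .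
  also have "(\<integral>m. (\<integral>y. w y * h m * b y m \<partial>\<nu>) \<partial>\<mu>) = L2_inner \<mu> h z"
    unfolding L2_inner_def z_def
    by (intro Bochner_Integration.integral_cong refl) (simp add: mult_ac flip: integral_mult_right_zero)
  also have "(\<integral>y. (\<integral>m. w y * h m * b y m \<partial>\<mu>) \<partial>\<nu>) = (\<integral>y. w y * L2_inner \<mu> h (b y) \<partial>\<nu>)"
    by (simp add: L2_inner_def mult.assoc)
  also have "\<dots> = (\<integral>y. 0 \<partial>\<nu>)"
    by (intro Bochner_Integration.integral_cong refl) (simp add: orth V(3))
  finally have "L2_inner \<mu> h z = 0" by simp
  then have "(L2_norm \<mu> h)\<^sup>2 = 0"
    using L2_inner_diff_right[OF zL pL hL] orth[OF p(1)] by (simp add: L2_norm_power2 h_def[abs_def])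
  then have "AE m in \<mu>. h m = 0" by (simp add: L2_norm_eq_0_iff[OF hL])
  then have "AE m in \<mu>. z m = p m" by eventually_elim (simp add: h_def)
  with p(1) show "\<exists>p\<in>V. AE m in \<mu>. (\<integral>y. w y * b y m \<partial>\<nu>) = p m"
    unfolding z_def by blast
qed

text \<open>The operator acts on labels with \<open>m\<close> frozen, so the scalar bound can be
  squared and integrated over \<open>\<mu>\<close>. It is available for almost every
  \<open>m\<close>, where the section is square-integrable.\<close>

lemma family_op_norm:
  assumes K: "sym_kernel \<nu> K" and b: "case_prod b \<in> L2 (\<nu> \<Otimes>\<^sub>M \<mu>)"
  shows "case_prod (\<lambda>x m. graphon_op \<nu> K (\<lambda>y. b y m) x) \<in> L2 (\<nu> \<Otimes>\<^sub>M \<mu>)"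
    and "L2_norm (\<nu> \<Otimes>\<^sub>M \<mu>) (case_prod (\<lambda>x m. graphon_op \<nu> K (\<lambda>y. b y m) x))
      \<le> kernel_norm \<nu> K * L2_norm (\<nu> \<Otimes>\<^sub>M \<mu>) (case_prod b)"
proof -
  interpret K: sym_kernel \<nu> K by fact
  let ?z = "\<lambda>x m. K.op (\<lambda>y. b y m) x"
  have [measurable]: "case_prod b \<in> borel_measurable (\<nu> \<Otimes>\<^sub>M \<mu>)" using b by (rule L2_measurable)
  have [measurable]: "(\<lambda>(x, m). ?z x m) \<in> borel_measurable (\<nu> \<Otimes>\<^sub>M \<mu>)"
    unfolding graphon_op_def split_beta by measurable
  let ?\<sigma> = "kernel_norm \<nu> K"
  have "(\<integral>\<^sup>+u. ennreal ((case_prod ?z u)\<^sup>2) \<partial>(\<nu> \<Otimes>\<^sub>M \<mu>)) = (\<integral>\<^sup>+m. \<integral>\<^sup>+x. ennreal ((?z x m)\<^sup>2) \<partial>\<nu> \<partial>\<mu>)"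
    by (subst nn_integral_snd[symmetric]) (auto simp: split_beta)
  also have "\<dots> \<le> (\<integral>\<^sup>+m. ennreal (?\<sigma>\<^sup>2) * (\<integral>\<^sup>+x. ennreal ((b x m)\<^sup>2) \<partial>\<nu>) \<partial>\<mu>)"
  proof (rule nn_integral_mono_AE)
    show "AE m in \<mu>. (\<integral>\<^sup>+x. ennreal ((?z x m)\<^sup>2) \<partial>\<nu>) \<le> ennreal (?\<sigma>\<^sup>2) * (\<integral>\<^sup>+x. ennreal ((b x m)\<^sup>2) \<partial>\<nu>)"
      using family_AE_section[OF b]
    proof eventually_elim
      case (elim m)
      from power_mono[OF K.op_norm_le_kernel_norm[OF elim] L2_norm_nonneg, of 2]
      show ?case
        by (simp add: nn_integral_L2 elim K.op_L2 power_mult_distrib flip: ennreal_mult')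
    qed
  qed
  also have "\<dots> = ennreal (?\<sigma>\<^sup>2) * (\<integral>\<^sup>+m. \<integral>\<^sup>+x. ennreal ((b x m)\<^sup>2) \<partial>\<nu> \<partial>\<mu>)"
    by (rule nn_integral_cmult) measurable
  also have "(\<integral>\<^sup>+m. \<integral>\<^sup>+x. ennreal ((b x m)\<^sup>2) \<partial>\<nu> \<partial>\<mu>) = (\<integral>\<^sup>+u. ennreal ((case_prod b u)\<^sup>2) \<partial>(\<nu> \<Otimes>\<^sub>M \<mu>))"
    by (subst nn_integral_snd[symmetric]) (auto simp: split_beta)
  also have "ennreal (?\<sigma>\<^sup>2) * \<dots> = ennreal ((?\<sigma> * L2_norm (\<nu> \<Otimes>\<^sub>M \<mu>) (case_prod b))\<^sup>2)"
    by (simp add: nn_integral_L2[OF b] power_mult_distrib ennreal_mult')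
  finally have le: "(\<integral>\<^sup>+u. ennreal ((case_prod ?z u)\<^sup>2) \<partial>(\<nu> \<Otimes>\<^sub>M \<mu>))
      \<le> ennreal ((?\<sigma> * L2_norm (\<nu> \<Otimes>\<^sub>M \<mu>) (case_prod b))\<^sup>2)" .
  show L: "case_prod ?z \<in> L2 (\<nu> \<Otimes>\<^sub>M \<mu>)"
    by (rule L2I_nn_integral) (use le in \<open>auto intro: le_less_trans simp: split_beta'\<close>)
  show "L2_norm (\<nu> \<Otimes>\<^sub>M \<mu>) (case_prod ?z) \<le> ?\<sigma> * L2_norm (\<nu> \<Otimes>\<^sub>M \<mu>) (case_prod b)"
    by (rule power2_le_imp_le) (use le K.kernel_norm_nonneg in \<open>auto simp: nn_integral_L2[OF L]\<close>)
qed

text \<open>Minkowski's inequality for labelwise estimates; \<open>p\<close>, \<open>q\<close> and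
  \<open>r\<close> stand for a change of profile, of kernel and of heterogeneity. Norms are added
  instead of squares, which preserves the constants.\<close>

lemma L2_norm_combine:
  assumes "u \<in> borel_measurable \<nu>" "p \<in> L2 \<nu>" "q \<in> L2 \<nu>" "r \<in> L2 \<nu>"
    and le: "\<And>x. x \<in> space \<nu> \<Longrightarrow> \<alpha> * u x \<le> c * p x + c * q x + d * r x"
    and "\<And>x. 0 \<le> u x" "0 < \<alpha>" "0 \<le> c" "0 \<le> d"
  shows "\<alpha> * L2_norm \<nu> u \<le> c * L2_norm \<nu> p + c * L2_norm \<nu> q + d * L2_norm \<nu> r"
proof -
  have L: "(\<lambda>x. c * p x) \<in> L2 \<nu>" "(\<lambda>x. c * q x) \<in> L2 \<nu>" "(\<lambda>x. d * r x) \<in> L2 \<nu>"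
    by (intro L2_scale assms)+
  have "\<alpha> * L2_norm \<nu> u = L2_norm \<nu> (\<lambda>x. \<alpha> * u x)"
    using \<open>0 < \<alpha>\<close> by (simp add: L2_norm_scale)
  also have "\<dots> \<le> L2_norm \<nu> (\<lambda>x. c * p x + c * q x + d * r x)"
  proof (rule L2_norm_mono(2))
    show "AE x in \<nu>. \<bar>\<alpha> * u x\<bar> \<le> \<bar>c * p x + c * q x + d * r x\<bar>"
    proof (rule AE_I2)
      fix x assume "x \<in> space \<nu>"
      from le[OF this] show "\<bar>\<alpha> * u x\<bar> \<le> \<bar>c * p x + c * q x + d * r x\<bar>"
        using assms(6)[of x] \<open>0 < \<alpha>\<close> by (simp add: abs_mult)
    qed
  qed (use assms(1) in measurable, intro L2_add L)
  also have "\<dots> \<le> L2_norm \<nu> (\<lambda>x. c * p x) + L2_norm \<nu> (\<lambda>x. c * q x) + L2_norm \<nu> (\<lambda>x. d * r x)"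
    using L2_triangle[OF L2_add[OF L(1,2)] L(3)] L2_triangle[OF L(1,2)] by linarith
  also have "\<dots> = c * L2_norm \<nu> p + c * L2_norm \<nu> q + d * L2_norm \<nu> r"
    using assms by (simp add: L2_norm_scale)
  finally show ?thesis .
qed

end

section \<open>Processes and action profiles as square-integrable functions\<close>

text \<open>The generating preimages and the null sets all belong to \<open>P\<close>, so
  measurability for the filtration implies measurability for \<open>P\<close>.\<close>

lemma augmented_filtration_measure:
  assumes X: "\<And>i s. i \<in> I \<Longrightarrow> s \<in> {0..t} \<Longrightarrow> X i s \<in> borel_measurable P"
  shows "space (augmented_filtration P I X t) = space P" "sets (augmented_filtration P I X t) \<subseteq> sets P"
proof -
  let ?G = "(\<Union>i\<in>I. \<Union>s\<in>{0..t}. {X i s -` B \<inter> space P | B. B \<in> sets borel}) \<union> null_sets P"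
  have G: "?G \<subseteq> sets P" using X by (auto intro: measurable_sets null_setsD2)
  then have "?G \<subseteq> Pow (space P)" using sets.space_closed by blast
  then show "space (augmented_filtration P I X t) = space P" "sets (augmented_filtration P I X t) \<subseteq> sets P"
    unfolding augmented_filtration_def using sets.sigma_sets_subset[OF G]
    by (simp_all add: space_measure_of sets_measure_of)
qed

lemma sets_time_measure: "sets (time_measure T) = sets (restrict_space borel {0..T})"
  unfolding time_measure_def by (rule sets_restrict_space_cong) simp

lemma finite_measure_time_measure: "finite_measure (time_measure T)"
  by (rule finite_measureI) (simp add: time_measure_def emeasure_restrict_space space_restrict_space emeasure_lborel_Icc_eq)

locale process_space = prob_space P for P :: "'w measure" +
  fixes T :: real and F :: "real \<Rightarrow> 'w measure"
  assumes T_pos: "0 < T"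
    and filtration_space: "t \<in> {0..T} \<Longrightarrow> space (F t) = space P"
    and filtration_sets: "t \<in> {0..T} \<Longrightarrow> sets (F t) \<subseteq> sets P"
begin

definition \<mu> :: "(real \<times> 'w) measure" where "\<mu> = time_measure T \<Otimes>\<^sub>M P"

sublocale time: finite_measure "time_measure T" by (rule finite_measure_time_measure)
sublocale time_P: pair_sigma_finite "time_measure T" P ..

sublocale mu: finite_measure \<mu>
  unfolding \<mu>_def by (intro finite_measure_pair_measure finite_measure_time_measure) unfold_locales

text \<open>The instance \<open>t = T\<close> of progressive measurability, with \<open>F T\<close>
  enlarged to the sigma-algebra of \<open>P\<close>.\<close>

lemma progressive_measurable:
  assumes "progressively_measurable F T a"
  shows "case_prod a \<in> borel_measurable \<mu>"
proof -
  have T: "T \<in> {0..T}" using T_pos by simp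
  have m: "case_prod a \<in> borel_measurable (restrict_space borel {0..T} \<Otimes>\<^sub>M F T)"
    using assms T by (auto simp: progressively_measurable_def case_prod_unfold)
  have [measurable]: "(\<lambda>x. x) \<in> measurable P (F T)"
  proof (rule measurableI)
    fix A assume A: "A \<in> sets (F T)"
    then have "(\<lambda>x. x) -` A \<inter> space P = A"
      using sets.sets_into_space[OF A] filtration_space[OF T] by auto
    with A show "(\<lambda>x. x) -` A \<inter> space P \<in> sets P" using filtration_sets[OF T] by auto
  qed (simp add: filtration_space[OF T])
  have [measurable]: "(\<lambda>x. x) \<in> measurable (time_measure T) (restrict_space borel {0..T})"
    by (rule measurable_ident_sets) (simp add: sets_time_measure)
  have "(\<lambda>z. (fst z, snd z)) \<in> measurable \<mu> (restrict_space borel {0..T} \<Otimes>\<^sub>M F T)"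
    unfolding \<mu>_def by measurable
  from measurable_compose[OF this m] show ?thesis by simp
qed

lemma sq_norm_A_eq:
  "case_prod a \<in> borel_measurable \<mu> \<Longrightarrow> sq_norm_A P T a = (\<integral>\<^sup>+z. ennreal ((case_prod a z)\<^sup>2) \<partial>\<mu>)"
  unfolding sq_norm_A_def \<mu>_def by (subst nn_integral_fst[symmetric]) auto

text \<open>Measurability suffices: if the square integral is infinite, both sides take the default
  value 0.\<close>

lemma norm_A_eq: "case_prod a \<in> borel_measurable \<mu> \<Longrightarrow> norm_A P T a = L2_norm \<mu> (case_prod a)"
  by (simp add: norm_A_def L2_norm_def sq_norm_A_eq integral_eq_nn_integral)

lemma space_A_iff: "a \<in> space_A P F T \<longleftrightarrow> progressively_measurable F T a \<and> case_prod a \<in> L2 \<mu>"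
  using progressive_measurable[of a]
  by (auto simp: space_A_def sq_norm_A_eq L2_def integrable_iff_bounded)

lemma space_A_L2: "a \<in> space_A P F T \<Longrightarrow> case_prod a \<in> L2 \<mu>"
  by (simp add: space_A_iff)

lemma norm_A_diff_eq:
  "case_prod a \<in> L2 \<mu> \<Longrightarrow> case_prod b \<in> L2 \<mu> \<Longrightarrow>
    norm_A P T (a - b) = L2_norm \<mu> (\<lambda>z. case_prod a z - case_prod b z)"
  using L2_measurable[OF L2_diff[of "case_prod a" \<mu> "case_prod b"]]
  by (subst norm_A_eq) (simp_all add: split_beta')

lemma inner_A_eq:
  assumes "case_prod a \<in> L2 \<mu>" "case_prod b \<in> L2 \<mu>"
  shows "inner_A P T a b = L2_inner \<mu> (case_prod a) (case_prod b)"
proof -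
  have "integrable (time_measure T \<Otimes>\<^sub>M P) (\<lambda>(t, \<omega>). a t \<omega> * b t \<omega>)"
    using L2_integrable_mult[OF assms] by (simp add: \<mu>_def split_beta')
  from time_P.integral_fst'[OF this] show ?thesis
    by (simp add: inner_A_def L2_inner_def \<mu>_def split_beta')
qed

lemma process_eq_iff: "process_eq P T a b \<longleftrightarrow> (AE z in \<mu>. case_prod a z = case_prod b z)"
  unfolding process_eq_def \<mu>_def split_beta' ..

lemma space_A_add_scale:
  assumes "a \<in> space_A P F T" "b \<in> space_A P F T"
  shows "(\<lambda>t \<omega>. a t \<omega> + c * b t \<omega>) \<in> space_A P F T"
  using assms L2_add_scale[of "case_prod a" \<mu> "case_prod b" c]
  by (auto simp: space_A_iff progressively_measurable_def split_beta'
      intro!: borel_measurable_add borel_measurable_times)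

lemma space_A_const: "(\<lambda>t \<omega>. c) \<in> space_A P F T"
  by (simp add: space_A_iff progressively_measurable_def L2_def split_beta')

lemma space_A_subspace: "L2_subspace \<mu> (case_prod ` space_A P F T)"
  unfolding L2_subspace_def
proof (intro conjI ballI allI)
  show "case_prod ` space_A P F T \<subseteq> L2 \<mu>" by (auto simp: space_A_L2)
  show "(\<lambda>x. 0) \<in> case_prod ` space_A P F T"
    by (rule image_eqI[OF _ space_A_const[of 0]]) auto
  fix f g c assume "f \<in> case_prod ` space_A P F T" "g \<in> case_prod ` space_A P F T"
  then show "(\<lambda>x. f x + c * g x) \<in> case_prod ` space_A P F T"
    by (auto intro!: image_eqI[OF _ space_A_add_scale])
qed

text \<open>A limit in \<open>L2 \<mu>\<close> is determined only up to null sets, but progressive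
  measurability needs one representative that is measurable at all times at once. The pointwise
  \<open>lim\<close> of a subsequence is such a one; it is measurable regardless of where the
  sequence diverges.\<close>

lemma space_A_complete: "L2_complete \<mu> (case_prod ` space_A P F T)"
  unfolding L2_complete_def
proof (intro allI impI, elim conjE)
  fix s assume s: "\<forall>n. s n \<in> case_prod ` space_A P F T" and C: "L2_Cauchy \<mu> s"
  then have "\<forall>n. \<exists>a. a \<in> space_A P F T \<and> s n = case_prod a" by auto
  then obtain a where a: "\<And>n. a n \<in> space_A P F T" "\<And>n. s n = case_prod (a n)" by metis
  have sL: "\<And>n. s n \<in> L2 \<mu>" using a by (simp add: space_A_L2)
  obtain r where r: "(\<lambda>x. lim (\<lambda>n. s (r n) x)) \<in> L2 \<mu>"
    "(\<lambda>n. L2_norm \<mu> (\<lambda>x. s n x - lim (\<lambda>n. s (r n) x))) \<longlonglongrightarrow> 0"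
    using mu.L2_Cauchy_subseq[OF sL C] by blast
  define g where "g t \<omega> = lim (\<lambda>n. a (r n) t \<omega>)" for t \<omega>
  have g: "lim (\<lambda>n. s (r n) x) = case_prod g x" for x
    by (simp add: g_def a split_beta')
  have "progressively_measurable F T g"
    unfolding progressively_measurable_def g_def split_beta'
  proof (intro ballI borel_measurable_lim_metric)
    fix t n assume "t \<in> {0..T}"
    then show "(\<lambda>x. a (r n) (fst x) (snd x)) \<in> borel_measurable (restrict_space borel {0..t} \<Otimes>\<^sub>M F t)"
      using a(1)[of "r n"] by (auto simp: space_A_iff progressively_measurable_def split_beta')
  qed
  then have "g \<in> space_A P F T" using r(1) by (simp add: space_A_iff g)
  then show "\<exists>g\<in>case_prod ` space_A P F T. (\<lambda>n. L2_norm \<mu> (\<lambda>x. s n x - g x)) \<longlonglongrightarrow> 0"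
    using r(2) unfolding g by blast
qed

end

locale profile_space = process_space P T F
  for P :: "'w measure" and T :: real and F :: "real \<Rightarrow> 'w measure" +
  fixes \<nu> :: "real measure"
  assumes ext: "extends_lebesgue_space \<nu>"
begin

sublocale labelled \<nu> \<mu>
  unfolding labelled_def using extends_lebesgue_prob[OF ext] mu.finite_measure_axioms by simp

lemma space_label: "space \<nu> = {0..1}"
  by (rule extends_lebesgue_space_eq[OF ext])

definition joint :: "'w profile \<Rightarrow> real \<times> real \<times> 'w \<Rightarrow> real" where
  "joint a = case_prod (\<lambda>x. case_prod (a x))"

lemma joint_simp [simp]: "joint a (x, t, \<omega>) = a x t \<omega>"
  by (simp add: joint_def)

lemma joint_measurable_iff:
  "joint a \<in> borel_measurable (\<nu> \<Otimes>\<^sub>M \<mu>) \<longleftrightarrow>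
   (\<lambda>(x, t, \<omega>). a x t \<omega>) \<in> borel_measurable (\<nu> \<Otimes>\<^sub>M (restrict_space borel {0..T} \<Otimes>\<^sub>M P))"
  unfolding \<mu>_def joint_def
  by (intro arg_cong2[of _ _ _ _ "(\<in>)"] refl measurable_cong_sets sets_pair_measure_cong sets_time_measure)

lemma norm_Ainf_eq:
  assumes a: "joint a \<in> borel_measurable (\<nu> \<Otimes>\<^sub>M \<mu>)"
  shows "sq_norm_Ainf \<nu> P T a = (\<integral>\<^sup>+z. ennreal ((joint a z)\<^sup>2) \<partial>(\<nu> \<Otimes>\<^sub>M \<mu>))"
    and "norm_Ainf \<nu> P T a = L2_norm (\<nu> \<Otimes>\<^sub>M \<mu>) (joint a)"
proof -
  note [measurable] = a
  have "sq_norm_Ainf \<nu> P T a = (\<integral>\<^sup>+x. \<integral>\<^sup>+z. ennreal ((joint a (x, z))\<^sup>2) \<partial>\<mu> \<partial>\<nu>)"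
    unfolding sq_norm_Ainf_def
    by (intro nn_integral_cong, subst sq_norm_A_eq)
      (use family_measurable_section(1)[OF a[unfolded joint_def]] in \<open>auto simp: joint_def\<close>)
  also have "\<dots> = (\<integral>\<^sup>+z. ennreal ((joint a z)\<^sup>2) \<partial>(\<nu> \<Otimes>\<^sub>M \<mu>))"
    by (rule mu.nn_integral_fst) measurable
  finally show sq: "sq_norm_Ainf \<nu> P T a = (\<integral>\<^sup>+z. ennreal ((joint a z)\<^sup>2) \<partial>(\<nu> \<Otimes>\<^sub>M \<mu>))" .
  show "norm_Ainf \<nu> P T a = L2_norm (\<nu> \<Otimes>\<^sub>M \<mu>) (joint a)"
    by (simp add: norm_Ainf_def L2_norm_def sq integral_eq_nn_integral)
qed

lemma space_Ainf_iff:
  "a \<in> space_Ainf \<nu> P F T \<longleftrightarrow> (\<forall>x\<in>{0..1}. a x \<in> space_A P F T) \<and> joint a \<in> L2 (\<nu> \<Otimes>\<^sub>M \<mu>)"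
  unfolding space_Ainf_def joint_measurable_iff[symmetric] mem_Collect_eq
  by (auto simp: norm_Ainf_eq L2_def integrable_iff_bounded)

lemma joint_diff: "joint (a - b) = (\<lambda>z. joint a z - joint b z)"
  by (auto simp: joint_def)

text \<open>The aggregate is integrated pointwise over labels, so progressive measurability cannot
  be read off. \<open>family_average\<close>, with the section \<open>K x\<close> as weight and the
  progressive processes as subspace, supplies a version, and does so at every label, as the
  equilibrium condition requires.\<close>

lemma op_profile_section:
  assumes K: "sym_kernel \<nu> K" and a: "a \<in> space_Ainf \<nu> P F T" and x: "x \<in> {0..1}"
  shows "case_prod (graphon_op_profile \<nu> K a x) \<in> L2 \<mu>"
    and "\<exists>z\<in>space_A P F T. process_eq P T (graphon_op_profile \<nu> K a x) z"
proof -
  interpret K: sym_kernel \<nu> K by fact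
  have eq: "case_prod (graphon_op_profile \<nu> K a x) = (\<lambda>m. \<integral>y. K x y * case_prod (a y) m \<partial>\<nu>)"
    by (auto simp: graphon_op_profile_def graphon_op_def)
  have j: "case_prod (\<lambda>x. case_prod (a x)) \<in> L2 (\<nu> \<Otimes>\<^sub>M \<mu>)"
    and aV: "\<And>y. y \<in> space \<nu> \<Longrightarrow> case_prod (a y) \<in> case_prod ` space_A P F T"
    using a by (auto simp: space_Ainf_iff joint_def space_label)
  have w: "K x \<in> borel_measurable \<nu>" "\<And>y. y \<in> space \<nu> \<Longrightarrow> \<bar>K x y\<bar> \<le> 1"
    using K.kernel_section(1)[of x] K.kernel_bound x by (auto simp: space_label L2_measurable)
  note av = family_average[OF j space_A_subspace space_A_complete aV w]
  show "case_prod (graphon_op_profile \<nu> K a x) \<in> L2 \<mu>" unfolding eq by (rule av(1))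
  show "\<exists>z\<in>space_A P F T. process_eq P T (graphon_op_profile \<nu> K a x) z"
    using av(2) unfolding process_eq_iff eq by auto
qed

lemma op_profile_norm:
  assumes K: "sym_kernel \<nu> K" and a: "joint a \<in> L2 (\<nu> \<Otimes>\<^sub>M \<mu>)"
  shows "joint (graphon_op_profile \<nu> K a) \<in> L2 (\<nu> \<Otimes>\<^sub>M \<mu>)"
    and "L2_norm (\<nu> \<Otimes>\<^sub>M \<mu>) (joint (graphon_op_profile \<nu> K a))
      \<le> kernel_norm \<nu> K * L2_norm (\<nu> \<Otimes>\<^sub>M \<mu>) (joint a)"
proof -
  have eq: "joint (graphon_op_profile \<nu> K a) = case_prod (\<lambda>x m. graphon_op \<nu> K (\<lambda>y. case_prod (a y) m) x)"
    by (auto simp: joint_def graphon_op_profile_def)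
  show "joint (graphon_op_profile \<nu> K a) \<in> L2 (\<nu> \<Otimes>\<^sub>M \<mu>)"
    "L2_norm (\<nu> \<Otimes>\<^sub>M \<mu>) (joint (graphon_op_profile \<nu> K a))
      \<le> kernel_norm \<nu> K * L2_norm (\<nu> \<Otimes>\<^sub>M \<mu>) (joint a)"
    unfolding eq using family_op_norm[OF K a[unfolded joint_def]] by (simp_all add: joint_def)
qed

end

section \<open>Best responses\<close>

locale game = process_space P T F
  for P :: "'w measure" and T :: real and F :: "real \<Rightarrow> 'w measure" +
  fixes U :: "'w utility" and grad :: "'w process \<Rightarrow> 'w process \<Rightarrow> 'w process \<Rightarrow> 'w process"
    and A0 :: "'w process set" and \<alpha> lU l\<theta> :: real
  assumes alpha_pos: "0 < \<alpha>"
    and well_defined: "well_defined_on_classes P T U"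
    and strongly_concave: "z \<in> space_A P F T \<Longrightarrow> \<theta> \<in> space_A P F T \<Longrightarrow>
      concave_A P F T (\<lambda>a. U a z \<theta> + \<alpha> / 2 * (norm_A P T a)\<^sup>2)"
    and gateaux: "a \<in> space_A P F T \<Longrightarrow> z \<in> space_A P F T \<Longrightarrow> \<theta> \<in> space_A P F T \<Longrightarrow>
      is_gateaux_gradient P F T (\<lambda>b. U b z \<theta>) a (grad a z \<theta>)"
    and grad_lipschitz: "a \<in> space_A P F T \<Longrightarrow> z1 \<in> space_A P F T \<Longrightarrow> z2 \<in> space_A P F T \<Longrightarrow>
      \<theta>1 \<in> space_A P F T \<Longrightarrow> \<theta>2 \<in> space_A P F T \<Longrightarrow>
      norm_A P T (grad a z1 \<theta>1 - grad a z2 \<theta>2) \<le> lU * norm_A P T (z1 - z2) + l\<theta> * norm_A P T (\<theta>1 - \<theta>2)"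
    and A0_nonempty: "A0 \<noteq> {}" and A0_convex: "convex_A A0" and A0_closed: "closed_A P F T A0"
    and A0_subset: "A0 \<subseteq> space_A P F T"
begin

abbreviation "A \<equiv> space_A P F T"

definition dist_A :: "'w process \<Rightarrow> 'w process \<Rightarrow> real" where
  "dist_A a b = L2_norm \<mu> (\<lambda>x. case_prod a x - case_prod b x)"

lemma dist_A_nonneg [simp]: "0 \<le> dist_A a b"
  by (simp add: dist_A_def)

lemma dist_A_self [simp]: "dist_A a a = 0"
  by (simp add: dist_A_def)

lemma dist_A_norm: "a \<in> A \<Longrightarrow> b \<in> A \<Longrightarrow> norm_A P T (a - b) = dist_A a b"
  by (simp add: norm_A_diff_eq space_A_L2 dist_A_def)

lemma A0_A: "a \<in> A0 \<Longrightarrow> a \<in> A"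
  using A0_subset by blast

lemma grad_A: "a \<in> A \<Longrightarrow> z \<in> A \<Longrightarrow> \<theta> \<in> A \<Longrightarrow> grad a z \<theta> \<in> A"
  using gateaux unfolding is_gateaux_gradient_def by blast

text \<open>The signs are forced by the Lipschitz condition itself: the constant processes 0 and 1
  have distance \<open>sqrt T\<close>, which is positive, and a norm is at least 0.\<close>

lemma lipschitz_constants_nonneg: "0 \<le> lU" "0 \<le> l\<theta>"
proof -
  let ?c = "\<lambda>c::real. (\<lambda>(t::real) (\<omega>::'w). c)"
  have "emeasure (time_measure T) (space (time_measure T)) = ennreal T"
    using T_pos by (simp add: time_measure_def emeasure_restrict_space space_restrict_space)
  then have "emeasure \<mu> (space \<mu>) = ennreal T"
    unfolding \<mu>_def space_pair_measure
    by (subst emeasure_pair_measure_Times) (auto simp: emeasure_space_1)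
  then have "measure \<mu> (space \<mu>) = T"
    using T_pos by (simp add: measure_def)
  then have one: "norm_A P T (?c 1 - ?c 0) = sqrt T"
    by (subst dist_A_norm) (simp_all add: space_A_const dist_A_def L2_norm_def split_beta')
  have zero: "norm_A P T (?c 0 - ?c 0) = 0"
    by (subst dist_A_norm) (simp_all add: space_A_const)
  have nn: "0 \<le> norm_A P T a" for a by (simp add: norm_A_def)
  have "0 \<le> lU * sqrt T + l\<theta> * 0"
    using order_trans[OF nn grad_lipschitz[of "?c 0" "?c 1" "?c 0" "?c 0" "?c 0"]]
    unfolding one zero by (simp add: space_A_const)
  then show "0 \<le> lU" using T_pos by (simp add: zero_le_mult_iff)
  have "0 \<le> lU * 0 + l\<theta> * sqrt T"
    using order_trans[OF nn grad_lipschitz[of "?c 0" "?c 0" "?c 0" "?c 1" "?c 0"]]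
    unfolding one zero by (simp add: space_A_const)
  then show "0 \<le> l\<theta>" using T_pos by (simp add: zero_le_mult_iff)
qed

lemma segment_eq:
  "(\<lambda>t \<omega>. e * b t \<omega> + (1 - e) * a t \<omega>) = (\<lambda>t \<omega>. a t \<omega> + e * (b t \<omega> - a t \<omega>) :: real)"
  by (auto simp: algebra_simps)

lemma diff_A: "a \<in> A \<Longrightarrow> b \<in> A \<Longrightarrow> (\<lambda>t \<omega>. b t \<omega> - a t \<omega>) \<in> A"
  using space_A_add_scale[of b a "-1"] by simp

text \<open>The limit is one-sided because convex combinations of \<open>a\<close> and
  \<open>b\<close> are available as comparison points only for nonnegative \<open>e\<close>.\<close>

lemma gateaux_right_limit:
  assumes "a \<in> A" "b \<in> A" "z \<in> A" "\<theta> \<in> A"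
  shows "((\<lambda>e. (U (\<lambda>t \<omega>. e * b t \<omega> + (1 - e) * a t \<omega>) z \<theta> - U a z \<theta>) / e)
    \<longlongrightarrow> L2_inner \<mu> (case_prod (grad a z \<theta>)) (\<lambda>x. case_prod b x - case_prod a x)) (at_right 0)"
proof -
  have "((\<lambda>e. (U (\<lambda>t \<omega>. e * b t \<omega> + (1 - e) * a t \<omega>) z \<theta> - U a z \<theta>) / e)
      \<longlongrightarrow> inner_A P T (grad a z \<theta>) (\<lambda>t \<omega>. b t \<omega> - a t \<omega>)) (at 0)"
    unfolding segment_eq using gateaux[of a z \<theta>] diff_A[of a b] assms by (simp add: is_gateaux_gradient_def)
  then have "((\<lambda>e. (U (\<lambda>t \<omega>. e * b t \<omega> + (1 - e) * a t \<omega>) z \<theta> - U a z \<theta>) / e)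
      \<longlongrightarrow> inner_A P T (grad a z \<theta>) (\<lambda>t \<omega>. b t \<omega> - a t \<omega>)) (at_right 0)"
    by (rule tendsto_mono[OF at_le, rotated]) simp
  moreover have "inner_A P T (grad a z \<theta>) (\<lambda>t \<omega>. b t \<omega> - a t \<omega>)
      = L2_inner \<mu> (case_prod (grad a z \<theta>)) (\<lambda>x. case_prod b x - case_prod a x)"
    using inner_A_eq[OF space_A_L2[OF grad_A[OF assms(1,3,4)]] space_A_L2[OF diff_A[OF assms(1,2)]]]
    by (simp add: split_beta')
  ultimately show ?thesis by simp
qed

text \<open>The convex combination identity converts the quadratic terms in the concavity assumption
  into the surplus.\<close>

lemma strong_concavity_segment:
  assumes "a \<in> A" "b \<in> A" "z \<in> A" "\<theta> \<in> A" "0 \<le> u" "u \<le> 1"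
  shows "u * U b z \<theta> + (1 - u) * U a z \<theta> + \<alpha> / 2 * (u * (1 - u) * (dist_A b a)\<^sup>2)
    \<le> U (\<lambda>t \<omega>. u * b t \<omega> + (1 - u) * a t \<omega>) z \<theta>"
proof -
  let ?s = "\<lambda>t \<omega>. u * b t \<omega> + (1 - u) * a t \<omega>"
  have s: "?s \<in> A" unfolding segment_eq using assms by (intro space_A_add_scale diff_A)
  have eq: "case_prod ?s = (\<lambda>x. u * case_prod b x + (1 - u) * case_prod a x)"
    by auto
  have n: "(norm_A P T ?s)\<^sup>2 = u * (norm_A P T b)\<^sup>2 + (1 - u) * (norm_A P T a)\<^sup>2 - u * (1 - u) * (dist_A b a)\<^sup>2"
    using L2_norm_convex_combination[of "case_prod b" \<mu> "case_prod a" u] assms s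
    by (simp add: norm_A_eq L2_measurable space_A_L2 dist_A_def) (simp add: eq)
  have "u * (U b z \<theta> + \<alpha> / 2 * (norm_A P T b)\<^sup>2) + (1 - u) * (U a z \<theta> + \<alpha> / 2 * (norm_A P T a)\<^sup>2)
      \<le> U ?s z \<theta> + \<alpha> / 2 * (norm_A P T ?s)\<^sup>2"
    using strongly_concave[of z \<theta>] assms unfolding concave_A_def by simp
  moreover have "u * (x + \<alpha> / 2 * p) + (1 - u) * (y + \<alpha> / 2 * q) \<le> v + \<alpha> / 2 * (u * p + (1 - u) * q - r) \<Longrightarrow>
      u * x + (1 - u) * y + \<alpha> / 2 * r \<le> v" for x y p q r v :: real
    by (simp add: algebra_simps add_divide_distrib diff_divide_distrib)
  ultimately show ?thesis unfolding n by blast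
qed

text \<open>The segment inequality divided by \<open>e\<close>, as \<open>e\<close> tends to 0 from
  the right. This bound gives boundedness and upper semicontinuity for existence, and the Lipschitz
  estimate for best responses.\<close>

lemma strong_concavity_gradient:
  assumes "a \<in> A" "b \<in> A" "z \<in> A" "\<theta> \<in> A"
  shows "U b z \<theta> \<le> U a z \<theta> + L2_inner \<mu> (case_prod (grad a z \<theta>)) (\<lambda>x. case_prod b x - case_prod a x)
    - \<alpha> / 2 * (dist_A b a)\<^sup>2"
proof -
  have "((\<lambda>e::real. U b z \<theta> - U a z \<theta> + \<alpha> / 2 * ((1 - e) * (dist_A b a)\<^sup>2))
      \<longlongrightarrow> U b z \<theta> - U a z \<theta> + \<alpha> / 2 * ((1 - 0) * (dist_A b a)\<^sup>2)) (at_right 0)"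
    by (intro tendsto_intros)
  moreover have "\<forall>\<^sub>F e in at_right 0. U b z \<theta> - U a z \<theta> + \<alpha> / 2 * ((1 - e) * (dist_A b a)\<^sup>2)
      \<le> (U (\<lambda>t \<omega>. e * b t \<omega> + (1 - e) * a t \<omega>) z \<theta> - U a z \<theta>) / e"
  proof (rule eventually_at_rightI[of 0 1])
    fix e :: real assume "e \<in> {0<..<1}"
    then have e: "0 < e" "e < 1" by auto
    have "(U b z \<theta> - U a z \<theta> + \<alpha> / 2 * ((1 - e) * (dist_A b a)\<^sup>2)) * e
        \<le> U (\<lambda>t \<omega>. e * b t \<omega> + (1 - e) * a t \<omega>) z \<theta> - U a z \<theta>"
      using strong_concavity_segment[OF assms, of e] e by (simp add: algebra_simps)
    then show "U b z \<theta> - U a z \<theta> + \<alpha> / 2 * ((1 - e) * (dist_A b a)\<^sup>2)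
      \<le> (U (\<lambda>t \<omega>. e * b t \<omega> + (1 - e) * a t \<omega>) z \<theta> - U a z \<theta>) / e"
      using e by (simp add: pos_le_divide_eq)
  qed simp
  ultimately have "U b z \<theta> - U a z \<theta> + \<alpha> / 2 * ((1 - 0) * (dist_A b a)\<^sup>2)
      \<le> L2_inner \<mu> (case_prod (grad a z \<theta>)) (\<lambda>x. case_prod b x - case_prod a x)"
    by (intro tendsto_le[OF _ gateaux_right_limit[OF assms]]) auto
  then show ?thesis by simp
qed

section \<open>Existence and Lipschitz dependence of best responses\<close>

definition best_response :: "'w process \<Rightarrow> 'w process \<Rightarrow> 'w process \<Rightarrow> bool" where
  "best_response z \<theta> a \<longleftrightarrow> is_arg_max (\<lambda>b. U b z \<theta>) (\<lambda>b. b \<in> A0) a"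

lemma best_response_iff: "best_response z \<theta> a \<longleftrightarrow> a \<in> A0 \<and> (\<forall>b\<in>A0. U b z \<theta> \<le> U a z \<theta>)"
  by (auto simp: best_response_def is_arg_max_linorder)

text \<open>Difference quotients along segments inside the convex action set are nonpositive at a
  maximiser.\<close>

lemma best_response_first_order:
  assumes a: "best_response z \<theta> a" and b: "b \<in> A0" and zt: "z \<in> A" "\<theta> \<in> A"
  shows "L2_inner \<mu> (case_prod (grad a z \<theta>)) (\<lambda>x. case_prod b x - case_prod a x) \<le> 0"
proof (rule tendsto_upperbound[OF gateaux_right_limit])
  have aA0: "a \<in> A0" using a by (simp add: best_response_iff)
  show "\<forall>\<^sub>F e in at_right 0. (U (\<lambda>t \<omega>. e * b t \<omega> + (1 - e) * a t \<omega>) z \<theta> - U a z \<theta>) / e \<le> 0"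
  proof (rule eventually_at_rightI[of 0 1])
    fix e :: real assume "e \<in> {0<..<1}"
    moreover from this have "(\<lambda>t \<omega>. e * b t \<omega> + (1 - e) * a t \<omega>) \<in> A0"
      using A0_convex b aA0 unfolding convex_A_def by simp
    ultimately show "(U (\<lambda>t \<omega>. e * b t \<omega> + (1 - e) * a t \<omega>) z \<theta> - U a z \<theta>) / e \<le> 0"
      using a by (simp add: best_response_iff divide_le_0_iff)
  qed simp
qed (use assms in \<open>auto simp: best_response_iff A0_A\<close>)

text \<open>Two gradient inequalities with the same data \<open>z1\<close>, \<open>\<theta>1\<close>
  are added, and the gradient at \<open>a1\<close> drops out by optimality. Subtracting the
  optimality of \<open>a2\<close> under its own data leaves two gradients at the same point
  \<open>a2\<close>, whose distance the Lipschitz condition controls.\<close>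

lemma best_response_lipschitz_A:
  assumes a1: "best_response z1 \<theta>1 a1" and a2: "best_response z2 \<theta>2 a2"
    and A: "z1 \<in> A" "z2 \<in> A" "\<theta>1 \<in> A" "\<theta>2 \<in> A"
  shows "\<alpha> * dist_A a1 a2 \<le> lU * dist_A z1 z2 + l\<theta> * dist_A \<theta>1 \<theta>2"
proof -
  have a: "a1 \<in> A0" "a2 \<in> A0" "a1 \<in> A" "a2 \<in> A"
    using a1 a2 by (auto simp: best_response_iff A0_A)
  let ?c = "case_prod :: 'w process \<Rightarrow> _"
  define g1 where "g1 = ?c (grad a2 z1 \<theta>1)"
  define g2 where "g2 = ?c (grad a2 z2 \<theta>2)"
  have L: "g1 \<in> L2 \<mu>" "g2 \<in> L2 \<mu>" "?c a1 \<in> L2 \<mu>" "?c a2 \<in> L2 \<mu>"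
    using a A by (auto simp: g1_def g2_def space_A_L2 grad_A)
  have dL: "(\<lambda>x. ?c a1 x - ?c a2 x) \<in> L2 \<mu>" by (intro L2_diff L)
  have s: "dist_A a2 a1 = dist_A a1 a2"
    unfolding dist_A_def by (rule L2_norm_minus_commute)
  have "\<alpha> * (dist_A a1 a2)\<^sup>2 \<le> L2_inner \<mu> g1 (\<lambda>x. ?c a1 x - ?c a2 x)"
    using strong_concavity_gradient[OF a(3,4) A(1,3)] strong_concavity_gradient[OF a(4,3) A(1,3)]
      best_response_first_order[OF a1 a(2) A(1,3)] unfolding s g1_def by linarith
  also have "\<dots> \<le> L2_inner \<mu> g1 (\<lambda>x. ?c a1 x - ?c a2 x) - L2_inner \<mu> g2 (\<lambda>x. ?c a1 x - ?c a2 x)"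
    using best_response_first_order[OF a2 a(1) A(2,4)] unfolding g2_def by linarith
  also have "\<dots> = L2_inner \<mu> (\<lambda>x. g1 x - g2 x) (\<lambda>x. ?c a1 x - ?c a2 x)"
    by (rule L2_inner_diff_left[symmetric, OF L(1,2) dL])
  also have "\<dots> \<le> L2_norm \<mu> (\<lambda>x. g1 x - g2 x) * dist_A a1 a2"
    using L2_Cauchy_Schwarz[OF L2_diff[OF L(1,2)] dL] unfolding dist_A_def by linarith
  also have "L2_norm \<mu> (\<lambda>x. g1 x - g2 x) = norm_A P T (grad a2 z1 \<theta>1 - grad a2 z2 \<theta>2)"
    unfolding g1_def g2_def using a A by (subst norm_A_diff_eq) (auto simp: space_A_L2 grad_A)
  also have "\<dots> * dist_A a1 a2 \<le> (lU * dist_A z1 z2 + l\<theta> * dist_A \<theta>1 \<theta>2) * dist_A a1 a2"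
    using grad_lipschitz[OF a(4) A] A by (intro mult_right_mono) (auto simp: dist_A_norm)
  finally have *: "\<alpha> * dist_A a1 a2 * dist_A a1 a2 \<le> (lU * dist_A z1 z2 + l\<theta> * dist_A \<theta>1 \<theta>2) * dist_A a1 a2"
    by (simp add: power2_eq_square mult.assoc)
  show ?thesis
  proof (cases "dist_A a1 a2 = 0")
    case True
    then show ?thesis using lipschitz_constants_nonneg by simp
  next
    case False
    then have "dist_A a1 a2 > 0" using dist_A_nonneg[of a1 a2] by linarith
    with * show ?thesis by simp
  qed
qed

text \<open>Aggregates such as \<open>graphon_op_profile\<close> are progressively measurable only up to a null set.\<close>

definition almost_A :: "'w process \<Rightarrow> bool" where
  "almost_A z \<longleftrightarrow> case_prod z \<in> L2 \<mu> \<and> (\<exists>z'\<in>A. process_eq P T z z')"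

lemma utility_cong:
  assumes "process_eq P T a a'" "process_eq P T z z'"
  shows "U a z \<theta> = U a' z' \<theta>"
proof -
  have "process_eq P T \<theta> \<theta>" by (simp add: process_eq_iff)
  with assms well_defined show ?thesis unfolding well_defined_on_classes_def by blast
qed

text \<open>The utility ignores null sets even at arguments that are not progressively measurable,
  so an aggregate may be replaced by a progressive version.\<close>

lemma best_response_cong:
  assumes "process_eq P T z z'"
  shows "best_response z \<theta> a \<longleftrightarrow> best_response z' \<theta> a"
proof -
  have "U b z \<theta> = U b z' \<theta>" for b
    by (rule utility_cong) (simp_all add: assms, simp add: process_eq_iff)
  then show ?thesis by (simp add: best_response_iff)
qed

lemma best_response_lipschitz:
  assumes a1: "best_response z1 \<theta>1 a1" and a2: "best_response z2 \<theta>2 a2"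
    and z: "almost_A z1" "almost_A z2" and th: "\<theta>1 \<in> A" "\<theta>2 \<in> A"
  shows "\<alpha> * dist_A a1 a2 \<le> lU * dist_A z1 z2 + l\<theta> * dist_A \<theta>1 \<theta>2"
proof -
  obtain y1 y2 where y: "y1 \<in> A" "process_eq P T z1 y1" "y2 \<in> A" "process_eq P T z2 y2"
    using z unfolding almost_A_def by blast
  have [measurable]: "case_prod z1 \<in> borel_measurable \<mu>" "case_prod z2 \<in> borel_measurable \<mu>"
    "case_prod y1 \<in> borel_measurable \<mu>" "case_prod y2 \<in> borel_measurable \<mu>"
    using z y space_A_L2 unfolding almost_A_def by (auto intro: L2_measurable)
  have "dist_A z1 z2 = dist_A y1 y2"
    unfolding dist_A_def
  proof (rule L2_norm_cong_AE)
    show "AE x in \<mu>. case_prod z1 x - case_prod z2 x = case_prod y1 x - case_prod y2 x"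
      using y(2)[unfolded process_eq_iff] y(4)[unfolded process_eq_iff] by eventually_elim simp
  qed measurable
  with best_response_lipschitz_A[OF _ _ y(1,3) th, of a1 a2] a1 a2
  show ?thesis by (simp add: best_response_cong[OF y(2)] best_response_cong[OF y(4)])
qed

lemma A0_complete: "L2_complete \<mu> (case_prod ` A0)"
  unfolding L2_complete_def
proof (intro allI impI, elim conjE)
  fix s assume s: "\<forall>n. s n \<in> case_prod ` A0" and C: "L2_Cauchy \<mu> s"
  then have "\<forall>n. \<exists>a. a \<in> A0 \<and> s n = case_prod a" by auto
  then obtain a where a: "\<And>n. a n \<in> A0" "\<And>n. s n = case_prod (a n)" by metis
  have "\<forall>n. s n \<in> case_prod ` A" using a A0_A by auto
  then obtain g where g: "g \<in> A" and lim: "(\<lambda>n. L2_norm \<mu> (\<lambda>x. s n x - case_prod g x)) \<longlonglongrightarrow> 0"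
    using space_A_complete C unfolding L2_complete_def by blast
  have "(\<lambda>n. norm_A P T (a n - g)) \<longlonglongrightarrow> 0"
    using lim a g A0_A by (simp add: norm_A_diff_eq space_A_L2)
  then have "g \<in> A0" using A0_closed a(1) g unfolding closed_A_def by blast
  then show "\<exists>g\<in>case_prod ` A0. (\<lambda>n. L2_norm \<mu> (\<lambda>x. s n x - g x)) \<longlonglongrightarrow> 0"
    using lim by blast
qed

lemma best_response_exists:
  assumes zt: "z \<in> A" "\<theta> \<in> A"
  shows "\<exists>a. best_response z \<theta> a"
proof -
  let ?c = "case_prod :: 'w process \<Rightarrow> _"
  \<comment> \<open>The maximiser lemma speaks of functions on pairs, hence the passage through
    \<open>curry\<close>.\<close>
  define J where "J f = U (curry f) z \<theta>" for f
  have Jc: "J (?c a) = U a z \<theta>" for a by (simp add: J_def)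
  have mid_eq: "(\<lambda>x. 1/2 * ?c a x + (1 - 1/2) * ?c b x) = ?c (\<lambda>t \<omega>. 1/2 * a t \<omega> + (1 - 1/2) * b t \<omega>)" for a b
    by auto
  have "\<exists>a\<in>?c ` A0. \<forall>b\<in>?c ` A0. J b \<le> J a"
  \<comment> \<open>The surplus at midpoints is \<open>\<alpha> / 2\<close> times
    \<open>1/2 * (1 - 1/2)\<close>.\<close>
  proof (rule L2_maximiser_exists[where c = "\<alpha> / 8"])
    show "?c ` A0 \<noteq> {}" using A0_nonempty by simp
    show "?c ` A0 \<subseteq> L2 \<mu>" using A0_A space_A_L2 by auto
    show "L2_complete \<mu> (?c ` A0)" by (rule A0_complete)
    show "(\<lambda>x. 1/2 * f x + (1 - 1/2) * g x) \<in> ?c ` A0" if fg: "f \<in> ?c ` A0" "g \<in> ?c ` A0" for f g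
    proof -
      obtain a b where ab: "a \<in> A0" "b \<in> A0" "f = ?c a" "g = ?c b" using fg by blast
      have "\<forall>u\<in>{0..1}. (\<lambda>t \<omega>. u * a t \<omega> + (1 - u) * b t \<omega>) \<in> A0"
        using A0_convex ab(1,2) unfolding convex_A_def by blast
      from bspec[OF this, of "1/2"] show ?thesis unfolding ab mid_eq by auto
    qed
    show "(J f + J g) / 2 + \<alpha> / 8 * (L2_norm \<mu> (\<lambda>x. f x - g x))\<^sup>2 \<le> J (\<lambda>x. 1/2 * f x + (1 - 1/2) * g x)"
      if fg: "f \<in> ?c ` A0" "g \<in> ?c ` A0" for f g
    proof -
      obtain a b where ab: "a \<in> A0" "b \<in> A0" "f = ?c a" "g = ?c b" using fg by blast
      show ?thesis
        unfolding ab mid_eq Jc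
        using strong_concavity_segment[OF A0_A[OF ab(2)] A0_A[OF ab(1)] zt, of "1/2"]
        by (simp add: dist_A_def field_simps)
    qed
    show "0 < \<alpha> / 8" using alpha_pos by simp
    obtain a0 where a0: "a0 \<in> A0" using A0_nonempty by blast
    define G where "G = L2_norm \<mu> (?c (grad a0 z \<theta>))"
    show "bdd_above (J ` ?c ` A0)"
    proof (rule bdd_aboveI)
      fix y assume "y \<in> J ` ?c ` A0"
      then obtain b where b: "b \<in> A0" "y = U b z \<theta>" by (auto simp: Jc)
      have "L2_inner \<mu> (?c (grad a0 z \<theta>)) (\<lambda>x. ?c b x - ?c a0 x) \<le> G * dist_A b a0"
        unfolding G_def dist_A_def using A0_A[OF a0] A0_A[OF b(1)] zt
        by (intro order_trans[OF abs_ge_self L2_Cauchy_Schwarz] L2_diff space_A_L2 grad_A)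
      \<comment> \<open>Completing the square: the quadratic loss outweighs the linear gain.\<close>
      moreover have "G * dist_A b a0 - \<alpha> / 2 * (dist_A b a0)\<^sup>2 \<le> G\<^sup>2 / (2 * \<alpha>)"
        using alpha_pos zero_le_power2[of "G - \<alpha> * dist_A b a0"]
        by (simp add: field_simps power2_eq_square)
      ultimately show "y \<le> U a0 z \<theta> + G\<^sup>2 / (2 * \<alpha>)"
        using strong_concavity_gradient[OF A0_A[OF a0] A0_A[OF b(1)] zt] unfolding b(2) by linarith
    qed
    show "l \<le> J f" if s: "\<And>n. s n \<in> ?c ` A0" and f: "f \<in> ?c ` A0"
      and lim: "(\<lambda>n. L2_norm \<mu> (\<lambda>x. s n x - f x)) \<longlonglongrightarrow> 0" and l: "(\<lambda>n. J (s n)) \<longlonglongrightarrow> l" for s f l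
    proof -
      obtain a where a: "a \<in> A0" "f = ?c a" using f by blast
      define N where "N = L2_norm \<mu> (?c (grad a z \<theta>))"
      \<comment> \<open>The gradient inequality at the limit point, without its quadratic term,
        bounds \<open>J\<close> from above by a quantity tending to \<open>J f\<close>.\<close>
      have "J (s n) \<le> J f + N * L2_norm \<mu> (\<lambda>x. s n x - f x)" for n
      proof -
        obtain b where b: "b \<in> A0" "s n = ?c b" using s[of n] by blast
        have "L2_inner \<mu> (?c (grad a z \<theta>)) (\<lambda>x. ?c b x - ?c a x) \<le> N * dist_A b a"
          unfolding N_def dist_A_def using A0_A[OF a(1)] A0_A[OF b(1)] zt
          by (intro order_trans[OF abs_ge_self L2_Cauchy_Schwarz] L2_diff space_A_L2 grad_A)
        moreover have "0 \<le> \<alpha> / 2 * (dist_A b a)\<^sup>2" using alpha_pos by simp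
        ultimately show ?thesis
          using strong_concavity_gradient[OF A0_A[OF a(1)] A0_A[OF b(1)] zt]
          unfolding a(2) b(2) Jc dist_A_def[symmetric] by linarith
      qed
      moreover have "(\<lambda>n. J f + N * L2_norm \<mu> (\<lambda>x. s n x - f x)) \<longlonglongrightarrow> J f + N * 0"
        by (intro tendsto_intros lim)
      ultimately show ?thesis by (intro LIMSEQ_le[OF l]) auto
    qed
  qed
  then show ?thesis by (auto simp: Jc best_response_iff)
qed

end

section \<open>Step functions\<close>

lemma cell_subset: "i \<in> {1..N} \<Longrightarrow> cell N i \<subseteq> {0..1}"
proof -
  assume i: "i \<in> {1..N}"
  then have b: "0 \<le> (real i - 1) / real N" "real i / real N \<le> 1" "0 \<le> (real N - 1) / real N" by auto
  show ?thesis
  proof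
    fix x assume x: "x \<in> cell N i"
    show "x \<in> {0..1}"
    proof (cases "i < N")
      case True
      then have "(real i - 1) / real N \<le> x" "x < real i / real N" using x by (auto simp: cell_def)
      with b show ?thesis unfolding atLeastAtMost_iff by linarith
    next
      case False
      then have "(real N - 1) / real N \<le> x" "x \<le> 1" using x by (auto simp: cell_def)
      with b show ?thesis unfolding atLeastAtMost_iff by linarith
    qed
  qed
qed

lemma cell_borel [measurable]: "cell N i \<in> sets borel"
  by (simp add: cell_def)

lemma cell_unique:
  assumes "i \<in> {1..N}" "j \<in> {1..N}" "x \<in> cell N i" "x \<in> cell N j"
  shows "i = j"
proof -
  have False if "i < j" "i \<in> {1..N}" "j \<in> {1..N}" "x \<in> cell N i" "x \<in> cell N j" for i j
  proof -
    have "x < real i / real N" using that by (auto simp: cell_def)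
    also have "\<dots> \<le> (real j - 1) / real N" using that by (intro divide_right_mono) auto
    also have "\<dots> \<le> x" using that by (auto simp: cell_def split: if_splits)
    finally show False by simp
  qed
  then show ?thesis using assms by (metis linorder_neqE_nat)
qed

lemma cell_exists:
  assumes N: "1 \<le> N" and x: "x \<in> {0..1}"
  shows "\<exists>i\<in>{1..N}. x \<in> cell N i"
proof (cases "x < (real N - 1) / real N")
  case True
  \<comment> \<open>Cells are numbered from one, so a label with this floor value lies in cell
    \<open>Suc k\<close>; the closed last cell is treated separately.\<close>
  define k where "k = nat \<lfloor>real N * x\<rfloor>"
  have k: "real k \<le> real N * x" "real N * x < real k + 1"
    using x by (auto simp: k_def of_nat_nat)
  have "real N * x < real N - 1" using True N by (simp add: field_simps)
  with k have "Suc k < N" by linarith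
  moreover have "x \<in> cell N (Suc k)"
    using k N \<open>Suc k < N\<close> by (simp add: cell_def field_simps)
  ultimately show ?thesis by (intro bexI[of _ "Suc k"]) auto
next
  case False
  then show ?thesis using N x by (intro bexI[of _ N]) (auto simp: cell_def)
qed

lemma cell_index_eq: "i \<in> {1..N} \<Longrightarrow> x \<in> cell N i \<Longrightarrow> cell_index N x = i"
  unfolding cell_index_def by (rule the_equality) (blast intro: cell_unique)+

lemma cell_index_mem:
  assumes "1 \<le> N" "x \<in> {0..1}"
  shows "cell_index N x \<in> {1..N}" "x \<in> cell N (cell_index N x)"
  using cell_exists[OF assms] cell_index_eq by (metis, metis)

text \<open>Every cell contains a label, namely its left end, so passing between players and labels
  loses nothing.\<close>

lemma cell_index_ball:
  assumes N: "1 \<le> N"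
  shows "(\<forall>x\<in>{0..1}. Q (cell_index N x)) \<longleftrightarrow> (\<forall>i\<in>{1..N}. Q i)"
proof (intro iffI ballI)
  fix i assume Q: "\<forall>x\<in>{0..1}. Q (cell_index N x)" and i: "i \<in> {1..N}"
  then have x: "(real i - 1) / real N \<in> cell N i" by (auto simp: cell_def divide_right_mono divide_strict_right_mono)
  with Q show "Q i" using cell_subset[OF i] cell_index_eq[OF i x] by fastforce
qed (use cell_index_mem[OF N] in blast)

text \<open>As finite sums over indicators, step functions inherit measurability and integrals from
  the cells.\<close>

lemma step_sum:
  fixes h :: "nat \<Rightarrow> real"
  assumes "1 \<le> N" "x \<in> {0..1}"
  shows "h (cell_index N x) = (\<Sum>i=1..N. h i * indicator (cell N i) x)"
proof -
  have "x \<in> cell N i \<longleftrightarrow> i = cell_index N x" if "i \<in> {1..N}" for i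
    using cell_index_eq[OF that] cell_index_mem(2)[OF assms] by blast
  then have "indicator (cell N i) x = (if i = cell_index N x then 1 else 0 :: real)" if "i \<in> {1..N}" for i
    using that by (simp add: indicator_def)
  then have "(\<Sum>i=1..N. h i * indicator (cell N i) x) = (\<Sum>i=1..N. if i = cell_index N x then h i else 0)"
    by (intro sum.cong) simp_all
  then show ?thesis using cell_index_mem(1)[OF assms] by (simp add: sum.delta)
qed

lemma cell_lebesgue: "i \<in> {1..N} \<Longrightarrow> cell N i \<in> sets (lebesgue_on {0..1})"
  using cell_subset by (auto simp: sets_restrict_space_iff)

lemma cell_measure:
  assumes "extends_lebesgue_space \<nu>" "i \<in> {1..N}"
  shows "measure \<nu> (cell N i) = 1 / real N"
proof -
  have "emeasure \<nu> (cell N i) = emeasure lborel (cell N i)"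
    using extends_lebesgue_emeasure[OF assms(1) cell_lebesgue[OF assms(2)]] cell_subset[OF assms(2)]
    by (simp add: emeasure_restrict_space)
  also have "\<dots> = ennreal (1 / real N)"
  proof (cases "i < N")
    case True
    have "(real i - 1) / real N \<le> real i / real N" by (intro divide_right_mono) auto
    then show ?thesis using True by (simp add: cell_def flip: diff_divide_distrib)
  next
    case False
    then have "1 \<le> N" using assms(2) by auto
    then have "(real N - 1) / real N \<le> 1" "1 - (real N - 1) / real N = 1 / real N" by (auto simp: field_simps)
    then show ?thesis using False by (simp add: cell_def)
  qed
  finally show ?thesis by (simp add: measure_def)
qed

text \<open>All cells have mass \<open>1 / N\<close>, as \<nu> agrees with Lebesgue measure on them;
  the label integral thus reproduces the normalisation of the network aggregate.\<close>

lemma integral_step: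
  fixes h :: "nat \<Rightarrow> real"
  assumes \<nu>: "extends_lebesgue_space \<nu>" and N: "1 \<le> N"
  shows "(\<integral>x. h (cell_index N x) \<partial>\<nu>) = 1 / real N * (\<Sum>i=1..N. h i)"
proof -
  interpret prob_space \<nu> by (rule extends_lebesgue_prob[OF \<nu>])
  have c: "cell N i \<in> sets \<nu>" if "i \<in> {1..N}" for i
    by (rule extends_lebesgue_sets[OF \<nu> cell_lebesgue[OF that]])
  have "(\<integral>x. h (cell_index N x) \<partial>\<nu>) = (\<integral>x. (\<Sum>i=1..N. h i * indicator (cell N i) x) \<partial>\<nu>)"
    by (intro Bochner_Integration.integral_cong refl step_sum N) (simp add: extends_lebesgue_space_eq[OF \<nu>])
  also have "\<dots> = (\<Sum>i=1..N. h i * measure \<nu> (cell N i))"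
    using c by (subst Bochner_Integration.integral_sum) (auto simp: less_top[symmetric])
  also have "\<dots> = (\<Sum>i=1..N. h i * (1 / real N))"
    by (intro sum.cong refl) (simp only: cell_measure[OF \<nu>])
  finally show ?thesis by (simp add: sum_divide_distrib)
qed

lemma step_graphon_measurable:
  assumes N: "1 \<le> N"
  shows "(\<lambda>(x, y). step_graphon N G x y) \<in> borel_measurable (lebesgue_on {0..1} \<Otimes>\<^sub>M lebesgue_on {0..1})"
proof -
  have [measurable]: "cell N i \<in> sets (lebesgue_on {0..1})" if "i \<in> {1..N}" for i
    by (rule cell_lebesgue[OF that])
  have "(\<lambda>z. \<Sum>i=1..N. (\<Sum>j=1..N. G i j * indicator (cell N j) (snd z)) * indicator (cell N i) (fst z))
      \<in> borel_measurable (lebesgue_on {0..1} \<Otimes>\<^sub>M lebesgue_on {0..1})"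
    by measurable
  moreover have "(case z of (x, y) \<Rightarrow> step_graphon N G x y)
      = (\<Sum>i=1..N. (\<Sum>j=1..N. G i j * indicator (cell N j) (snd z)) * indicator (cell N i) (fst z))"
    if z: "z \<in> space (lebesgue_on {0..1} \<Otimes>\<^sub>M lebesgue_on {0..1})" for z
  proof -
    obtain x y where zx: "z = (x, y)" by (cases z)
    have xy: "x \<in> {0..1}" "y \<in> {0..1}" using z by (simp_all add: zx space_pair_measure)
    show ?thesis
      unfolding zx fst_conv snd_conv prod.case step_graphon_def step_sum[OF N xy(2), symmetric]
      by (rule step_sum[OF N xy(1)])
  qed
  ultimately show ?thesis by (simp cong: measurable_cong)
qed

section \<open>Stability of equilibria and the network game\<close>

locale graphon_game = game P T F U grad A0 \<alpha> lU l\<theta> + profile_space P T F \<nu>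
  for P :: "'w measure" and T :: real and F :: "real \<Rightarrow> 'w measure"
    and U :: "'w utility" and grad :: "'w process \<Rightarrow> 'w process \<Rightarrow> 'w process \<Rightarrow> 'w process"
    and A0 :: "'w process set" and \<alpha> lU l\<theta> :: real and \<nu> :: "real measure"
begin

abbreviation joint_norm :: "'w profile \<Rightarrow> real" where
  "joint_norm a \<equiv> L2_norm (\<nu> \<Otimes>\<^sub>M \<mu>) (joint a)"

lemma space_Ainf_section: "a \<in> space_Ainf \<nu> P F T \<Longrightarrow> x \<in> {0..1} \<Longrightarrow> a x \<in> A"
  by (simp add: space_Ainf_iff)

lemma norm_Ainf_joint: "joint a \<in> L2 (\<nu> \<Otimes>\<^sub>M \<mu>) \<Longrightarrow> norm_Ainf \<nu> P T a = joint_norm a"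
  by (simp add: norm_Ainf_eq L2_measurable)

lemma space_Ainf_diff:
  assumes "a \<in> space_Ainf \<nu> P F T" "b \<in> space_Ainf \<nu> P F T"
  shows "a - b \<in> space_Ainf \<nu> P F T"
proof -
  have eq: "(a - b) x = (\<lambda>t \<omega>. a x t \<omega> - b x t \<omega>)" for x by (auto simp: fun_eq_iff)
  have "(a - b) x \<in> A" if "x \<in> {0..1}" for x
    unfolding eq by (intro diff_A space_Ainf_section assms that)
  then show ?thesis
    using assms unfolding space_Ainf_iff joint_diff by (auto intro!: L2_diff)
qed

lemma joint_norm_sections:
  assumes "joint a \<in> L2 (\<nu> \<Otimes>\<^sub>M \<mu>)" "\<And>x. x \<in> {0..1} \<Longrightarrow> case_prod (a x) \<in> L2 \<mu>"
  shows "(\<lambda>x. L2_norm \<mu> (case_prod (a x))) \<in> L2 \<nu>"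
    and "joint_norm a = L2_norm \<nu> (\<lambda>x. L2_norm \<mu> (case_prod (a x)))"
  using family_L2_iff[of "\<lambda>x. case_prod (a x)"] family_norm[of "\<lambda>x. case_prod (a x)"] assms L2_measurable[OF assms(1)]
  by (auto simp: joint_def space_label)

lemma joint_norm_diff_sections:
  assumes "a \<in> space_Ainf \<nu> P F T" "b \<in> space_Ainf \<nu> P F T"
  shows "(\<lambda>x. dist_A (a x) (b x)) \<in> L2 \<nu>"
    and "joint_norm (a - b) = L2_norm \<nu> (\<lambda>x. dist_A (a x) (b x))"
proof -
  have ab: "a - b \<in> space_Ainf \<nu> P F T" by (rule space_Ainf_diff[OF assms])
  have eq: "L2_norm \<mu> (case_prod ((a - b) x)) = dist_A (a x) (b x)" for x
    unfolding dist_A_def by (intro arg_cong[of _ _ "L2_norm \<mu>"]) auto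
  show "(\<lambda>x. dist_A (a x) (b x)) \<in> L2 \<nu>" "joint_norm (a - b) = L2_norm \<nu> (\<lambda>x. dist_A (a x) (b x))"
    using joint_norm_sections[of "a - b"] ab unfolding eq
    by (auto simp: space_Ainf_iff space_A_L2)
qed

text \<open>The perturbation is split so that \<open>K\<close> acts on the difference of profiles
  and \<open>K - K'\<close> on \<open>b'\<close> alone. Integrals may be separated at almost every
  point, where the label sections are square-integrable.\<close>

lemma dist_op_profile:
  assumes K: "sym_kernel \<nu> K" "sym_kernel \<nu> K'" "sym_kernel \<nu> (K - K')"
    and b: "b \<in> space_Ainf \<nu> P F T" "b' \<in> space_Ainf \<nu> P F T" and x: "x \<in> {0..1}"
  shows "dist_A (graphon_op_profile \<nu> K b x) (graphon_op_profile \<nu> K' b' x)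
    \<le> L2_norm \<mu> (case_prod (graphon_op_profile \<nu> K (b - b') x))
      + L2_norm \<mu> (case_prod (graphon_op_profile \<nu> (K - K') b' x))"
proof -
  interpret K: sym_kernel \<nu> K by fact
  interpret K': sym_kernel \<nu> K' by fact
  let ?p = "\<lambda>K b. case_prod (graphon_op_profile \<nu> K b x)"
  have bb: "b - b' \<in> space_Ainf \<nu> P F T" by (rule space_Ainf_diff[OF b])
  note L = op_profile_section(1)[OF K(1) b(1) x] op_profile_section(1)[OF K(2) b(2) x]
    op_profile_section(1)[OF K(1) bb x] op_profile_section(1)[OF K(3) b(2) x]
  have sec: "AE m in \<mu>. (\<lambda>y. case_prod (b y) m) \<in> L2 \<nu>" "AE m in \<mu>. (\<lambda>y. case_prod (b' y) m) \<in> L2 \<nu>"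
    using b by (auto simp: space_Ainf_iff joint_def intro!: family_AE_section)
  have "AE m in \<mu>. ?p K b m - ?p K' b' m = ?p K (b - b') m + ?p (K - K') b' m"
    using sec
  proof eventually_elim
    case (elim m)
    obtain t \<omega> where m: "m = (t, \<omega>)" by (cases m)
    have xs: "x \<in> space \<nu>" using x by (simp add: space_label)
    have i: "integrable \<nu> (\<lambda>y. K x y * b y t \<omega>)" "integrable \<nu> (\<lambda>y. K x y * b' y t \<omega>)" "integrable \<nu> (\<lambda>y. K' x y * b' y t \<omega>)"
      using elim L2_integrable_mult K.kernel_section(1)[OF xs] K'.kernel_section(1)[OF xs]
      unfolding m by auto
    then show ?case
      by (simp add: m graphon_op_profile_def graphon_op_def right_diff_distrib left_diff_distrib)
  qed
  then have "dist_A (graphon_op_profile \<nu> K b x) (graphon_op_profile \<nu> K' b' x)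
      = L2_norm \<mu> (\<lambda>m. ?p K (b - b') m + ?p (K - K') b' m)"
    unfolding dist_A_def by (intro L2_norm_cong_AE L2_measurable L2_diff L2_add L)
  also have "\<dots> \<le> L2_norm \<mu> (?p K (b - b')) + L2_norm \<mu> (?p (K - K') b')"
    by (rule L2_triangle[OF L(3,4)])
  finally show ?thesis .
qed

text \<open>One estimate for two purposes, which is why responses \<open>a\<close> and the profiles
  \<open>b\<close> they answer are kept apart. With \<open>b = a\<close> and \<open>b' = a'\<close>
  it compares equilibria of two games; with equal kernels and equal heterogeneity it makes the best
  response map a contraction.\<close>

lemma best_response_profile_stability:
  assumes K: "sym_kernel \<nu> K" "sym_kernel \<nu> K'" "sym_kernel \<nu> (K - K')"
    and prof: "a \<in> space_Ainf \<nu> P F T" "a' \<in> space_Ainf \<nu> P F T" "b \<in> space_Ainf \<nu> P F T"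
      "b' \<in> space_Ainf \<nu> P F T" "\<theta> \<in> space_Ainf \<nu> P F T" "\<theta>' \<in> space_Ainf \<nu> P F T"
    and br: "\<And>x. x \<in> {0..1} \<Longrightarrow> best_response (graphon_op_profile \<nu> K b x) (\<theta> x) (a x)"
      "\<And>x. x \<in> {0..1} \<Longrightarrow> best_response (graphon_op_profile \<nu> K' b' x) (\<theta>' x) (a' x)"
  shows "\<alpha> * joint_norm (a - a') \<le> lU * (kernel_norm \<nu> K * joint_norm (b - b'))
    + lU * (kernel_norm \<nu> (K - K') * joint_norm b') + l\<theta> * joint_norm (\<theta> - \<theta>')"
proof -
  have bb: "b - b' \<in> space_Ainf \<nu> P F T" by (rule space_Ainf_diff[OF prof(3,4)])
  have L: "joint (b - b') \<in> L2 (\<nu> \<Otimes>\<^sub>M \<mu>)" "joint b' \<in> L2 (\<nu> \<Otimes>\<^sub>M \<mu>)"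
    using bb prof(4) by (auto simp: space_Ainf_iff)
  let ?n = "\<lambda>K b x. L2_norm \<mu> (case_prod (graphon_op_profile \<nu> K b x))"
  have s1: "?n K (b - b') \<in> L2 \<nu>" "joint_norm (graphon_op_profile \<nu> K (b - b')) = L2_norm \<nu> (?n K (b - b'))"
    by (rule joint_norm_sections[OF op_profile_norm(1)[OF K(1) L(1)]], erule op_profile_section(1)[OF K(1) bb])+
  have s2: "?n (K - K') b' \<in> L2 \<nu>" "joint_norm (graphon_op_profile \<nu> (K - K') b') = L2_norm \<nu> (?n (K - K') b')"
    by (rule joint_norm_sections[OF op_profile_norm(1)[OF K(3) L(2)]], erule op_profile_section(1)[OF K(3) prof(4)])+
  note da = joint_norm_diff_sections[OF prof(1,2)] and dt = joint_norm_diff_sections[OF prof(5,6)]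
  have "\<alpha> * joint_norm (a - a') \<le> lU * joint_norm (graphon_op_profile \<nu> K (b - b'))
      + lU * joint_norm (graphon_op_profile \<nu> (K - K') b') + l\<theta> * joint_norm (\<theta> - \<theta>')"
    unfolding da(2) dt(2) s1(2) s2(2)
  proof (rule L2_norm_combine)
    fix x assume "x \<in> space \<nu>"
    then have x: "x \<in> {0..1}" by (simp add: space_label)
    have "\<alpha> * dist_A (a x) (a' x)
        \<le> lU * dist_A (graphon_op_profile \<nu> K b x) (graphon_op_profile \<nu> K' b' x) + l\<theta> * dist_A (\<theta> x) (\<theta>' x)"
      using br[OF x] op_profile_section[OF K(1) prof(3) x] op_profile_section[OF K(2) prof(4) x]
        space_Ainf_section[OF prof(5) x] space_Ainf_section[OF prof(6) x]
      by (intro best_response_lipschitz) (auto simp: almost_A_def)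
    also have "lU * dist_A (graphon_op_profile \<nu> K b x) (graphon_op_profile \<nu> K' b' x)
        \<le> lU * (L2_norm \<mu> (case_prod (graphon_op_profile \<nu> K (b - b') x))
          + L2_norm \<mu> (case_prod (graphon_op_profile \<nu> (K - K') b' x)))"
      by (intro mult_left_mono dist_op_profile K prof x lipschitz_constants_nonneg)
    finally show "\<alpha> * dist_A (a x) (a' x)
        \<le> lU * L2_norm \<mu> (case_prod (graphon_op_profile \<nu> K (b - b') x))
          + lU * L2_norm \<mu> (case_prod (graphon_op_profile \<nu> (K - K') b' x)) + l\<theta> * dist_A (\<theta> x) (\<theta>' x)"
      by (simp add: distrib_left)
  qed (use da(1) dt(1) s1(1) s2(1) alpha_pos lipschitz_constants_nonneg in \<open>auto intro: L2_measurable\<close>)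
  also have "\<dots> \<le> lU * (kernel_norm \<nu> K * joint_norm (b - b'))
      + lU * (kernel_norm \<nu> (K - K') * joint_norm b') + l\<theta> * joint_norm (\<theta> - \<theta>')"
    by (intro add_mono mult_left_mono op_profile_norm(2) K L lipschitz_constants_nonneg order_refl)
  finally show ?thesis .
qed

section \<open>Step profiles and player averages\<close>

lemma step_profile_Ainf:
  assumes N: "1 \<le> N" and a: "\<And>i. i \<in> {1..N} \<Longrightarrow> a i \<in> A"
  shows "step_profile N a \<in> space_Ainf \<nu> P F T"
proof -
  have sec: "step_profile N a x \<in> A" if "x \<in> {0..1}" for x
    using a cell_index_mem(1)[OF N that] by (simp add: step_profile_def)
  have [measurable]: "cell N i \<in> sets \<nu>" "case_prod (a i) \<in> borel_measurable \<mu>" if "i \<in> {1..N}" for i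
    using that a by (auto intro!: extends_lebesgue_sets[OF ext] cell_lebesgue L2_measurable space_A_L2)
  have "(\<lambda>z. \<Sum>i=1..N. case_prod (a i) (snd z) * indicator (cell N i) (fst z)) \<in> borel_measurable (\<nu> \<Otimes>\<^sub>M \<mu>)"
    by measurable
  moreover have "joint (step_profile N a) z = (\<Sum>i=1..N. case_prod (a i) (snd z) * indicator (cell N i) (fst z))"
    if z: "z \<in> space (\<nu> \<Otimes>\<^sub>M \<mu>)" for z
  proof -
    obtain x t \<omega> where zx: "z = (x, t, \<omega>)" by (cases z)
    have "x \<in> {0..1}" using z by (simp add: zx space_pair_measure space_label)
    from step_sum[OF N this, of "\<lambda>i. a i t \<omega>"] show ?thesis
      unfolding zx joint_simp step_profile_def fst_conv snd_conv prod.case .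
  qed
  ultimately have m: "joint (step_profile N a) \<in> borel_measurable (\<nu> \<Otimes>\<^sub>M \<mu>)"
    by (simp cong: measurable_cong)
  have "joint (step_profile N a) \<in> L2 (\<nu> \<Otimes>\<^sub>M \<mu>)"
    unfolding joint_def
  proof (subst family_L2_iff)
    show "case_prod (\<lambda>x. case_prod (step_profile N a x)) \<in> borel_measurable (\<nu> \<Otimes>\<^sub>M \<mu>)"
      using m by (simp add: joint_def)
    show "case_prod (step_profile N a x) \<in> L2 \<mu>" if "x \<in> space \<nu>" for x
      using sec that by (simp add: space_label space_A_L2)
    \<comment> \<open>There are finitely many players, so the sum of their norms bounds every
      section.\<close>
    define B where "B = (\<Sum>i=1..N. L2_norm \<mu> (case_prod (a i)))"
    have le: "L2_norm \<mu> (case_prod (step_profile N a x)) \<le> B" if "x \<in> space \<nu>" for x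
      unfolding B_def step_profile_def using cell_index_mem(1)[OF N, of x] that
      by (intro member_le_sum) (auto simp: space_label)
    show "(\<lambda>x. L2_norm \<mu> (case_prod (step_profile N a x))) \<in> L2 \<nu>"
    proof (rule L2_norm_mono(1))
      show "(\<lambda>x. L2_norm \<mu> (case_prod (step_profile N a x))) \<in> borel_measurable \<nu>"
        by (rule family_norm_measurable) (rule m[unfolded joint_def])
      show "(\<lambda>x. B) \<in> L2 \<nu>" by (simp add: L2_def)
      show "AE x in \<nu>. \<bar>L2_norm \<mu> (case_prod (step_profile N a x))\<bar> \<le> \<bar>B\<bar>"
        using le by (intro AE_I2) (metis L2_norm_nonneg abs_of_nonneg order_trans)
    qed
  qed
  with sec show ?thesis by (simp add: space_Ainf_iff)
qed

lemma joint_norm_step: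
  assumes N: "1 \<le> N" and a: "\<And>i. i \<in> {1..N} \<Longrightarrow> a i \<in> A"
  shows "(joint_norm (step_profile N a))\<^sup>2 = 1 / real N * (\<Sum>i=1..N. (L2_norm \<mu> (case_prod (a i)))\<^sup>2)"
proof -
  have "step_profile N a \<in> space_Ainf \<nu> P F T" by (rule step_profile_Ainf[OF assms])
  then have "joint_norm (step_profile N a) = L2_norm \<nu> (\<lambda>x. L2_norm \<mu> (case_prod (step_profile N a x)))"
    by (intro joint_norm_sections) (auto simp: space_Ainf_iff space_A_L2)
  then have "(joint_norm (step_profile N a))\<^sup>2 = (\<integral>x. (L2_norm \<mu> (case_prod (a (cell_index N x))))\<^sup>2 \<partial>\<nu>)"
    by (simp add: L2_norm_def[of \<nu>] step_profile_def)
  also have "\<dots> = 1 / real N * (\<Sum>i=1..N. (L2_norm \<mu> (case_prod (a i)))\<^sup>2)"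
    by (rule integral_step[OF ext N])
  finally show ?thesis .
qed

lemma joint_norm_step_diff:
  assumes N: "1 \<le> N" and a: "\<And>i. i \<in> {1..N} \<Longrightarrow> a i \<in> A" and b: "\<And>i. i \<in> {1..N} \<Longrightarrow> b i \<in> A"
  shows "(joint_norm (step_profile N a - step_profile N b))\<^sup>2 = 1 / real N * (\<Sum>i=1..N. (dist_A (a i) (b i))\<^sup>2)"
proof -
  have eq: "step_profile N a - step_profile N b = step_profile N (\<lambda>i t \<omega>. a i t \<omega> - b i t \<omega>)"
    by (auto simp: step_profile_def fun_eq_iff)
  have eq2: "L2_norm \<mu> (case_prod (\<lambda>t \<omega>. a i t \<omega> - b i t \<omega>)) = dist_A (a i) (b i)" for i
    unfolding dist_A_def by (intro arg_cong[of _ _ "L2_norm \<mu>"]) auto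
  have "(\<lambda>t \<omega>. a i t \<omega> - b i t \<omega>) \<in> A" if "i \<in> {1..N}" for i
    by (intro diff_A a b that)
  from joint_norm_step[OF N, of "\<lambda>i t \<omega>. a i t \<omega> - b i t \<omega>", OF this] show ?thesis
    unfolding eq eq2 .
qed

text \<open>The joint norm averages over players, which costs the factor
  \<open>sqrt (real N)\<close> for a single one. \<open>N\<close> is fixed during the fixed point
  argument, so the factor does no harm.\<close>

lemma dist_A_le_joint_norm:
  assumes N: "1 \<le> N" and a: "\<And>i. i \<in> {1..N} \<Longrightarrow> a i \<in> A" and b: "\<And>i. i \<in> {1..N} \<Longrightarrow> b i \<in> A"
    and i: "i \<in> {1..N}"
  shows "dist_A (a i) (b i) \<le> sqrt (real N) * joint_norm (step_profile N a - step_profile N b)"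
proof (rule power2_le_imp_le)
  have "(dist_A (a i) (b i))\<^sup>2 \<le> (\<Sum>i=1..N. (dist_A (a i) (b i))\<^sup>2)"
    by (rule member_le_sum) (use i in auto)
  also have "\<dots> = real N * (joint_norm (step_profile N a - step_profile N b))\<^sup>2"
    using N joint_norm_step_diff[of N a b, OF N a b] by (simp add: field_simps)
  finally show "(dist_A (a i) (b i))\<^sup>2 \<le> (sqrt (real N) * joint_norm (step_profile N a - step_profile N b))\<^sup>2"
    by (simp add: power_mult_distrib)
qed simp

lemma dist_A_0_process_eq:
  assumes "a \<in> A" "b \<in> A" "dist_A a b = 0"
  shows "process_eq P T a b"
proof -
  have "AE z in \<mu>. case_prod a z - case_prod b z = 0"
    using assms L2_norm_eq_0_iff[OF L2_diff[OF space_A_L2 space_A_L2, OF assms(1,2)]] unfolding dist_A_def by simp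
  then show ?thesis unfolding process_eq_iff by eventually_elim (simp add: split_beta')
qed

section \<open>Equilibria of the network game\<close>

definition aggregate :: "nat \<Rightarrow> (nat \<Rightarrow> nat \<Rightarrow> real) \<Rightarrow> (nat \<Rightarrow> 'w process) \<Rightarrow> nat \<Rightarrow> 'w process" where
  "aggregate N G a i = (\<lambda>t \<omega>. 1 / real N * (\<Sum>j=1..N. G i j * a j t \<omega>))"

text \<open>An equality of functions at every label and not just almost everywhere, so graphon
  operators and network aggregates can be exchanged by rewriting.\<close>

lemma op_profile_step:
  assumes N: "1 \<le> N"
  shows "graphon_op_profile \<nu> (step_graphon N G) (step_profile N a) x = aggregate N G a (cell_index N x)"
  unfolding graphon_op_profile_def graphon_op_def aggregate_def step_graphon_def step_profile_def
  by (intro HOL.ext integral_step[OF ext N])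

lemma network_nash_iff:
  "network_nash N A0 U \<theta> G a \<longleftrightarrow> (\<forall>i\<in>{1..N}. best_response (aggregate N G a i) (\<theta> i) (a i))"
  unfolding network_nash_def best_response_def aggregate_def by (auto simp: is_arg_max_def)

context
  fixes N :: nat and G :: "nat \<Rightarrow> nat \<Rightarrow> real"
  assumes N: "1 \<le> N"
    and G: "\<And>i j. i \<in> {1..N} \<Longrightarrow> j \<in> {1..N} \<Longrightarrow> G i j = G j i \<and> 0 \<le> G i j \<and> G i j \<le> 1"
begin

lemma step_graphon_sym_kernel: "sym_kernel \<nu> (step_graphon N G)"
  by (rule lebesgue_sym_kernel[OF ext step_graphon_measurable[OF N]])
    (use G cell_index_mem(1)[OF N] in \<open>auto simp: step_graphon_def abs_le_iff intro: order_trans\<close>)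

text \<open>The stability estimate with the same kernel and the same heterogeneity on both sides:
  the zero kernel and the zero profile remove two of its three terms.\<close>

lemma aggregate_stability:
  assumes a: "\<And>i. i \<in> {1..N} \<Longrightarrow> a i \<in> A0" "\<And>i. i \<in> {1..N} \<Longrightarrow> a' i \<in> A0"
    and b: "\<And>i. i \<in> {1..N} \<Longrightarrow> b i \<in> A0" "\<And>i. i \<in> {1..N} \<Longrightarrow> b' i \<in> A0"
    and \<theta>: "\<And>i. i \<in> {1..N} \<Longrightarrow> \<theta> i \<in> A"
    and br: "\<And>i. i \<in> {1..N} \<Longrightarrow> best_response (aggregate N G b i) (\<theta> i) (a i)"
      "\<And>i. i \<in> {1..N} \<Longrightarrow> best_response (aggregate N G b' i) (\<theta> i) (a' i)"
  shows "\<alpha> * joint_norm (step_profile N a - step_profile N a')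
    \<le> lU * kernel_norm \<nu> (step_graphon N G) * joint_norm (step_profile N b - step_profile N b')"
proof -
  let ?K = "step_graphon N G"
  have K0: "sym_kernel \<nu> (?K - ?K)"
    by (rule lebesgue_sym_kernel[OF ext]) (auto simp: split_beta')
  have "kernel_norm \<nu> (?K - ?K) \<le> 0"
    by (rule sym_kernel.kernel_norm_le[OF K0]) (simp add: graphon_op_def[abs_def])
  then have n0: "kernel_norm \<nu> (?K - ?K) = 0"
    using sym_kernel.kernel_norm_nonneg[OF K0] by simp
  have t0: "joint_norm (step_profile N \<theta> - step_profile N \<theta>) = 0"
    unfolding joint_diff by simp
  have "\<alpha> * joint_norm (step_profile N a - step_profile N a')
    \<le> lU * (kernel_norm \<nu> ?K * joint_norm (step_profile N b - step_profile N b'))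
      + lU * (kernel_norm \<nu> (?K - ?K) * joint_norm (step_profile N b'))
      + l\<theta> * joint_norm (step_profile N \<theta> - step_profile N \<theta>)"
  proof (rule best_response_profile_stability)
    show "best_response (graphon_op_profile \<nu> ?K (step_profile N b) x) (step_profile N \<theta> x) (step_profile N a x)"
      "best_response (graphon_op_profile \<nu> ?K (step_profile N b') x) (step_profile N \<theta> x) (step_profile N a' x)"
      if "x \<in> {0..1}" for x
      unfolding op_profile_step[OF N] step_profile_def by (intro br cell_index_mem(1)[OF N that])+
  qed (intro step_graphon_sym_kernel K0 step_profile_Ainf N A0_A[OF a(1)] A0_A[OF a(2)] A0_A[OF b(1)] A0_A[OF b(2)] \<theta>; assumption)+
  then show ?thesis by (simp add: n0 t0 mult.assoc)
qed

text \<open>Inherited from the operator of the step graphon, read at the labels of a cell.\<close>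

lemma aggregate_almost_A:
  assumes "\<And>i. i \<in> {1..N} \<Longrightarrow> a i \<in> A0" "i \<in> {1..N}"
  shows "almost_A (aggregate N G a i)"
proof -
  have "step_profile N a \<in> space_Ainf \<nu> P F T" by (intro step_profile_Ainf N A0_A assms)
  from op_profile_section[OF step_graphon_sym_kernel this]
  have "\<forall>x\<in>{0..1}. almost_A (aggregate N G a (cell_index N x))"
    unfolding op_profile_step[OF N] almost_A_def by blast
  then show ?thesis using assms(2) unfolding cell_index_ball[OF N, of "\<lambda>i. almost_A (aggregate N G a i)"] by blast
qed

text \<open>Two equilibria answer themselves, so their distance satisfies the contraction estimate
  with itself on the right and vanishes. Being a seminorm distance, it identifies the actions up to
  null sets.\<close>

lemma network_nash_unique:
  assumes small: "lU * kernel_norm \<nu> (step_graphon N G) < \<alpha>"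
    and \<theta>: "\<And>i. i \<in> {1..N} \<Longrightarrow> \<theta> i \<in> A"
    and a: "network_nash N A0 U \<theta> G a" and b: "network_nash N A0 U \<theta> G b" and i: "i \<in> {1..N}"
  shows "process_eq P T (b i) (a i)"
proof -
  have A0: "\<And>i. i \<in> {1..N} \<Longrightarrow> a i \<in> A0" "\<And>i. i \<in> {1..N} \<Longrightarrow> b i \<in> A0"
    using a b by (auto simp: network_nash_iff best_response_iff)
  let ?d = "joint_norm (step_profile N b - step_profile N a)"
  have "\<alpha> * ?d \<le> lU * kernel_norm \<nu> (step_graphon N G) * ?d"
    by (rule aggregate_stability) (use a b A0 \<theta> in \<open>auto simp: network_nash_iff\<close>)
  then have "(\<alpha> - lU * kernel_norm \<nu> (step_graphon N G)) * ?d \<le> 0" by (simp add: left_diff_distrib)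
  then have "?d = 0" using small L2_norm_nonneg[of "\<nu> \<Otimes>\<^sub>M \<mu>" "joint (step_profile N b - step_profile N a)"]
    by (simp add: mult_le_0_iff)
  moreover have "dist_A (b i) (a i) \<le> sqrt (real N) * ?d"
    by (intro dist_A_le_joint_norm N A0_A A0 i)
  ultimately have "dist_A (b i) (a i) = 0"
    using dist_A_nonneg[of "b i" "a i"] by simp
  then show ?thesis by (intro dist_A_0_process_eq A0_A A0 i)
qed

text \<open>Picard iteration of best responses. The contraction holds in the joint norm; convergence
  is then extracted for each player, so that completeness of \<open>A0\<close> places the limits in
  the action set.\<close>

lemma network_nash_exists:
  assumes small: "lU * kernel_norm \<nu> (step_graphon N G) < \<alpha>"
    and \<theta>: "\<And>i. i \<in> {1..N} \<Longrightarrow> \<theta> i \<in> A"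
  shows "\<exists>a. network_nash N A0 U \<theta> G a"
proof -
  \<comment> \<open>A best response is determined only up to null sets; the choice picks one
    representative.\<close>
  define \<Phi> where "\<Phi> u i = (SOME a. best_response (aggregate N G u i) (\<theta> i) a)" for u i
  have br: "best_response (aggregate N G u i) (\<theta> i) (\<Phi> u i)"
    if u: "\<And>i. i \<in> {1..N} \<Longrightarrow> u i \<in> A0" and i: "i \<in> {1..N}" for u i
  proof -
    obtain z where z: "z \<in> A" "process_eq P T (aggregate N G u i) z"
      using aggregate_almost_A[of u i, OF u i] unfolding almost_A_def by blast
    have "\<exists>a. best_response (aggregate N G u i) (\<theta> i) a"
      using best_response_exists[OF z(1) \<theta>[OF i]] by (simp add: best_response_cong[OF z(2)])
    then show ?thesis unfolding \<Phi>_def by (rule someI_ex)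
  qed
  obtain a0 where a0: "a0 \<in> A0" using A0_nonempty by blast
  define s where "s = rec_nat (\<lambda>i. a0) (\<lambda>_. \<Phi>)"
  have s_Suc: "s (Suc n) = \<Phi> (s n)" for n by (simp add: s_def)
  have sA0: "s n i \<in> A0" if "i \<in> {1..N}" for n i
    using that
  proof (induction n arbitrary: i)
    case 0
    show ?case using a0 by (simp add: s_def)
  next
    case (Suc n)
    then show ?case using br[of "s n" i] by (simp add: s_Suc best_response_iff)
  qed
  define q where "q = lU * kernel_norm \<nu> (step_graphon N G) / \<alpha>"
  have q: "0 \<le> q" "q < 1"
    using small alpha_pos lipschitz_constants_nonneg sym_kernel.kernel_norm_nonneg[OF step_graphon_sym_kernel]
    by (auto simp: q_def)
  let ?D = "\<lambda>u v. joint_norm (step_profile N u - step_profile N v)"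
  have contr: "?D (\<Phi> u) (\<Phi> v) \<le> q * ?D u v"
    if u: "\<And>i. i \<in> {1..N} \<Longrightarrow> u i \<in> A0" and v: "\<And>i. i \<in> {1..N} \<Longrightarrow> v i \<in> A0" for u v
  proof -
    have "\<alpha> * ?D (\<Phi> u) (\<Phi> v) \<le> lU * kernel_norm \<nu> (step_graphon N G) * ?D u v"
    proof (rule aggregate_stability)
      fix i assume i: "i \<in> {1..N}"
      show "best_response (aggregate N G u i) (\<theta> i) (\<Phi> u i)" "best_response (aggregate N G v i) (\<theta> i) (\<Phi> v i)"
        using br[of u i] br[of v i] u v i by blast+
      then show "\<Phi> u i \<in> A0" "\<Phi> v i \<in> A0" by (simp_all add: best_response_iff)
    qed (use u v \<theta> in auto)
    then show ?thesis using alpha_pos by (simp add: q_def field_simps)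
  qed
  have step: "?D (s (Suc n)) (s n) \<le> ?D (s 1) (s 0) * q ^ n" for n
  proof (induction n)
    case (Suc n)
    have "?D (s (Suc (Suc n))) (s (Suc n)) \<le> q * ?D (s (Suc n)) (s n)"
    proof -
      have "?D (\<Phi> (s (Suc n))) (\<Phi> (s n)) \<le> q * ?D (s (Suc n)) (s n)"
        by (rule contr) (rule sA0, assumption)+
      then show ?thesis by (simp only: s_Suc)
    qed
    also have "\<dots> \<le> q * (?D (s 1) (s 0) * q ^ n)" by (intro mult_left_mono Suc.IH q)
    finally show ?case by (simp only: mult_ac power_Suc)
  qed simp
  have "\<exists>u\<in>A0. (\<lambda>n. dist_A (s n i) u) \<longlonglongrightarrow> 0" if i: "i \<in> {1..N}" for i
  proof -
    have "dist_A (s (Suc n) i) (s n i) \<le> sqrt (real N) * ?D (s 1) (s 0) * q ^ n" for n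
    proof -
      have "dist_A (s (Suc n) i) (s n i) \<le> sqrt (real N) * ?D (s (Suc n)) (s n)"
        by (intro dist_A_le_joint_norm N A0_A sA0 i)
      also have "\<dots> \<le> sqrt (real N) * (?D (s 1) (s 0) * q ^ n)" by (intro mult_left_mono step) simp
      finally show ?thesis by (simp add: mult.assoc)
    qed
    then have "L2_Cauchy \<mu> (\<lambda>n. case_prod (s n i))"
      unfolding dist_A_def by (intro L2_Cauchy_geometric[OF _ _ q] space_A_L2 A0_A sA0 i)
    moreover have "\<forall>n. case_prod (s n i) \<in> case_prod ` A0" using sA0[OF i] by blast
    ultimately obtain g where g: "g \<in> case_prod ` A0" "(\<lambda>n. L2_norm \<mu> (\<lambda>x. case_prod (s n i) x - g x)) \<longlonglongrightarrow> 0"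
      using A0_complete unfolding L2_complete_def by meson
    from g(1) obtain u where "u \<in> A0" "g = case_prod u" by blast
    with g(2) show ?thesis unfolding dist_A_def by blast
  qed
  then obtain u where u: "\<And>i. i \<in> {1..N} \<Longrightarrow> u i \<in> A0" "\<And>i. i \<in> {1..N} \<Longrightarrow> (\<lambda>n. dist_A (s n i) (u i)) \<longlonglongrightarrow> 0"
    by metis
  have "(\<lambda>n. 1 / real N * (\<Sum>i=1..N. (dist_A (s n i) (u i))\<^sup>2)) \<longlonglongrightarrow> 1 / real N * (\<Sum>i=1..N. 0\<^sup>2)"
    by (intro tendsto_intros u(2))
  moreover have "(?D (s n) u)\<^sup>2 = 1 / real N * (\<Sum>i=1..N. (dist_A (s n i) (u i))\<^sup>2)" for n
    by (rule joint_norm_step_diff[OF N]) (rule A0_A, rule sA0 u(1), assumption)+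
  ultimately have "(\<lambda>n. (?D (s n) u)\<^sup>2) \<longlonglongrightarrow> 1 / real N * (\<Sum>i=1..N. 0\<^sup>2)"
    by (simp only:)
  from tendsto_real_sqrt[OF this] have Dlim: "(\<lambda>n. ?D (s n) u) \<longlonglongrightarrow> 0" by simp
  have "best_response (aggregate N G u i) (\<theta> i) (u i)" if i: "i \<in> {1..N}" for i
  proof -
    have \<Phi>A0: "\<Phi> u i \<in> A0" if "i \<in> {1..N}" for i using br[of u i, OF u(1) that] by (simp add: best_response_iff)
    \<comment> \<open>The iterate \<open>s (Suc n)\<close> is inserted between
      \<open>\<Phi> u i\<close> and \<open>u i\<close>: the contraction bounds the first part,
      convergence of the iteration the second.\<close>
    have "dist_A (\<Phi> u i) (u i) \<le> sqrt (real N) * (q * ?D (s n) u) + dist_A (s (Suc n) i) (u i)" for n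
    proof -
      have "dist_A (\<Phi> u i) (u i) \<le> dist_A (\<Phi> u i) (s (Suc n) i) + dist_A (s (Suc n) i) (u i)"
        unfolding dist_A_def by (intro L2_triangle_diff space_A_L2 A0_A \<Phi>A0 sA0 u(1) i)
      also have "dist_A (\<Phi> u i) (s (Suc n) i) = dist_A (s (Suc n) i) (\<Phi> u i)"
        unfolding dist_A_def by (rule L2_norm_minus_commute)
      also have "\<dots> \<le> sqrt (real N) * ?D (s (Suc n)) (\<Phi> u)"
        by (intro dist_A_le_joint_norm N A0_A sA0 \<Phi>A0 i)
      also have "\<dots> \<le> sqrt (real N) * (q * ?D (s n) u)"
        unfolding s_Suc by (intro mult_left_mono contr sA0 u(1)) auto
      finally show ?thesis by simp
    qed
    moreover have "(\<lambda>n. sqrt (real N) * (q * ?D (s n) u) + dist_A (s (Suc n) i) (u i))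
        \<longlonglongrightarrow> sqrt (real N) * (q * 0) + 0"
      by (intro tendsto_intros Dlim LIMSEQ_Suc u(2) i)
    ultimately have "dist_A (\<Phi> u i) (u i) \<le> 0"
      by (intro LIMSEQ_le_const) auto
    then have "process_eq P T (\<Phi> u i) (u i)"
      using dist_A_nonneg[of "\<Phi> u i" "u i"] by (intro dist_A_0_process_eq A0_A \<Phi>A0 u(1) i) simp
    \<comment> \<open>\<open>u\<close> is a fixed point only up to null sets. The utility does not
      see them, so \<open>u i\<close> inherits optimality from \<open>\<Phi> u i\<close>.\<close>
    then have "U (\<Phi> u i) z t = U (u i) z t" for z t
      by (rule utility_cong) (simp add: process_eq_iff)
    then show ?thesis using br[of u i, OF u(1) i] u(1)[OF i] by (simp add: best_response_iff)
  qed
  then show ?thesis unfolding network_nash_iff by blast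
qed

end

end

text \<open>Uniqueness is expressed by \<open>process_eq\<close> for each player because processes
  are represented by functions.\<close>

theorem theorem2p14:
  fixes T :: real and P :: "'w measure" and \<nu> :: "real measure" and Q :: "(real \<times> 'w) measure"
    and F :: "real \<Rightarrow> 'w measure"
    and U :: "'w process \<Rightarrow> 'w process \<Rightarrow> 'w process \<Rightarrow> real"
    and \<theta> abar :: "'w profile" and W :: "real \<Rightarrow> real \<Rightarrow> real"
    and Ax :: "real \<Rightarrow> 'w process set" and A0 :: "'w process set"
    and \<alpha>U lU l\<theta> M :: real
    and G :: "nat \<Rightarrow> nat \<Rightarrow> nat \<Rightarrow> real" and \<theta>N :: "nat \<Rightarrow> nat \<Rightarrow> 'w process"
  assumes "T > 0" and "prob_space P"
    and "extends_lebesgue_space \<nu>" and "rich_fubini_extension \<nu> P Q"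
    and "F = augmented_filtration P {0..1} \<theta>"
    and "well_defined_on_classes P T U"
    and "\<theta> \<in> space_Ainf \<nu> P F T" and "graphon W"
    and homogeneous: "\<forall>x\<in>{0..1}. Ax x = A0" "A0 \<subseteq> space_A P F T"
    and A1: "utility_condition P F T U \<alpha>U lU l\<theta>"
    and A2: "A0 \<noteq> {}" "convex_A A0" "closed_A P F T A0"
      "\<exists>z0\<in>space_A P F T. \<exists>\<theta>0\<in>space_A P F T. \<exists>b\<in>space_Ainf \<nu> P F T.
         \<forall>x\<in>{0..1}. is_arg_max (\<lambda>a. U a z0 \<theta>0) (\<lambda>a. a \<in> Ax x) (b x)"
    and A3: "A0 \<subseteq> {a \<in> space_A P F T. norm_A P T a \<le> M}"
    and A4: "lU * lambda1 \<nu> W < \<alpha>U"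
    and "graphon_nash \<nu> P F T Ax U \<theta> W abar"
    and "\<forall>N\<ge>1. \<forall>i\<in>{1..N}. \<forall>j\<in>{1..N}. G N i j = G N j i \<and> 0 \<le> G N i j \<and> G N i j \<le> 1"
    and "(\<lambda>N. cut_norm \<nu> (W - step_graphon N (G N))) \<longlonglongrightarrow> 0"
    and "\<forall>N\<ge>1. \<forall>i\<in>{1..N}. \<theta>N N i \<in> space_A P F T"
    and "\<forall>N\<ge>1. \<forall>t\<in>{0..T}. sets (augmented_filtration P {1..N} (\<theta>N N) t) \<subseteq> sets (F t)"
    and "(\<lambda>N. norm_Ainf \<nu> P T (\<theta> - step_profile N (\<theta>N N))) \<longlonglongrightarrow> 0"
  shows "let C_W = sqrt 8 * lU * M / (\<alpha>U - lU * lambda1 \<nu> W);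
             C_\<theta> = l\<theta> / (\<alpha>U - lU * lambda1 \<nu> W);
             bound = (\<lambda>N. C_W * cut_norm \<nu> (W - step_graphon N (G N)) powr (1 / 2)
                        + C_\<theta> * norm_Ainf \<nu> P T (\<theta> - step_profile N (\<theta>N N)))
         in (\<exists>N0\<ge>1. \<forall>N\<ge>N0. \<exists>aN.
               network_nash N A0 U (\<theta>N N) (G N) aN \<and>
               (\<forall>b. network_nash N A0 U (\<theta>N N) (G N) b \<longrightarrow>
                    (\<forall>i\<in>{1..N}. process_eq P T (b i) (aN i))) \<and>
               norm_Ainf \<nu> P T (abar - step_profile N aN) \<le> bound N)
            \<and> bound \<longlonglongrightarrow> 0"
proof -
  note T = assms(1) and P = assms(2) and ext = assms(3) and F = assms(5) and wd = assms(6)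
    and \<theta> = assms(7) and W = assms(8) and nash = assms(18) and G = assms(19) and cut = assms(20)
    and \<theta>N = assms(21) and \<theta>_lim = assms(23)
  interpret P: prob_space P by fact
  \<comment> \<open>Sections of a jointly measurable profile are measurable at every label and time,
    so the filtration generated by \<open>\<theta>\<close> stays inside \<open>P\<close>.\<close>
  have "\<theta> x s \<in> borel_measurable P" if x: "x \<in> {0..1}" and s: "s \<in> {0..T}" for x s
  proof -
    have m: "(\<lambda>(x, t, \<omega>). \<theta> x t \<omega>) \<in> borel_measurable (\<nu> \<Otimes>\<^sub>M (restrict_space borel {0..T} \<Otimes>\<^sub>M P))"
      using \<theta> by (simp add: space_Ainf_def)
    have "(\<lambda>\<omega>. (x, s, \<omega>)) \<in> measurable P (\<nu> \<Otimes>\<^sub>M (restrict_space borel {0..T} \<Otimes>\<^sub>M P))"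
      using x s by (intro measurable_Pair measurable_const measurable_ident)
        (auto simp: extends_lebesgue_space_eq[OF ext] space_restrict_space)
    from measurable_compose[OF this m] show ?thesis by simp
  qed
  then have filt: "space (F t) = space P" "sets (F t) \<subseteq> sets P" if "t \<in> {0..T}" for t
    unfolding F using that by (auto intro!: augmented_filtration_measure)
  obtain gr where
    gr: "\<forall>z\<in>space_A P F T. \<forall>\<theta>\<in>space_A P F T.
           (\<forall>a\<in>space_A P F T. is_gateaux_gradient P F T (\<lambda>b. U b z \<theta>) a (gr a z \<theta>)) \<and>
           norm_continuous_A P F T (\<lambda>a. gr a z \<theta>)"
    and gr_lip: "\<forall>a\<in>space_A P F T. \<forall>z1\<in>space_A P F T. \<forall>z2\<in>space_A P F T.
           \<forall>\<theta>1\<in>space_A P F T. \<forall>\<theta>2\<in>space_A P F T.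
             norm_A P T (gr a z1 \<theta>1 - gr a z2 \<theta>2)
               \<le> lU * norm_A P T (z1 - z2) + l\<theta> * norm_A P T (\<theta>1 - \<theta>2)"
    using A1 unfolding utility_condition_def by blast
  interpret graphon_game P T F U gr A0 \<alpha>U lU l\<theta> \<nu>
  proof unfold_locales
    show "0 < \<alpha>U" "\<And>z \<theta>. z \<in> space_A P F T \<Longrightarrow> \<theta> \<in> space_A P F T \<Longrightarrow>
      concave_A P F T (\<lambda>a. U a z \<theta> + \<alpha>U / 2 * (norm_A P T a)\<^sup>2)"
      using A1 unfolding utility_condition_def by blast+
  qed (use T wd homogeneous A2 filt gr gr_lip ext in auto)
  define l1 where "l1 = lambda1 \<nu> W"
  define D where "D N = W - step_graphon N (G N)" for N
  have Wm: "(\<lambda>(x, y). W x y) \<in> borel_measurable (lebesgue_on {0..1} \<Otimes>\<^sub>M lebesgue_on {0..1})"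
    and Wb: "\<And>x y. x \<in> {0..1} \<Longrightarrow> y \<in> {0..1} \<Longrightarrow> W x y = W y x \<and> 0 \<le> W x y \<and> W x y \<le> 1"
    using W unfolding graphon_def by auto
  have KW: "sym_kernel \<nu> W"
    by (rule lebesgue_sym_kernel[OF ext Wm]) (use Wb in \<open>auto simp: abs_le_iff intro: order_trans\<close>)
  have l1: "kernel_norm \<nu> W = l1"
    unfolding l1_def by (rule sym_kernel.lambda1_eq_kernel_norm[OF KW, symmetric]) (use Wb in \<open>auto simp: space_label\<close>)
  have GN: "\<And>i j. i \<in> {1..N} \<Longrightarrow> j \<in> {1..N} \<Longrightarrow> G N i j = G N j i \<and> 0 \<le> G N i j \<and> G N i j \<le> 1" if "1 \<le> N" for N
    using G that by blast
  have Dm: "(\<lambda>(x, y). D N x y) \<in> borel_measurable (lebesgue_on {0..1} \<Otimes>\<^sub>M lebesgue_on {0..1})" if "1 \<le> N" for N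
    using borel_measurable_diff[OF Wm step_graphon_measurable[OF that, of "G N"]] by (simp add: D_def split_beta')
  have Db: "D N x y = D N y x" "\<bar>D N x y\<bar> \<le> 1" if "1 \<le> N" "x \<in> {0..1}" "y \<in> {0..1}" for N x y
    using Wb[OF that(2,3)] GN[OF that(1) cell_index_mem(1)[OF that(1,2)] cell_index_mem(1)[OF that(1,3)]]
    by (auto simp: D_def step_graphon_def abs_le_iff)
  have KD: "sym_kernel \<nu> (D N)" if "1 \<le> N" for N
    by (rule lebesgue_sym_kernel[OF ext Dm]) (use Db that in auto)
  have cut_nn: "0 \<le> cut_norm \<nu> (D N)" if "1 \<le> N" for N
    by (rule cut_norm_nonneg[OF ext Dm]) (use Db that in auto)
  have KN: "sym_kernel \<nu> (step_graphon N (G N))" if "1 \<le> N" for N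
    by (rule step_graphon_sym_kernel[OF that GN[OF that]])
  have Dn: "kernel_norm \<nu> (D N) \<le> 2 * sqrt (cut_norm \<nu> (D N))" if "1 \<le> N" for N
  proof (rule power2_le_imp_le)
    have "(kernel_norm \<nu> (D N))\<^sup>2 \<le> 4 * cut_norm \<nu> (D N)"
      by (rule kernel_norm_le_cut_norm[OF ext Dm]) (use Db that in auto)
    then show "(kernel_norm \<nu> (D N))\<^sup>2 \<le> (2 * sqrt (cut_norm \<nu> (D N)))\<^sup>2"
      using cut_nn[OF that] by (simp add: power_mult_distrib)
  qed (simp add: cut_nn[OF that])
  have cut: "(\<lambda>N. cut_norm \<nu> (D N)) \<longlonglongrightarrow> 0" using cut by (simp add: D_def)
  \<comment> \<open>The bracket dominates the operator norm of the step graphon. The strict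
    inequality \<open>A4\<close> leaves room for it once the cut norm is small, which fixes the
    threshold.\<close>
  have "(\<lambda>N. lU * (l1 + 2 * sqrt (cut_norm \<nu> (D N)))) \<longlonglongrightarrow> lU * (l1 + 2 * sqrt 0)"
    by (intro tendsto_intros cut)
  from order_tendstoD(2)[OF this, of \<alpha>U] A4
  obtain N1 where N1: "\<And>N. N \<ge> N1 \<Longrightarrow> lU * (l1 + 2 * sqrt (cut_norm \<nu> (D N))) < \<alpha>U"
    by (auto simp: eventually_sequentially l1_def)
  \<comment> \<open>The maximum with 1 guarantees at least one player, as the cells require.\<close>
  have small: "lU * kernel_norm \<nu> (step_graphon N (G N)) < \<alpha>U" if N: "N \<ge> max 1 N1" for N
  proof -
    have N: "1 \<le> N" "N \<ge> N1" using N by auto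
    have "kernel_norm \<nu> (step_graphon N (G N)) \<le> l1 + 2 * sqrt (cut_norm \<nu> (D N))"
      using kernel_norm_le_add_diff[OF KW KN[OF N(1)] KD[OF N(1), unfolded D_def]] Dn[OF N(1)]
      unfolding l1 D_def by linarith
    from mult_left_mono[OF this lipschitz_constants_nonneg(1)] N1[OF N(2)] show ?thesis by linarith
  qed
  \<comment> \<open>The sign of \<open>M\<close> comes from the norm of some member of
    \<open>A0\<close>.\<close>
  obtain a0 where "a0 \<in> A0" using A2(1) by blast
  then have M: "0 \<le> M" using A3 order_trans[of 0 "norm_A P T a0" M] by (auto simp: norm_A_def)
  define \<delta> where "\<delta> = \<alpha>U - lU * l1"
  have \<delta>: "0 < \<delta>" using A4 by (simp add: \<delta>_def l1_def)
  define bound where "bound N = sqrt 8 * lU * M / \<delta> * cut_norm \<nu> (D N) powr (1 / 2)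
      + l\<theta> / \<delta> * norm_Ainf \<nu> P T (\<theta> - step_profile N (\<theta>N N))" for N
  have abar: "abar \<in> space_Ainf \<nu> P F T"
    "\<And>x. x \<in> {0..1} \<Longrightarrow> best_response (graphon_op_profile \<nu> W abar x) (\<theta> x) (abar x)"
    using nash homogeneous(1) by (auto simp: graphon_nash_def admissible_profiles_def best_response_def)
  \<comment> \<open>The estimate holds for every network equilibrium with at least one player; the
    threshold serves existence and uniqueness only.\<close>
  have est: "norm_Ainf \<nu> P T (abar - step_profile N a) \<le> bound N"
    if N: "1 \<le> N" and a: "network_nash N A0 U (\<theta>N N) (G N) a" for N a
  proof -
    have aA0: "\<And>i. i \<in> {1..N} \<Longrightarrow> a i \<in> A0" using a by (auto simp: network_nash_iff best_response_iff)
    have step: "step_profile N a \<in> space_Ainf \<nu> P F T" "step_profile N (\<theta>N N) \<in> space_Ainf \<nu> P F T"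
      using \<theta>N N by (auto intro!: step_profile_Ainf A0_A[OF aA0])
    have "joint_norm (step_profile N a) \<le> M"
    proof (rule power2_le_imp_le)
      have "(\<Sum>i=1..N. (L2_norm \<mu> (case_prod (a i)))\<^sup>2) \<le> (\<Sum>i=1..N. M\<^sup>2)"
      proof (intro sum_mono power_mono)
        fix i assume i: "i \<in> {1..N}"
        have "norm_A P T (a i) = L2_norm \<mu> (case_prod (a i))"
          by (intro norm_A_eq L2_measurable space_A_L2 A0_A aA0 i)
        then show "L2_norm \<mu> (case_prod (a i)) \<le> M" using A3 aA0[OF i] by auto
      qed simp
      then have "real N * (joint_norm (step_profile N a))\<^sup>2 \<le> real N * M\<^sup>2"
        using N joint_norm_step[of N a, OF N A0_A[OF aA0]] by (simp add: field_simps)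
      then show "(joint_norm (step_profile N a))\<^sup>2 \<le> M\<^sup>2"
        by (rule mult_left_le_imp_le) (use N in simp)
    qed (rule M)
    \<comment> \<open>The factor 2 is weakened to \<open>sqrt 8\<close> to match the claimed
      constant.\<close>
    moreover have "kernel_norm \<nu> (D N) \<le> sqrt 8 * cut_norm \<nu> (D N) powr (1 / 2)"
    proof -
      have "2 * sqrt (cut_norm \<nu> (D N)) \<le> sqrt 8 * sqrt (cut_norm \<nu> (D N))"
        by (intro mult_right_mono real_le_rsqrt) (auto simp: cut_nn[OF N])
      with Dn[OF N] show ?thesis by (simp add: powr_half_sqrt cut_nn[OF N])
    qed
    ultimately have DM: "kernel_norm \<nu> (D N) * joint_norm (step_profile N a)
        \<le> sqrt 8 * cut_norm \<nu> (D N) powr (1 / 2) * M"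
      by (intro mult_mono) auto
    \<comment> \<open>Both profiles answer themselves, so the unknown difference reappears on the
      right with factor \<open>lU * l1\<close>; moving it to the left leaves the denominator
      \<open>\<delta>\<close>.\<close>
    have "\<alpha>U * joint_norm (abar - step_profile N a)
        \<le> lU * (kernel_norm \<nu> W * joint_norm (abar - step_profile N a))
          + lU * (kernel_norm \<nu> (D N) * joint_norm (step_profile N a))
          + l\<theta> * joint_norm (\<theta> - step_profile N (\<theta>N N))"
      unfolding D_def
    proof (rule best_response_profile_stability)
      show "best_response (graphon_op_profile \<nu> (step_graphon N (G N)) (step_profile N a) x)
          (step_profile N (\<theta>N N) x) (step_profile N a x)" if "x \<in> {0..1}" for x
        using a cell_index_mem(1)[OF N that]
        unfolding network_nash_iff op_profile_step[OF N] step_profile_def by blast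
    qed (use KW KN[OF N] KD[OF N] abar step \<theta> in \<open>auto simp: D_def\<close>)
    also have "\<dots> \<le> lU * (l1 * joint_norm (abar - step_profile N a))
          + lU * (sqrt 8 * cut_norm \<nu> (D N) powr (1 / 2) * M)
          + l\<theta> * joint_norm (\<theta> - step_profile N (\<theta>N N))"
      unfolding l1 by (intro add_mono mult_left_mono DM lipschitz_constants_nonneg order_refl)
    finally have "\<delta> * joint_norm (abar - step_profile N a)
        \<le> lU * (sqrt 8 * cut_norm \<nu> (D N) powr (1 / 2) * M) + l\<theta> * joint_norm (\<theta> - step_profile N (\<theta>N N))"
      by (simp add: \<delta>_def left_diff_distrib)
    then have "joint_norm (abar - step_profile N a)
        \<le> (lU * (sqrt 8 * cut_norm \<nu> (D N) powr (1 / 2) * M) + l\<theta> * joint_norm (\<theta> - step_profile N (\<theta>N N))) / \<delta>"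
      using \<delta> by (simp add: pos_le_divide_eq mult.commute)
    also have "\<dots> = sqrt 8 * lU * M / \<delta> * cut_norm \<nu> (D N) powr (1 / 2)
        + l\<theta> / \<delta> * joint_norm (\<theta> - step_profile N (\<theta>N N))"
      by (simp add: add_divide_distrib mult_ac)
    finally show ?thesis
      using space_Ainf_diff[OF abar(1) step(1)] space_Ainf_diff[OF \<theta> step(2)]
      by (simp add: bound_def norm_Ainf_joint space_Ainf_iff)
  qed
  have "\<exists>N0\<ge>1. \<forall>N\<ge>N0. \<exists>aN. network_nash N A0 U (\<theta>N N) (G N) aN \<and>
      (\<forall>b. network_nash N A0 U (\<theta>N N) (G N) b \<longrightarrow> (\<forall>i\<in>{1..N}. process_eq P T (b i) (aN i))) \<and>
      norm_Ainf \<nu> P T (abar - step_profile N aN) \<le> bound N"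
  proof (intro exI[of _ "max 1 N1"] conjI allI impI)
    fix N assume N: "max 1 N1 \<le> N"
    then have N1: "1 \<le> N" by simp
    have th: "\<And>i. i \<in> {1..N} \<Longrightarrow> \<theta>N N i \<in> space_A P F T" using \<theta>N N1 by blast
    have "\<exists>aN. network_nash N A0 U (\<theta>N N) (G N) aN"
      by (rule network_nash_exists[OF N1 _ small[OF N]]) (use GN[OF N1] th in blast)+
    then obtain aN where aN: "network_nash N A0 U (\<theta>N N) (G N) aN" by blast
    have "process_eq P T (b i) (aN i)"
      if "network_nash N A0 U (\<theta>N N) (G N) b" "i \<in> {1..N}" for b i
      by (rule network_nash_unique[OF N1 _ small[OF N] _ aN that]) (use GN[OF N1] th in blast)+
    with aN est[OF N1 aN] show "\<exists>aN. network_nash N A0 U (\<theta>N N) (G N) aN \<and>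
      (\<forall>b. network_nash N A0 U (\<theta>N N) (G N) b \<longrightarrow> (\<forall>i\<in>{1..N}. process_eq P T (b i) (aN i))) \<and>
      norm_Ainf \<nu> P T (abar - step_profile N aN) \<le> bound N" by blast
  qed simp
  moreover have "bound \<longlonglongrightarrow> 0"
  proof -
    \<comment> \<open>The power rule asks for eventually nonnegative values, which are available
      from \<open>N = 1\<close> on, where \<open>D N\<close> is known to be a kernel.\<close>
    have "(\<lambda>N. cut_norm \<nu> (D N) powr (1 / 2)) \<longlonglongrightarrow> 0"
      by (rule tendsto_zero_powrI[OF cut tendsto_const])
        (use cut_nn in \<open>auto intro!: eventually_sequentiallyI[of 1]\<close>)
    then have "bound \<longlonglongrightarrow> sqrt 8 * lU * M / \<delta> * 0 + l\<theta> / \<delta> * 0"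
      unfolding bound_def by (intro tendsto_intros \<theta>_lim)
    then show ?thesis by simp
  qed
  ultimately show ?thesis
    unfolding Let_def bound_def D_def \<delta>_def l1_def by blast
qed

end
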